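(* Let $\boldsymbol k$ be a field of characteristic $0$, let $S=\boldsymbol k[x_1,\dots,x_n]$ with $\deg x_i\ge1$ be equipped with a Poisson bracket respecting the internal degree, $\Lambda_{ij}:=\{x_i,x_j\}$, and let $I=(f_1,\dots,f_k)$ be a Poisson ideal generated by homogeneous polynomials $f_1,\dots,f_k\in S$. Let $A=S/I$, and fix $Z_{i\mu}^\nu\in S$ with $\{x_i,f_\mu\}=\sum_{\nu}Z_{i\mu}^\nu f_\nu$. Let $\mathbb L=\mathbb L_0\oplus\mathbb L_1$ be the two-term complex of free $A$-modules with $\mathbb L_0=A^n$ (canonical basis $e_1,\dots,e_n$), $\mathbb L_1=A^k$ (canonical basis $\varepsilon_1,\dots,\varepsilon_k$) and $A$-linear differential $\partial:\mathbb L_1\to\mathbb L_0$, $\partial\varepsilon_\mu=\sum_{i=1}^n\frac{\partial f_\mu}{\partial x_i}e_i$. If $\boldsymbol f=(f_1,\dots,f_k)$ is a complete intersection, then there is a graded Lie bracket on $\mathbb L$ defined by $$[e_i,e_j]:=\sum_{l=1}^n\frac{\partial\Lambda_{ij}}{\partial x_l}e_l,\qquad [e_i,\varepsilon_\mu]:=\sum_{\nu=1}^kZ_{i\mu}^\nu\varepsilon_\nu$$ (coefficients taken modulo $I$), making $(\mathbb L,\partial,[\,,])$ a dg Lie algebroid over $\operatorname{Spec}(A)$ with anchor $\rho:\mathbb L\to D_A=\mathrm{Der}(A,A)$ given by $e_i\mapsto\{x_i,\cdot\}$ and $\varepsilon_\mu\mapsto0$. Moreover, the $A$-linear quasi-isomorphism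 $\mathbb L\to\Omega_{A|\boldsymbol k}$, $e_i\mapsto\mathrm dx_i$, $\varepsilon_\mu\mapsto0$, is compatible with the brackets. The internal degree of $[\,,]$ coincides with the internal degree of $\{\,,\}$, while $\deg\partial=0$.
   Context: A Poisson ideal is an ideal $I$ with $\{I,S\}\subseteq I$; $A$ carries the induced Poisson bracket. $\boldsymbol f$ is a complete intersection if the Koszul complex $S[y_1,\dots,y_k]$ ($y_\mu$ odd, $\partial y_\mu=f_\mu$) has no homology in homological degrees $\ge1$. A quasi-isomorphism is a map of complexes inducing an isomorphism in homology; $\Omega_{A|\boldsymbol k}$ (the Kähler differentials) is regarded as a complex concentrated in degree $0$. Dg Lie algebroid structure on $(\mathbb L,\partial)$ over $\operatorname{Spec}(A)$ with anchor $\rho$ ($|\cdot|$ the degree, $\mathbb L_0,\mathbb L_1$ in homological degrees $0,1$, finitely generated projective $A$-modules): a graded Lie bracket $[\,,]$ of degree $0$ (graded antisymmetric, satisfying the graded Jacobi identity) with $\partial[X,Y]=[\partial X,Y]+(-1)^{|X|}[X,\partial Y]$, $\partial$ being $A$-linear, and an $A$-linear morphism of graded Lie algebras $\rho:\mathbb L\to D_A$ with $\rho\circ\partial=0$ and $[X,aY]=a[X,Y]+\rho_X(a)Y$ for $a\in A$. The bracket is extended from the basis to all of $\mathbb L$ by the last rule; $[\mathbb L_1,\mathbb L_1]=0$ for degree reasons. The bracket on $\Omega_{A|\boldsymbol k}$ is the Koszul bracket $[a_1\mathrm da_2,b_1\mathrm db_2]=a_1\{a_2,b_1\}\mathrm db_2+b_1\{a_1,b_2\}\mathrm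 da_2+a_1b_1\mathrm d\{a_2,b_2\}$. Internal degrees: $\deg e_i=\deg x_i$, $\deg\varepsilon_\mu=\deg f_\mu$; the Poisson bracket respects the internal degree, with internal degree $p=\deg\{\,,\}$, if $\deg\{a,b\}=\deg a+\deg b+p$ for homogeneous $a,b$, and then the $Z_{i\mu}^\nu$ are chosen homogeneous with $\deg Z_{i\mu}^\nu=\deg x_i+\deg f_\mu+p-\deg f_\nu$.
   Formalization: That L → Ω is a quasi-isomorphism is proved only for reduced A; in general only a chain map inducing isomorphisms in all homological degrees except 1, since for S=k[x], zero bracket, f=x² one has H_1(L)≠0. *)

theory Defs
  imports "HOL-Algebra.Algebra" "HOL-Algebra.Algebraic_Closure_Type" "HOL-Library.Poly_Mapping"
begin

section \<open>Modules\<close>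

text \<open>
  The record \<^typ>\<open>('a, 'b) module\<close> extends \<^typ>\<open>'b ring\<close>, so it carries the fields
  \<^const>\<open>monoid.mult\<close> and \<^const>\<open>one\<close>; the locale \<^locale>\<open>module\<close> ignores them, and they are left
  \<^term>\<open>undefined\<close> in the modules below.
\<close>

definition lin_maps ::
    "('a, 'r) ring_scheme \<Rightarrow> ('a, 'b, 'm) module_scheme \<Rightarrow> ('a, 'c, 'n) module_scheme \<Rightarrow> ('b \<Rightarrow> 'c) set"
  where "lin_maps R M N =
    {h \<in> carrier M \<rightarrow> carrier N.
       (\<forall>x\<in>carrier M. \<forall>y\<in>carrier M. h (x \<oplus>\<^bsub>M\<^esub> y) = h x \<oplus>\<^bsub>N\<^esub> h y) \<and>
       (\<forall>a\<in>carrier R. \<forall>x\<in>carrier M. h (a \<odot>\<^bsub>M\<^esub> x) = a \<odot>\<^bsub>N\<^esub> h x)}"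

definition pow_module :: "('a, 'r) ring_scheme \<Rightarrow> 'j set \<Rightarrow> ('a, 'j \<Rightarrow> 'a) module"
  where "pow_module R J =
    \<lparr>carrier = J \<rightarrow>\<^sub>E carrier R, monoid.mult = undefined, one = undefined,
     ring.zero = (\<lambda>j\<in>J. \<zero>\<^bsub>R\<^esub>), add = (\<lambda>u v. \<lambda>j\<in>J. u j \<oplus>\<^bsub>R\<^esub> v j),
     module.smult = (\<lambda>a u. \<lambda>j\<in>J. a \<otimes>\<^bsub>R\<^esub> u j)\<rparr>"

text \<open>For infinite \<open>J\<close> the free module on \<open>J\<close> is the submodule of finitely supported families.\<close>

definition free_module :: "('a, 'r) ring_scheme \<Rightarrow> 'j set \<Rightarrow> ('a, 'j \<Rightarrow> 'a) module"
  where "free_module R J =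
    (pow_module R J)\<lparr>carrier := {u \<in> J \<rightarrow>\<^sub>E carrier R. finite {j \<in> J. u j \<noteq> \<zero>\<^bsub>R\<^esub>}}\<rparr>"

definition unit_vec :: "('a, 'r) ring_scheme \<Rightarrow> 'j set \<Rightarrow> 'j \<Rightarrow> ('j \<Rightarrow> 'a)"
  where "unit_vec R J i = (\<lambda>j\<in>J. if j = i then \<one>\<^bsub>R\<^esub> else \<zero>\<^bsub>R\<^esub>)"

definition sum_module :: "('a, 'b) module \<Rightarrow> ('a, 'c) module \<Rightarrow> ('a, 'b \<times> 'c) module"
  where "sum_module M N =
    \<lparr>carrier = carrier M \<times> carrier N, monoid.mult = undefined, one = undefined,
     ring.zero = (\<zero>\<^bsub>M\<^esub>, \<zero>\<^bsub>N\<^esub>),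
     add = (\<lambda>(x, y) (x', y'). (x \<oplus>\<^bsub>M\<^esub> x', y \<oplus>\<^bsub>N\<^esub> y')),
     module.smult = (\<lambda>a (x, y). (a \<odot>\<^bsub>M\<^esub> x, a \<odot>\<^bsub>N\<^esub> y))\<rparr>"

definition span_submodule :: "('a, 'r) ring_scheme \<Rightarrow> ('a, 'b, 'm) module_scheme \<Rightarrow> 'b set \<Rightarrow> 'b set"
  where "span_submodule R M G = \<Inter>{H. submodule H R M \<and> G \<subseteq> H}"

definition quot_module :: "('a, 'b, 'm) module_scheme \<Rightarrow> 'b set \<Rightarrow> ('a, 'b set) module"
  where "quot_module M H =
    \<lparr>carrier = a_rcosets\<^bsub>M\<^esub> H, monoid.mult = undefined, one = undefined,
     ring.zero = H, add = set_add M, module.smult = (\<lambda>a C. \<Union>x\<in>C. H +>\<^bsub>M\<^esub> (a \<odot>\<^bsub>M\<^esub> x))\<rparr>"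

text \<open>A finitely generated projective module is a direct summand of some \<open>R\<^sup>N\<close>.\<close>

definition fg_projective :: "('a, 'r) ring_scheme \<Rightarrow> ('a, 'b, 'm) module_scheme \<Rightarrow> bool"
  where "fg_projective R M \<longleftrightarrow> module R M \<and>
    (\<exists>N::nat. \<exists>s \<in> lin_maps R M (free_module R {..<N}). \<exists>r \<in> lin_maps R (free_module R {..<N}) M.
       \<forall>x\<in>carrier M. r (s x) = x)"

definition reduced :: "('a, 'r) ring_scheme \<Rightarrow> bool"
  where "reduced R \<longleftrightarrow> (\<forall>a\<in>carrier R. \<forall>m::nat. a [^]\<^bsub>R\<^esub> m = \<zero>\<^bsub>R\<^esub> \<longrightarrow> a = \<zero>\<^bsub>R\<^esub>)"


section \<open>Complexes and homology\<close>

text \<open>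
  A graded module is a module \<open>M\<close> with submodules \<open>gr d\<close> (\<open>d\<close> the homological degree) of which it is
  the internal direct sum.
\<close>

locale graded_module = module R M for R (structure) and M (structure) +
  fixes gr :: "int \<Rightarrow> 'c set"
  assumes gr_submodule: "submodule (gr d) R M"
    and gr_direct_sum: "x \<in> carrier M \<Longrightarrow>
      \<exists>!c. (\<forall>d. c d \<in> gr d) \<and> finite {d. c d \<noteq> \<zero>\<^bsub>M\<^esub>} \<and> x = (\<Oplus>\<^bsub>M\<^esub>d\<in>{d. c d \<noteq> \<zero>\<^bsub>M\<^esub>}. c d)"

locale chain_complex = graded_module R M gr
  for R (structure) and M (structure) and gr :: "int \<Rightarrow> 'c set" +
  fixes \<delta> :: "'c \<Rightarrow> 'c"
  assumes diff_linear: "\<delta> \<in> lin_maps R M M"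
    and diff_degree: "x \<in> gr d \<Longrightarrow> \<delta> x \<in> gr (d - 1)"
    and diff_diff: "x \<in> carrier M \<Longrightarrow> \<delta> (\<delta> x) = \<zero>\<^bsub>M\<^esub>"

definition chain_map ::
    "('a, 'r) ring_scheme \<Rightarrow> ('a, 'b, 'm) module_scheme \<Rightarrow> (int \<Rightarrow> 'b set) \<Rightarrow> ('b \<Rightarrow> 'b)
       \<Rightarrow> ('a, 'c, 'n) module_scheme \<Rightarrow> (int \<Rightarrow> 'c set) \<Rightarrow> ('c \<Rightarrow> 'c) \<Rightarrow> ('b \<Rightarrow> 'c) \<Rightarrow> bool"
  where "chain_map R M gr \<delta> N gr' \<delta>' h \<longleftrightarrow>
    chain_complex R M gr \<delta> \<and> chain_complex R N gr' \<delta>' \<and> h \<in> lin_maps R M N \<and>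
    (\<forall>d. \<forall>x\<in>gr d. h x \<in> gr' d) \<and> (\<forall>x\<in>carrier M. h (\<delta> x) = \<delta>' (h x))"

definition cycles :: "('a, 'b, 'm) module_scheme \<Rightarrow> (int \<Rightarrow> 'b set) \<Rightarrow> ('b \<Rightarrow> 'b) \<Rightarrow> int \<Rightarrow> 'b monoid"
  where "cycles M gr \<delta> d = \<lparr>carrier = {x \<in> gr d. \<delta> x = \<zero>\<^bsub>M\<^esub>}, monoid.mult = add M, one = ring.zero M\<rparr>"

definition boundaries :: "(int \<Rightarrow> 'b set) \<Rightarrow> ('b \<Rightarrow> 'b) \<Rightarrow> int \<Rightarrow> 'b set"
  where "boundaries gr \<delta> d = \<delta> ` gr (d + 1)"

definition homology ::
    "('a, 'b, 'm) module_scheme \<Rightarrow> (int \<Rightarrow> 'b set) \<Rightarrow> ('b \<Rightarrow> 'b) \<Rightarrow> int \<Rightarrow> 'b set monoid"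
  where "homology M gr \<delta> d = cycles M gr \<delta> d Mod boundaries gr \<delta> d"

definition homology_map ::
    "('a, 'c, 'n) module_scheme \<Rightarrow> (int \<Rightarrow> 'c set) \<Rightarrow> ('c \<Rightarrow> 'c) \<Rightarrow> int \<Rightarrow> ('b \<Rightarrow> 'c) \<Rightarrow> 'b set \<Rightarrow> 'c set"
  where "homology_map N gr' \<delta>' d h C = (\<Union>x\<in>C. boundaries gr' \<delta>' d #>\<^bsub>cycles N gr' \<delta>' d\<^esub> h x)"

definition homology_iso ::
    "('a, 'b, 'm) module_scheme \<Rightarrow> (int \<Rightarrow> 'b set) \<Rightarrow> ('b \<Rightarrow> 'b)
       \<Rightarrow> ('a, 'c, 'n) module_scheme \<Rightarrow> (int \<Rightarrow> 'c set) \<Rightarrow> ('c \<Rightarrow> 'c) \<Rightarrow> ('b \<Rightarrow> 'c) \<Rightarrow> int \<Rightarrow> bool"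
  where "homology_iso M gr \<delta> N gr' \<delta>' h d \<longleftrightarrow>
    homology_map N gr' \<delta>' d h \<in> iso (homology M gr \<delta> d) (homology N gr' \<delta>' d)"

definition quasi_isomorphism ::
    "('a, 'r) ring_scheme \<Rightarrow> ('a, 'b, 'm) module_scheme \<Rightarrow> (int \<Rightarrow> 'b set) \<Rightarrow> ('b \<Rightarrow> 'b)
       \<Rightarrow> ('a, 'c, 'n) module_scheme \<Rightarrow> (int \<Rightarrow> 'c set) \<Rightarrow> ('c \<Rightarrow> 'c) \<Rightarrow> ('b \<Rightarrow> 'c) \<Rightarrow> bool"
  where "quasi_isomorphism R M gr \<delta> N gr' \<delta>' h \<longleftrightarrow>
    chain_map R M gr \<delta> N gr' \<delta>' h \<and> (\<forall>d. homology_iso M gr \<delta> N gr' \<delta>' h d)"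

definition concentrated :: "('a, 'b, 'm) module_scheme \<Rightarrow> int \<Rightarrow> 'b set"
  where "concentrated M d = (if d = 0 then carrier M else {\<zero>\<^bsub>M\<^esub>})"


section \<open>Derivations and Kaehler differentials\<close>

text \<open>
  \<open>R\<close> is an algebra over a field \<open>k\<close> via the structure map \<open>\<iota> : k \<rightarrow> R\<close>, so \<open>c \<cdot> a\<close> is
  \<open>\<iota> c \<otimes> a\<close>.
\<close>

definition derivations :: "('k \<Rightarrow> 'a) \<Rightarrow> ('a, 'r) ring_scheme \<Rightarrow> ('a \<Rightarrow> 'a) set"
  where "derivations \<iota> R =
    {D \<in> carrier R \<rightarrow>\<^sub>E carrier R.
       (\<forall>a\<in>carrier R. \<forall>b\<in>carrier R. D (a \<oplus>\<^bsub>R\<^esub> b) = D a \<oplus>\<^bsub>R\<^esub> D b) \<and>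
       (\<forall>c. \<forall>a\<in>carrier R. D (\<iota> c \<otimes>\<^bsub>R\<^esub> a) = \<iota> c \<otimes>\<^bsub>R\<^esub> D a) \<and>
       (\<forall>a\<in>carrier R. \<forall>b\<in>carrier R. D (a \<otimes>\<^bsub>R\<^esub> b) = D a \<otimes>\<^bsub>R\<^esub> b \<oplus>\<^bsub>R\<^esub> a \<otimes>\<^bsub>R\<^esub> D b)}"

definition der_module :: "('k \<Rightarrow> 'a) \<Rightarrow> ('a, 'r) ring_scheme \<Rightarrow> ('a, 'a \<Rightarrow> 'a) module"
  where "der_module \<iota> R = (pow_module R (carrier R))\<lparr>carrier := derivations \<iota> R\<rparr>"

definition commutator :: "('a, 'r) ring_scheme \<Rightarrow> ('a \<Rightarrow> 'a) \<Rightarrow> ('a \<Rightarrow> 'a) \<Rightarrow> ('a \<Rightarrow> 'a)"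
  where "commutator R D E = (\<lambda>a\<in>carrier R. D (E a) \<ominus>\<^bsub>R\<^esub> E (D a))"

text \<open>
  \<open>\<Omega>\<close> is the free module on symbols \<open>[a]\<close>, \<open>a \<in> R\<close>, modulo additivity, \<open>k\<close>-linearity and the
  Leibniz rule.
\<close>

definition kaehler_relations :: "('k \<Rightarrow> 'a) \<Rightarrow> ('a, 'r) ring_scheme \<Rightarrow> ('a \<Rightarrow> 'a) set"
  where "kaehler_relations \<iota> R =
    (let F = free_module R (carrier R); s = unit_vec R (carrier R) in
       {s (a \<oplus>\<^bsub>R\<^esub> b) \<ominus>\<^bsub>F\<^esub> (s a \<oplus>\<^bsub>F\<^esub> s b) | a b. a \<in> carrier R \<and> b \<in> carrier R} \<union>
       {s (\<iota> c \<otimes>\<^bsub>R\<^esub> a) \<ominus>\<^bsub>F\<^esub> \<iota> c \<odot>\<^bsub>F\<^esub> s a | c a. a \<in> carrier R} \<union>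
       {s (a \<otimes>\<^bsub>R\<^esub> b) \<ominus>\<^bsub>F\<^esub> (b \<odot>\<^bsub>F\<^esub> s a \<oplus>\<^bsub>F\<^esub> a \<odot>\<^bsub>F\<^esub> s b) | a b. a \<in> carrier R \<and> b \<in> carrier R})"

definition kaehler_submodule :: "('k \<Rightarrow> 'a) \<Rightarrow> ('a, 'r) ring_scheme \<Rightarrow> ('a \<Rightarrow> 'a) set"
  where "kaehler_submodule \<iota> R =
    span_submodule R (free_module R (carrier R)) (kaehler_relations \<iota> R)"

definition kaehler :: "('k \<Rightarrow> 'a) \<Rightarrow> ('a, 'r) ring_scheme \<Rightarrow> ('a, ('a \<Rightarrow> 'a) set) module"
  where "kaehler \<iota> R = quot_module (free_module R (carrier R)) (kaehler_submodule \<iota> R)"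

definition kaehler_d :: "('k \<Rightarrow> 'a) \<Rightarrow> ('a, 'r) ring_scheme \<Rightarrow> 'a \<Rightarrow> ('a \<Rightarrow> 'a) set"
  where "kaehler_d \<iota> R a =
    kaehler_submodule \<iota> R +>\<^bsub>free_module R (carrier R)\<^esub> unit_vec R (carrier R) a"

text \<open>
  The elements \<open>a db\<close> generate \<open>\<Omega>\<close> additively, so there is at most one such bracket on
  \<^term>\<open>carrier (kaehler \<iota> R)\<close>.
\<close>

definition is_koszul_bracket ::
    "('k \<Rightarrow> 'a) \<Rightarrow> ('a, 'r) ring_scheme \<Rightarrow> ('a \<Rightarrow> 'a \<Rightarrow> 'a)
       \<Rightarrow> (('a \<Rightarrow> 'a) set \<Rightarrow> ('a \<Rightarrow> 'a) set \<Rightarrow> ('a \<Rightarrow> 'a) set) \<Rightarrow> bool"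
  where "is_koszul_bracket \<iota> R pb K \<longleftrightarrow>
    (let \<Omega> = kaehler \<iota> R; d = kaehler_d \<iota> R in
       (\<forall>x\<in>carrier \<Omega>. \<forall>y\<in>carrier \<Omega>. K x y \<in> carrier \<Omega>) \<and>
       (\<forall>x\<in>carrier \<Omega>. \<forall>y\<in>carrier \<Omega>. \<forall>z\<in>carrier \<Omega>.
          K (x \<oplus>\<^bsub>\<Omega>\<^esub> y) z = K x z \<oplus>\<^bsub>\<Omega>\<^esub> K y z \<and> K x (y \<oplus>\<^bsub>\<Omega>\<^esub> z) = K x y \<oplus>\<^bsub>\<Omega>\<^esub> K x z) \<and>
       (\<forall>a1\<in>carrier R. \<forall>a2\<in>carrier R. \<forall>b1\<in>carrier R. \<forall>b2\<in>carrier R.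
          K (a1 \<odot>\<^bsub>\<Omega>\<^esub> d a2) (b1 \<odot>\<^bsub>\<Omega>\<^esub> d b2) =
            (a1 \<otimes>\<^bsub>R\<^esub> pb a2 b1) \<odot>\<^bsub>\<Omega>\<^esub> d b2 \<oplus>\<^bsub>\<Omega>\<^esub> (b1 \<otimes>\<^bsub>R\<^esub> pb a1 b2) \<odot>\<^bsub>\<Omega>\<^esub> d a2
              \<oplus>\<^bsub>\<Omega>\<^esub> (a1 \<otimes>\<^bsub>R\<^esub> b1) \<odot>\<^bsub>\<Omega>\<^esub> d (pb a2 b2)))"


section \<open>Dg Lie algebroids\<close>

definition sign_smult :: "('a, 'b, 'm) module_scheme \<Rightarrow> int \<Rightarrow> 'b \<Rightarrow> 'b"
  where "sign_smult M d x = (if even d then x else \<ominus>\<^bsub>M\<^esub> x)"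

text \<open>
  Since derivations vanish on \<open>\<iota> k\<close>, the Leibniz rule makes the bracket \<open>k\<close>-bilinear. As \<open>D\<^sub>R\<close> sits
  in degree \<open>0\<close>, the degree \<open>0\<close> map \<open>\<rho>\<close> vanishes on \<open>gr d\<close> for \<open>d \<noteq> 0\<close>.
\<close>

locale dg_lie_algebroid = chain_complex R L gr \<delta>
  for R (structure) and L (structure) and gr :: "int \<Rightarrow> 'c set" and \<delta> :: "'c \<Rightarrow> 'c" +
  fixes br :: "'c \<Rightarrow> 'c \<Rightarrow> 'c" and \<iota> :: "'k \<Rightarrow> 'a" and \<rho> :: "'c \<Rightarrow> 'a \<Rightarrow> 'a"
  assumes gr_fg_projective: "fg_projective R (L\<lparr>carrier := gr d\<rparr>)"
    and br_degree: "\<lbrakk>x \<in> gr d; y \<in> gr e\<rbrakk> \<Longrightarrow> br x y \<in> gr (d + e)"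
    and br_add_left: "\<lbrakk>x \<in> carrier L; y \<in> carrier L; z \<in> carrier L\<rbrakk> \<Longrightarrow>
      br (x \<oplus>\<^bsub>L\<^esub> y) z = br x z \<oplus>\<^bsub>L\<^esub> br y z"
    and br_add_right: "\<lbrakk>x \<in> carrier L; y \<in> carrier L; z \<in> carrier L\<rbrakk> \<Longrightarrow>
      br x (y \<oplus>\<^bsub>L\<^esub> z) = br x y \<oplus>\<^bsub>L\<^esub> br x z"
    and br_antisym: "\<lbrakk>x \<in> gr d; y \<in> gr e\<rbrakk> \<Longrightarrow> br x y = \<ominus>\<^bsub>L\<^esub> sign_smult L (d * e) (br y x)"
    and br_jacobi: "\<lbrakk>x \<in> gr d; y \<in> gr e; z \<in> gr e'\<rbrakk> \<Longrightarrow>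
      br x (br y z) = br (br x y) z \<oplus>\<^bsub>L\<^esub> sign_smult L (d * e) (br y (br x z))"
    and br_diff: "\<lbrakk>x \<in> gr d; y \<in> gr e\<rbrakk> \<Longrightarrow>
      \<delta> (br x y) = br (\<delta> x) y \<oplus>\<^bsub>L\<^esub> sign_smult L d (br x (\<delta> y))"
    and anchor_linear: "\<rho> \<in> lin_maps R L (der_module \<iota> R)"
    and anchor_degree: "\<lbrakk>x \<in> gr d; d \<noteq> 0\<rbrakk> \<Longrightarrow> \<rho> x = \<zero>\<^bsub>der_module \<iota> R\<^esub>"
    and anchor_br: "\<lbrakk>x \<in> carrier L; y \<in> carrier L\<rbrakk> \<Longrightarrow> \<rho> (br x y) = commutator R (\<rho> x) (\<rho> y)"
    and anchor_diff: "x \<in> carrier L \<Longrightarrow> \<rho> (\<delta> x) = \<zero>\<^bsub>der_module \<iota> R\<^esub>"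
    and br_leibniz: "\<lbrakk>a \<in> carrier R; x \<in> carrier L; y \<in> carrier L\<rbrakk> \<Longrightarrow>
      br x (a \<odot>\<^bsub>L\<^esub> y) = a \<odot>\<^bsub>L\<^esub> br x y \<oplus>\<^bsub>L\<^esub> (\<rho> x a) \<odot>\<^bsub>L\<^esub> y"


section \<open>Polynomials and Poisson brackets\<close>

text \<open>\<open>S = k[x\<^sub>1,\<dots>,x\<^sub>n]\<close>, where the variables are indexed by a type \<open>'n\<close> with \<open>n\<close> elements.\<close>

type_synonym ('n, 'k) mpoly = "('n \<Rightarrow>\<^sub>0 nat) \<Rightarrow>\<^sub>0 'k"

abbreviation mpoly_ring :: "('n, 'k::field_char_0) mpoly ring"
  where "mpoly_ring \<equiv> ring_of_type_algebra"

definition mvar :: "'n \<Rightarrow> ('n, 'k::field_char_0) mpoly"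
  where "mvar i = Poly_Mapping.single (Poly_Mapping.single i 1) 1"

definition mconst :: "'k::field_char_0 \<Rightarrow> ('n, 'k) mpoly"
  where "mconst c = Poly_Mapping.single 0 c"

text \<open>Where the truncated exponent \<open>0 - 1\<close> occurs, the coefficient is \<open>0\<close>.\<close>

definition mpderiv :: "'n \<Rightarrow> ('n, 'k::field_char_0) mpoly \<Rightarrow> ('n, 'k) mpoly"
  where "mpderiv i q =
    (\<Sum>m\<in>Poly_Mapping.keys q. Poly_Mapping.single (m - Poly_Mapping.single i 1)
       (of_nat (Poly_Mapping.lookup m i) * Poly_Mapping.lookup q m))"

text \<open>The zero polynomial is homogeneous of every degree; degrees are integers.\<close>

definition homogeneous :: "('n::finite \<Rightarrow> nat) \<Rightarrow> int \<Rightarrow> ('n, 'k::field_char_0) mpoly \<Rightarrow> bool"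
  where "homogeneous w d q \<longleftrightarrow>
    (\<forall>m\<in>Poly_Mapping.keys q. int (\<Sum>i\<in>UNIV. Poly_Mapping.lookup m i * w i) = d)"

definition poisson_bracket ::
    "(('n, 'k::field_char_0) mpoly \<Rightarrow> ('n, 'k) mpoly \<Rightarrow> ('n, 'k) mpoly) \<Rightarrow> bool"
  where "poisson_bracket P \<longleftrightarrow>
    (\<forall>a b c. P (a + b) c = P a c + P b c) \<and>
    (\<forall>t a b. P (mconst t * a) b = mconst t * P a b) \<and>
    (\<forall>a b. P a b = - P b a) \<and>
    (\<forall>a b c. P a (b * c) = P a b * c + b * P a c) \<and>
    (\<forall>a b c. P a (P b c) + P b (P c a) + P c (P a b) = 0)"

definition respects_internal_degree ::
    "('n::finite \<Rightarrow> nat) \<Rightarrow> int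
       \<Rightarrow> (('n, 'k::field_char_0) mpoly \<Rightarrow> ('n, 'k) mpoly \<Rightarrow> ('n, 'k) mpoly) \<Rightarrow> bool"
  where "respects_internal_degree w p P \<longleftrightarrow>
    (\<forall>a b d e. homogeneous w d a \<longrightarrow> homogeneous w e b \<longrightarrow> homogeneous w (d + e + p) (P a b))"

definition poisson_ideal ::
    "(('n, 'k::field_char_0) mpoly \<Rightarrow> ('n, 'k) mpoly \<Rightarrow> ('n, 'k) mpoly) \<Rightarrow> ('n, 'k) mpoly set \<Rightarrow> bool"
  where "poisson_ideal P I \<longleftrightarrow> ideal I mpoly_ring \<and> (\<forall>a\<in>I. \<forall>b. P a b \<in> I)"

text \<open>
  The Koszul complex \<open>S[y\<^sub>\<mu> | \<mu> < k]\<close>: the basis monomial attached to \<open>T = {t\<^sub>1 < \<dots> < t\<^sub>d}\<close> is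
  \<open>y\<^bsub>t\<^sub>1\<^esub> \<cdots> y\<^bsub>t\<^sub>d\<^esub>\<close>, with differential \<open>\<Sum>\<^sub>j (-1)\<^bsup>j-1\<^esup> f\<^bsub>t\<^sub>j\<^esub> y\<^bsub>t\<^sub>1\<^esub> \<cdots> (omit y\<^bsub>t\<^sub>j\<^esub>) \<cdots> y\<^bsub>t\<^sub>d\<^esub>\<close>.
  In coordinates, the \<open>T\<close>-coefficient of \<open>\<partial> c\<close> collects the \<open>c (T \<union> {\<mu>})\<close> with \<open>\<mu> \<notin> T\<close>.
\<close>

definition koszul_module :: "nat \<Rightarrow> (('n, 'k::field_char_0) mpoly, nat set \<Rightarrow> ('n, 'k) mpoly) module"
  where "koszul_module k = free_module mpoly_ring (Pow {..<k})"

definition koszul_gr :: "nat \<Rightarrow> int \<Rightarrow> (nat set \<Rightarrow> ('n, 'k::field_char_0) mpoly) set"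
  where "koszul_gr k d =
    {c \<in> carrier (koszul_module k). \<forall>T\<in>Pow {..<k}. c T \<noteq> 0 \<longrightarrow> int (card T) = d}"

definition koszul_diff ::
    "nat \<Rightarrow> (nat \<Rightarrow> ('n, 'k::field_char_0) mpoly)
       \<Rightarrow> (nat set \<Rightarrow> ('n, 'k) mpoly) \<Rightarrow> (nat set \<Rightarrow> ('n, 'k) mpoly)"
  where "koszul_diff k f c =
    (\<lambda>T\<in>Pow {..<k}. \<Sum>\<mu>\<in>{..<k} - T. (- 1) ^ card {\<nu> \<in> T. \<nu> < \<mu>} * f \<mu> * c (insert \<mu> T))"

definition complete_intersection :: "nat \<Rightarrow> (nat \<Rightarrow> ('n, 'k::field_char_0) mpoly) \<Rightarrow> bool"
  where "complete_intersection k f \<longleftrightarrow>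
    (\<forall>d\<ge>1. trivial_group (homology (koszul_module k) (koszul_gr k) (koszul_diff k f) d))"


section \<open>The algebra \<open>A = S/I\<close> and the complex \<open>L\<close>\<close>

text \<open>\<open>I = (f\<^sub>0, \<dots>, f\<^bsub>k-1\<^esub>)\<close>; the generators are numbered from \<open>0\<close>.\<close>

definition gen_ideal :: "nat \<Rightarrow> (nat \<Rightarrow> ('n, 'k::field_char_0) mpoly) \<Rightarrow> ('n, 'k) mpoly set"
  where "gen_ideal k f = Idl\<^bsub>mpoly_ring\<^esub> (f ` {..<k})"

definition quot_alg :: "nat \<Rightarrow> (nat \<Rightarrow> ('n, 'k::field_char_0) mpoly) \<Rightarrow> ('n, 'k) mpoly set ring"
  where "quot_alg k f = mpoly_ring Quot (gen_ideal k f)"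

definition quot_cls ::
    "nat \<Rightarrow> (nat \<Rightarrow> ('n, 'k::field_char_0) mpoly) \<Rightarrow> ('n, 'k) mpoly \<Rightarrow> ('n, 'k) mpoly set"
  where "quot_cls k f s = gen_ideal k f +>\<^bsub>mpoly_ring\<^esub> s"

definition quot_const ::
    "nat \<Rightarrow> (nat \<Rightarrow> ('n, 'k::field_char_0) mpoly) \<Rightarrow> 'k \<Rightarrow> ('n, 'k) mpoly set"
  where "quot_const k f c = quot_cls k f (mconst c)"

definition quot_bracket ::
    "nat \<Rightarrow> (nat \<Rightarrow> ('n, 'k::field_char_0) mpoly)
       \<Rightarrow> (('n, 'k) mpoly \<Rightarrow> ('n, 'k) mpoly \<Rightarrow> ('n, 'k) mpoly)
       \<Rightarrow> ('n, 'k) mpoly set \<Rightarrow> ('n, 'k) mpoly set \<Rightarrow> ('n, 'k) mpoly set"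
  where "quot_bracket k f P a b = (\<Union>s\<in>a. \<Union>t\<in>b. quot_cls k f (P s t))"

type_synonym ('n, 'k) cot = "('n \<Rightarrow> ('n, 'k) mpoly set) \<times> (nat \<Rightarrow> ('n, 'k) mpoly set)"

definition cot_module ::
    "nat \<Rightarrow> (nat \<Rightarrow> ('n::finite, 'k::field_char_0) mpoly) \<Rightarrow> (('n, 'k) mpoly set, ('n, 'k) cot) module"
  where "cot_module k f =
    sum_module (free_module (quot_alg k f) UNIV) (free_module (quot_alg k f) {..<k})"

definition cot_gr ::
    "nat \<Rightarrow> (nat \<Rightarrow> ('n::finite, 'k::field_char_0) mpoly) \<Rightarrow> int \<Rightarrow> ('n, 'k) cot set"
  where "cot_gr k f d =
    (let L0 = free_module (quot_alg k f) UNIV; L1 = free_module (quot_alg k f) {..<k} in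
       if d = 0 then carrier L0 \<times> {\<zero>\<^bsub>L1\<^esub>}
       else if d = 1 then {\<zero>\<^bsub>L0\<^esub>} \<times> carrier L1
       else {(\<zero>\<^bsub>L0\<^esub>, \<zero>\<^bsub>L1\<^esub>)})"

definition cot_e ::
    "nat \<Rightarrow> (nat \<Rightarrow> ('n::finite, 'k::field_char_0) mpoly) \<Rightarrow> 'n \<Rightarrow> ('n, 'k) cot"
  where "cot_e k f i =
    (unit_vec (quot_alg k f) UNIV i, \<zero>\<^bsub>free_module (quot_alg k f) {..<k}\<^esub>)"

definition cot_eps ::
    "nat \<Rightarrow> (nat \<Rightarrow> ('n::finite, 'k::field_char_0) mpoly) \<Rightarrow> nat \<Rightarrow> ('n, 'k) cot"
  where "cot_eps k f \<mu> =
    (\<zero>\<^bsub>free_module (quot_alg k f) UNIV\<^esub>, unit_vec (quot_alg k f) {..<k} \<mu>)"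

text \<open>The \<open>A\<close>-linear map from \<open>L\<close> to \<open>N\<close> with \<open>e\<^sub>i \<mapsto> g i\<close> and \<open>\<epsilon>\<^sub>\<mu> \<mapsto> h \<mu>\<close>.\<close>

definition cot_lin ::
    "nat \<Rightarrow> (('n::finite, 'k::field_char_0) mpoly set, 'c, 'm) module_scheme
       \<Rightarrow> ('n \<Rightarrow> 'c) \<Rightarrow> (nat \<Rightarrow> 'c) \<Rightarrow> ('n, 'k) cot \<Rightarrow> 'c"
  where "cot_lin k N g h =
    (\<lambda>(u, v). (\<Oplus>\<^bsub>N\<^esub>i\<in>UNIV. u i \<odot>\<^bsub>N\<^esub> g i) \<oplus>\<^bsub>N\<^esub> (\<Oplus>\<^bsub>N\<^esub>\<mu>\<in>{..<k}. v \<mu> \<odot>\<^bsub>N\<^esub> h \<mu>))"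

definition cot_diff ::
    "nat \<Rightarrow> (nat \<Rightarrow> ('n::finite, 'k::field_char_0) mpoly) \<Rightarrow> ('n, 'k) cot \<Rightarrow> ('n, 'k) cot"
  where "cot_diff k f =
    (let L = cot_module k f in
       cot_lin k L (\<lambda>i. \<zero>\<^bsub>L\<^esub>)
         (\<lambda>\<mu>. \<Oplus>\<^bsub>L\<^esub>i\<in>UNIV. quot_cls k f (mpderiv i (f \<mu>)) \<odot>\<^bsub>L\<^esub> cot_e k f i))"

definition cot_anchor ::
    "nat \<Rightarrow> (nat \<Rightarrow> ('n::finite, 'k::field_char_0) mpoly)
       \<Rightarrow> (('n, 'k) mpoly \<Rightarrow> ('n, 'k) mpoly \<Rightarrow> ('n, 'k) mpoly)
       \<Rightarrow> ('n, 'k) cot \<Rightarrow> ('n, 'k) mpoly set \<Rightarrow> ('n, 'k) mpoly set"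
  where "cot_anchor k f P =
    (let A = quot_alg k f; D = der_module (quot_const k f) A in
       cot_lin k D (\<lambda>i. \<lambda>a\<in>carrier A. quot_bracket k f P (quot_cls k f (mvar i)) a) (\<lambda>\<mu>. \<zero>\<^bsub>D\<^esub>))"

definition cot_to_kaehler ::
    "nat \<Rightarrow> (nat \<Rightarrow> ('n::finite, 'k::field_char_0) mpoly)
       \<Rightarrow> ('n, 'k) cot \<Rightarrow> (('n, 'k) mpoly set \<Rightarrow> ('n, 'k) mpoly set) set"
  where "cot_to_kaehler k f =
    (let A = quot_alg k f; \<iota> = quot_const k f; \<Omega> = kaehler \<iota> A in
       cot_lin k \<Omega> (\<lambda>i. kaehler_d \<iota> A (quot_cls k f (mvar i))) (\<lambda>\<mu>. \<zero>\<^bsub>\<Omega>\<^esub>))"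

text \<open>
  Elements of \<open>L\<close> of internal degree \<open>d\<close>, where \<open>deg x\<^sub>i = deg e\<^sub>i = w i\<close> and
  \<open>deg f\<^sub>\<mu> = deg \<epsilon>\<^sub>\<mu> = df \<mu>\<close>.
\<close>

definition cot_internal ::
    "nat \<Rightarrow> (nat \<Rightarrow> ('n::finite, 'k::field_char_0) mpoly) \<Rightarrow> ('n \<Rightarrow> nat) \<Rightarrow> (nat \<Rightarrow> nat)
       \<Rightarrow> int \<Rightarrow> ('n, 'k) cot set"
  where "cot_internal k f w df d =
    {(u, v) \<in> carrier (cot_module k f).
       (\<forall>i. \<exists>s. homogeneous w (d - int (w i)) s \<and> u i = quot_cls k f s) \<and>
       (\<forall>\<mu><k. \<exists>s. homogeneous w (d - int (df \<mu>)) s \<and> v \<mu> = quot_cls k f s)}"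

end

theory Submission
  imports Defs
begin

text \<open>
  Everything is computed with polynomials and reduced modulo \<open>I\<close> at the very end. An element of
  \<open>L\<close> is represented by a tuple \<open>U\<close> of \<open>n\<close> polynomials, thought of as the one-form
  \<open>\<Sum>\<^sub>l U\<^sub>l dx\<^sub>l\<close> on affine space, and a tuple \<open>V\<close> of \<open>k\<close> polynomials, thought of as the element
  \<open>\<Sum>\<^sub>\<mu> V\<^sub>\<mu> f\<^sub>\<mu>\<close> of \<open>I\<close> (\<open>combination V\<close>).

  On one-forms the Poisson bracket induces the Koszul bracket (\<open>bracket\<close>), and \<open>U\<close> acts on polynomials
  by the derivation \<open>\<Sum>\<^sub>i U\<^sub>i {x\<^sub>i, _}\<close> (\<open>anchor U\<close>). These form a Lie algebroid over the polynomial ring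
  with no error terms (\<open>anchor_bracket\<close>, \<open>bracket_jacobi\<close>): the jacobiator is linear over polynomials in
  each slot, so it vanishes as soon as it vanishes on exact forms, where \<open>[da, db] = d{a, b}\<close> reduces it to
  the Jacobi identity of \<open>{,}\<close>.

  The \<open>Z\<close> define operators \<open>act U\<close> on the tuples \<open>V\<close> for which \<open>combination (act U V)\<close> is exactly
  \<open>anchor U (combination V)\<close>. Two of the axioms, namely that these operators form a representation of the
  Lie algebra of one-forms modulo \<open>I\<close> (flatness) and that \<open>\<partial>\<close> is a derivation of the bracket on two
  elements of degree one, each assert that some tuple is zero modulo \<open>I\<close>. For each of these tuples \<open>combination\<close> is zero, by the identities on the level of polynomials; so
  it is a syzygy of \<open>f\<close>, a Koszul one-cycle, and since that is a boundary its entries lie in \<open>I\<close>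
  (\<open>koszul_syzygy_coeff\<close>, \<open>act_flat\<close>, \<open>act_jacobian\<close>). Compatibility of \<open>\<partial>\<close> with the action of degree
  zero (\<open>bracket_jacobian\<close>) follows from \<open>\<partial> V \<equiv> d (combination V)\<close> modulo \<open>I\<close> together with
  \<open>{I, S} \<subseteq> I\<close>.

  The comparison map is onto, and by the universal property of the Kaehler differentials its kernel in
  degree zero is the image of \<open>\<partial>\<close> (\<open>\<omega>_kernel\<close>): \<open>a \<mapsto> da\<close> is a derivation from \<open>A\<close> to the cokernel of
  \<open>\<partial>\<close>. This settles homology in degree zero, and it also shows that the Koszul bracket of \<open>A\<close> is obtained
  from \<open>bracket\<close> by passing to classes, which gives the compatibility with brackets.

  For reduced \<open>A\<close> the differential \<open>\<partial>\<close> is injective. If \<open>\<partial> V = 0\<close>, then \<open>g = combination V\<close> and all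
  its partial derivatives lie in \<open>I\<close>. At a minimal prime \<open>\<pp>\<close> of the radical ideal \<open>I\<close>, such a \<open>g\<close>
  lies in \<open>\<pp>\<^sup>2\<close> after localization, because residue fields are separable over \<open>k\<close> in characteristic
  zero (\<open>conormal_zero_polys_in\<close>); hence \<open>s g \<in> I\<^sup>2\<close> for suitable \<open>s\<close> outside \<open>\<pp>\<close>
  (\<open>radical_ideal_conormal\<close>). As the \<open>f\<^sub>\<mu>\<close> form a basis of \<open>I/I\<^sup>2\<close> (\<open>conormal_coeff\<close>), \<open>s V\<^sub>\<mu> \<in> I\<close>,
  and choosing the minimal prime so as to avoid a given \<open>V\<^sub>\<mu> \<notin> I\<close> leads to a contradiction.
\<close>

section \<open>Polynomials and their derivations\<close>

lemma poly_mapping_sum_single: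
  "(\<Sum>m\<in>Poly_Mapping.keys q. Poly_Mapping.single m (Poly_Mapping.lookup q m)) = q"
  by (rule poly_mapping_eqI)
     (auto simp: lookup_sum lookup_single when_def in_keys_iff)

lemma mpoly_single_induct [case_names single add]:
  assumes "\<And>m c. Q (Poly_Mapping.single m c)" and "\<And>p q. Q p \<Longrightarrow> Q q \<Longrightarrow> Q (p + q)"
  shows "Q (q :: ('n, 'k::field_char_0) mpoly)"
proof -
  have "Q (\<Sum>m\<in>K. Poly_Mapping.single m (Poly_Mapping.lookup q m))" if "finite K" for K
    using that by induction (use assms(1)[of 0 0] in \<open>auto intro: assms\<close>)
  from this[of "Poly_Mapping.keys q"] show ?thesis
    by (simp add: poly_mapping_sum_single)
qed

lemma mpderiv_superset:
  assumes "finite K" "Poly_Mapping.keys q \<subseteq> K"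
  shows "mpderiv i q = (\<Sum>m\<in>K. Poly_Mapping.single (m - Poly_Mapping.single i 1)
       (of_nat (Poly_Mapping.lookup m i) * Poly_Mapping.lookup q m))"
  unfolding mpderiv_def
  by (rule sum.mono_neutral_left) (use assms in \<open>auto simp: in_keys_iff\<close>)

lemma mpderiv_add: "mpderiv i (p + q) = mpderiv i p + mpderiv i q"
proof -
  let ?K = "Poly_Mapping.keys p \<union> Poly_Mapping.keys q"
  have "Poly_Mapping.keys (p + q) \<subseteq> ?K" by (rule keys_add)
  then show ?thesis
    by (subst (1 2 3) mpderiv_superset[of ?K])
       (auto simp: lookup_add algebra_simps single_add sum.distrib)
qed

lemma mpderiv_single:
  "mpderiv i (Poly_Mapping.single m c) =
     Poly_Mapping.single (m - Poly_Mapping.single i 1) (of_nat (Poly_Mapping.lookup m i) * c)"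
  by (subst mpderiv_superset[of "{m}"]) auto

lemma mpderiv_mult: "mpderiv i (p * q) = mpderiv i p * q + p * mpderiv i q"
proof (induction p rule: mpoly_single_induct)
  case (single m c)
  show ?case
  proof (induction q rule: mpoly_single_induct)
    case (single m' c')
    \<comment> \<open>Subtraction of exponents is truncated, so it can only be moved past an exponent that is positive at \<open>i\<close>.\<close>
    have shift: "(a::'a \<Rightarrow>\<^sub>0 nat) + b - Poly_Mapping.single i 1 = (a - Poly_Mapping.single i 1) + b"
      if "Poly_Mapping.lookup a i \<noteq> 0" for a b
      by (rule poly_mapping_eqI) (use that in \<open>auto simp: lookup_add lookup_minus lookup_single when_def\<close>)
    show ?case
      using shift[of m m'] shift[of m' m]
      by (cases "Poly_Mapping.lookup m i = 0"; cases "Poly_Mapping.lookup m' i = 0")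
         (auto simp: mpderiv_single mult_single lookup_add single_add [symmetric] algebra_simps)
  qed (simp add: mpderiv_add algebra_simps)
qed (simp add: mpderiv_add algebra_simps)

lemma mpderiv_zero [simp]: "mpderiv i 0 = 0" by (simp add: mpderiv_def)

lemma mpderiv_uminus: "mpderiv i (- p) = - mpderiv i p"
  using mpderiv_add[of i p "- p"] by (simp add: eq_neg_iff_add_eq_0 add.commute)

lemma mpderiv_diff: "mpderiv i (p - q) = mpderiv i p - mpderiv i q"
  using mpderiv_add[of i p "- q"] by (simp add: mpderiv_uminus)

lemma mpderiv_sum: "mpderiv i (sum g K) = (\<Sum>m\<in>K. mpderiv i (g m))"
  by (induction K rule: infinite_finite_induct) (auto simp: mpderiv_add)

lemma mpderiv_mconst [simp]: "mpderiv i (mconst c) = 0"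
  by (simp add: mconst_def mpderiv_single)

lemma mconst_0 [simp]: "mconst 0 = 0" and mconst_1 [simp]: "mconst 1 = 1"
  by (simp_all add: mconst_def)

lemma mpderiv_one [simp]: "mpderiv i 1 = 0"
  using mpderiv_mconst[of i 1] by simp

lemma mpderiv_mvar: "mpderiv i (mvar j) = (if i = j then 1 else 0)"
  by (auto simp: mvar_def mpderiv_single lookup_single when_def)

lemma mconst_mult: "mconst a * mconst b = mconst (a * b)"
  by (simp add: mconst_def mult_single)

lemma mconst_of_nat: "mconst (of_nat n) = of_nat n"
  by (simp add: mconst_def)

text \<open>
  The subring \<open>k[x\<^sub>i | i \<in> V]\<close>, given by generators so that one can argue by induction on how a
  polynomial is built up; \<open>V\<close> varies because variables are adjoined one at a time in
  \<open>conormal_zero_polys_in\<close>.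
\<close>

inductive_set polys_in :: "'n set \<Rightarrow> ('n, 'k::field_char_0) mpoly set" for V where
  const: "mconst c \<in> polys_in V"
| var: "i \<in> V \<Longrightarrow> mvar i \<in> polys_in V"
| add: "a \<in> polys_in V \<Longrightarrow> b \<in> polys_in V \<Longrightarrow> a + b \<in> polys_in V"
| mult: "a \<in> polys_in V \<Longrightarrow> b \<in> polys_in V \<Longrightarrow> a * b \<in> polys_in V"

lemma single_in_polys_in: "Poly_Mapping.single m c \<in> polys_in UNIV"
proof -
  \<comment> \<open>The exponents of generated monomials form a submonoid, which contains the multiples of unit exponents.\<close>
  define M where "M = {m. Poly_Mapping.single m (1::'b) \<in> polys_in (UNIV :: 'a set)}"
  have M_add: "a + b \<in> M" if "a \<in> M" "b \<in> M" for a b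
    using polys_in.mult[of "Poly_Mapping.single a 1" _ "Poly_Mapping.single b 1"] that
    by (simp add: M_def mult_single)
  have M_0: "0 \<in> M"
    using polys_in.const[of 1] by (simp add: M_def)
  have M_single: "Poly_Mapping.single i n \<in> M" for i n
  proof (induction n)
    case (Suc n)
    have "Poly_Mapping.single i 1 \<in> M"
      using polys_in.var[of i UNIV] by (simp add: M_def mvar_def)
    from M_add[OF this Suc] show ?case by (simp add: single_add[symmetric])
  qed (simp add: M_0)
  have "(\<Sum>i\<in>K. Poly_Mapping.single i (Poly_Mapping.lookup m i)) \<in> M" if "finite K" for K
    using that by induction (auto intro: M_0 M_add M_single)
  from this[of "Poly_Mapping.keys m"] have "m \<in> M"
    by (simp add: poly_mapping_sum_single)
  then have "mconst c * Poly_Mapping.single m 1 \<in> polys_in UNIV"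
    by (auto simp: M_def intro: polys_in.intros)
  then show ?thesis by (simp add: mconst_def mult_single)
qed

lemma polys_in_UNIV: "q \<in> polys_in UNIV"
  by (induction q rule: mpoly_single_induct) (auto intro: single_in_polys_in polys_in.intros)

lemma mpoly_induct [case_names const var add mult]:
  assumes "\<And>c. Q (mconst c)" "\<And>i. Q (mvar i)" "\<And>a b. Q a \<Longrightarrow> Q b \<Longrightarrow> Q (a + b)"
    "\<And>a b. Q a \<Longrightarrow> Q b \<Longrightarrow> Q (a * b)"
  shows "Q q"
  using polys_in_UNIV[of q] by induction (auto intro: assms)

text \<open>
  A \<open>k\<close>-linear derivation of a polynomial ring is determined by its values on the variables.
\<close>

lemma derivation_chain_rule:
  fixes D :: "('n::finite, 'k::field_char_0) mpoly \<Rightarrow> ('n, 'k) mpoly"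
  assumes "\<And>c. D (mconst c) = 0" "\<And>a b. D (a + b) = D a + D b"
    "\<And>a b. D (a * b) = D a * b + a * D b"
  shows "D q = (\<Sum>l\<in>UNIV. mpderiv l q * D (mvar l))"
proof (induction q rule: mpoly_induct)
  case (var i)
  have "(\<Sum>l\<in>UNIV. mpderiv l (mvar i) * D (mvar l)) = (\<Sum>l\<in>UNIV. if l = i then D (mvar l) else 0)"
    by (rule sum.cong) (auto simp: mpderiv_mvar)
  then show ?case by simp
next
  case (mult a b)
  have "(\<Sum>l\<in>UNIV. mpderiv l (a * b) * D (mvar l))
     = (\<Sum>l\<in>UNIV. mpderiv l a * D (mvar l)) * b + a * (\<Sum>l\<in>UNIV. mpderiv l b * D (mvar l))"
    by (simp add: mpderiv_mult algebra_simps sum.distrib sum_distrib_left)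
  then show ?case by (simp add: assms mult[symmetric])
qed (auto simp: assms mpderiv_add algebra_simps sum.distrib)

lemma mpderiv_commute: "mpderiv i (mpderiv j q) = mpderiv j (mpderiv i q)"
  by (induction q rule: mpoly_induct)
     (auto simp: mpderiv_mvar mpderiv_add mpderiv_mult algebra_simps)

section \<open>Weighted homogeneous polynomials\<close>

lemma homogeneous_zero [simp]: "homogeneous w d 0"
  by (simp add: homogeneous_def)

lemma homogeneous_add: "homogeneous w d a \<Longrightarrow> homogeneous w d b \<Longrightarrow> homogeneous w d (a + b)"
  using keys_add[of a b] by (auto simp: homogeneous_def)

lemma homogeneous_uminus: "homogeneous w d a \<Longrightarrow> homogeneous w d (- a)"
  by (auto simp: homogeneous_def in_keys_iff)

lemma homogeneous_diff: "homogeneous w d a \<Longrightarrow> homogeneous w d b \<Longrightarrow> homogeneous w d (a - b)"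
  using homogeneous_add[of w d a "- b"] homogeneous_uminus by fastforce

lemma homogeneous_sum: "(\<And>m. m \<in> K \<Longrightarrow> homogeneous w d (g m)) \<Longrightarrow> homogeneous w d (sum g K)"
  by (induction K rule: infinite_finite_induct) (auto simp: homogeneous_add)

lemma homogeneous_mult:
  assumes "homogeneous w d a" "homogeneous w e b" shows "homogeneous w (d + e) (a * b)"
  unfolding homogeneous_def
proof
  fix m assume "m \<in> Poly_Mapping.keys (a * b)"
  then obtain m1 m2 where m: "m = m1 + m2" "m1 \<in> Poly_Mapping.keys a" "m2 \<in> Poly_Mapping.keys b"
    using keys_mult[of a b] by auto
  then have "int (\<Sum>i\<in>UNIV. Poly_Mapping.lookup m1 i * w i) = d"
       "int (\<Sum>i\<in>UNIV. Poly_Mapping.lookup m2 i * w i) = e"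
    using assms by (auto simp: homogeneous_def)
  then show "int (\<Sum>i\<in>UNIV. Poly_Mapping.lookup m i * w i) = d + e"
    unfolding m(1) lookup_add by (simp add: algebra_simps sum.distrib)
qed

lemma homogeneous_mvar: "homogeneous w (int (w i)) (mvar i)"
proof -
  have "(\<Sum>j\<in>UNIV. Poly_Mapping.lookup (Poly_Mapping.single i 1) j * w j)
      = (\<Sum>j\<in>UNIV. if j = i then w j else 0)"
    by (rule sum.cong) (auto simp: lookup_single when_def)
  then show ?thesis by (simp add: homogeneous_def mvar_def)
qed

lemma homogeneous_mpderiv:
  assumes "homogeneous w d q" shows "homogeneous w (d - int (w i)) (mpderiv i q)"
  unfolding mpderiv_def
proof (rule homogeneous_sum)
  fix m assume m: "m \<in> Poly_Mapping.keys q"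
  let ?e = "Poly_Mapping.single i (1::nat)"
  show "homogeneous w (d - int (w i)) (Poly_Mapping.single (m - ?e)
       (of_nat (Poly_Mapping.lookup m i) * Poly_Mapping.lookup q m))"
  proof (cases "Poly_Mapping.lookup m i = 0")
    case False
    have "m = (m - ?e) + ?e"
      by (rule poly_mapping_eqI) (use False in \<open>auto simp: lookup_add lookup_minus lookup_single when_def\<close>)
    then have "(\<Sum>j\<in>UNIV. Poly_Mapping.lookup m j * w j)
        = (\<Sum>j\<in>UNIV. Poly_Mapping.lookup (m - ?e) j * w j) + (\<Sum>j\<in>UNIV. Poly_Mapping.lookup ?e j * w j)"
      by (metis (no_types, lifting) add_mult_distrib lookup_add sum.cong sum.distrib)
    also have "(\<Sum>j\<in>UNIV. Poly_Mapping.lookup ?e j * w j) = w i"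
      using homogeneous_mvar[of w i] by (simp add: homogeneous_def mvar_def del: of_nat_sum)
    finally show ?thesis
      using assms m by (auto simp: homogeneous_def simp del: of_nat_sum)
  qed simp
qed

section \<open>Polynomials vanishing to second order along a radical ideal\<close>

text \<open>
  Ideals as subsets of a type with ring operations, so that congruences are handled with the
  arithmetic of the type; \<open>ideal_mpoly_ring_iff\<close> below identifies them with the ideals of the
  ring record of polynomials.
\<close>

locale ring_ideal =
  fixes J :: "'a::comm_ring_1 set"
  assumes zero: "0 \<in> J" and add: "a \<in> J \<Longrightarrow> b \<in> J \<Longrightarrow> a + b \<in> J"
    and mult: "a \<in> J \<Longrightarrow> c * a \<in> J"
begin

lemma mult_right: "a \<in> J \<Longrightarrow> a * c \<in> J"
  using mult[of a c] by (simp add: mult.commute)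

lemma uminus: "a \<in> J \<Longrightarrow> - a \<in> J"
  using mult[of a "- 1"] by simp

lemma diff: "a \<in> J \<Longrightarrow> b \<in> J \<Longrightarrow> a - b \<in> J"
  using add[of a "- b"] uminus by simp

lemma sum: "(\<And>m. m \<in> K \<Longrightarrow> g m \<in> J) \<Longrightarrow> sum g K \<in> J"
  by (induction K rule: infinite_finite_induct) (auto intro: zero add)

end

inductive_set ideal_square :: "'a::comm_ring_1 set \<Rightarrow> 'a set" for J where
  prod: "a \<in> J \<Longrightarrow> b \<in> J \<Longrightarrow> a * b \<in> ideal_square J"
| add: "a \<in> ideal_square J \<Longrightarrow> b \<in> ideal_square J \<Longrightarrow> a + b \<in> ideal_square J"

context ring_ideal
begin

lemma square_mult: "a \<in> ideal_square J \<Longrightarrow> c * a \<in> ideal_square J"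
proof (induction rule: ideal_square.induct)
  case (prod a b)
  then have "(c * a) * b \<in> ideal_square J"
    by (intro ideal_square.prod mult)
  then show ?case by (simp add: mult.assoc)
qed (auto simp: distrib_left intro: ideal_square.add)

text \<open>
  The complement of such an \<open>M\<close> is a prime \<open>\<pp>\<close> that is minimal over \<open>J\<close> and avoids \<open>a\<close>. The last
  property says that \<open>J\<close> and \<open>\<pp>\<close> agree after localization at \<open>\<pp>\<close>, and it is what lets statements
  about \<open>\<pp>\<close> be carried back to \<open>J\<close>. A multiplicative set avoiding \<open>J\<close>, chosen maximal by Zorn's lemma,
  has it.
\<close>

lemma maximal_multiplicative_set:
  assumes radical: "\<forall>b m. b ^ m \<in> J \<longrightarrow> b \<in> J" and a: "a \<notin> J"
  shows "\<exists>M. 1 \<in> M \<and> (\<forall>b\<in>M. \<forall>c\<in>M. b * c \<in> M) \<and> a \<in> M \<and>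
    (\<forall>b. b \<notin> M \<longleftrightarrow> (\<exists>s\<in>M. s * b \<in> J))"
proof -
  define MM where "MM = {M. 1 \<in> M \<and> (\<forall>b\<in>M. \<forall>c\<in>M. b * c \<in> M) \<and> a \<in> M \<and> M \<inter> J = {}}"
  have "range (\<lambda>n. a ^ n) \<in> MM"
  proof -
    have "1 \<in> range (\<lambda>n. a ^ n)" "a \<in> range (\<lambda>n. a ^ n)"
      using rangeI[of "\<lambda>n. a ^ n" 0] rangeI[of "\<lambda>n. a ^ n" 1] by auto
    moreover have "a ^ n * a ^ m \<in> range (\<lambda>n. a ^ n)" for n m
      by (auto simp: power_add[symmetric])
    ultimately show ?thesis
      using radical a by (auto simp: MM_def)
  qed
  then have nonempty: "MM \<noteq> {}" by auto
  have "\<exists>M\<in>MM. \<forall>W\<in>MM. M \<subseteq> W \<longrightarrow> W = M"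
  proof (rule subset_Zorn_nonempty[OF nonempty])
    fix C assume "C \<noteq> {}" and C: "subset.chain MM C"
    have CM: "W \<in> MM" if "W \<in> C" for W using C that by (auto simp: subset.chain_def)
    have "b * c \<in> Union C" if bc: "b \<in> W" "W \<in> C" "c \<in> Y" "Y \<in> C" for b c W Y
    proof -
      have "W \<subseteq> Y \<or> Y \<subseteq> W" using C bc by (auto simp: subset.chain_def)
      then obtain U where "U \<in> C" "b \<in> U" "c \<in> U" using bc by blast
      then show ?thesis using CM[of U] by (auto simp: MM_def)
    qed
    moreover have "1 \<in> Union C" "a \<in> Union C"
      using \<open>C \<noteq> {}\<close> CM by (auto simp: MM_def)
    moreover have "Union C \<inter> J = {}" using CM by (auto simp: MM_def)
    ultimately show "Union C \<in> MM" unfolding MM_def by blast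
  qed
  then obtain M where M: "M \<in> MM" and max: "\<And>W. W \<in> MM \<Longrightarrow> M \<subseteq> W \<Longrightarrow> W = M"
    by auto
  have M1: "1 \<in> M" and M2: "\<And>b c. b \<in> M \<Longrightarrow> c \<in> M \<Longrightarrow> b * c \<in> M" and M3: "a \<in> M"
    and M4: "M \<inter> J = {}"
    using M by (auto simp: MM_def)
  have "\<exists>s\<in>M. s * b \<in> J" if b: "b \<notin> M" for b
  proof (rule ccontr)
    assume no: "\<not> (\<exists>s\<in>M. s * b \<in> J)"
    \<comment> \<open>If nothing in \<open>M\<close> carries \<open>b\<close> into \<open>J\<close>, adjoining the powers of \<open>b\<close> keeps the set off \<open>J\<close>, as \<open>J\<close> is radical; this contradicts maximality.\<close>
    let ?X = "{s * b ^ n | s n. s \<in> M}"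
    have "s * b ^ n \<notin> J" if "s \<in> M" for s n
    proof
      assume "s * b ^ n \<in> J"
      from mult[OF this, of "s ^ n * b"]
      have "s ^ Suc n * b ^ Suc n \<in> J" by (simp add: algebra_simps)
      then have "(s * b) ^ Suc n \<in> J" by (simp only: power_mult_distrib)
      then show False using radical no that by blast
    qed
    moreover have "M \<subseteq> ?X" by (auto intro!: exI[of _ "0::nat"])
    moreover have "s * b ^ n * (t * b ^ m) \<in> ?X" if "s \<in> M" "t \<in> M" for s t n m
    proof -
      have "s * b ^ n * (t * b ^ m) = (s * t) * b ^ (n + m)"
        by (simp add: power_add algebra_simps)
      then show ?thesis using M2 that by blast
    qed
    ultimately have "?X \<in> MM"
      using M1 M3 unfolding MM_def by blast
    from max[OF this \<open>M \<subseteq> ?X\<close>] have "?X = M" .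
    moreover have "b \<in> ?X"
      by (rule CollectI, rule exI[of _ 1], rule exI[of _ 1]) (simp add: M1)
    ultimately show False using b by simp
  qed
  moreover have "b \<notin> M" if "s \<in> M" "s * b \<in> J" for s b
    using that M2 M4 by blast
  ultimately have "b \<notin> M \<longleftrightarrow> (\<exists>s\<in>M. s * b \<in> J)" for b
    by (metis (no_types))
  with M1 M2 M3 show ?thesis
    by (intro exI[of _ M]) simp
qed

end

lemma polys_in_zero [simp]: "0 \<in> polys_in V" and polys_in_one [simp]: "1 \<in> polys_in V"
  using polys_in.const[of 0 V] polys_in.const[of 1 V] by simp_all

lemma polys_in_uminus: "a \<in> polys_in V \<Longrightarrow> - a \<in> polys_in V"
  using polys_in.mult[OF polys_in.const[of "- 1" V], of a]
  by (simp add: mconst_def single_uminus)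

lemma polys_in_diff: "a \<in> polys_in V \<Longrightarrow> b \<in> polys_in V \<Longrightarrow> a - b \<in> polys_in V"
  using polys_in.add[of a V "- b"] polys_in_uminus by fastforce

lemma polys_in_sum: "(\<And>m. m \<in> K \<Longrightarrow> g m \<in> polys_in V) \<Longrightarrow> sum g K \<in> polys_in V"
  by (induction K rule: infinite_finite_induct) (auto intro: polys_in.add)

lemma polys_in_of_nat: "of_nat n \<in> polys_in V"
  using polys_in.const[of "of_nat n" V] by (simp add: mconst_of_nat)

lemma mpderiv_polys_in: "a \<in> polys_in V \<Longrightarrow> mpderiv i a \<in> polys_in V"
  by (induction rule: polys_in.induct)
     (auto simp: mpderiv_mvar mpderiv_add mpderiv_mult intro: polys_in.intros)

lemma mpderiv_polys_in_outside: "a \<in> polys_in V \<Longrightarrow> i \<notin> V \<Longrightarrow> mpderiv i a = 0"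
  by (induction rule: polys_in.induct) (auto simp: mpderiv_mvar mpderiv_add mpderiv_mult)

text \<open>
  The derivative is taken over an arbitrary commutative ring of coefficients, since the
  coefficients will themselves be polynomials in other variables.
\<close>

definition formal_pderiv :: "'a::comm_ring_1 poly \<Rightarrow> 'a poly" where
  "formal_pderiv r = poly_of_list (map (\<lambda>j. of_nat (Suc j) * coeff r (Suc j)) [0..<degree r])"

lemma coeff_formal_pderiv: "coeff (formal_pderiv r) j = of_nat (Suc j) * coeff r (Suc j)"
  by (auto simp: formal_pderiv_def nth_default_def coeff_eq_0 simp del: of_nat_Suc)

lemma formal_pderiv_pCons: "formal_pderiv (pCons a r) = r + pCons 0 (formal_pderiv r)"
  by (auto simp: poly_eq_iff coeff_formal_pderiv coeff_pCons algebra_simps split: nat.splits)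

lemma formal_pderiv_0 [simp]: "formal_pderiv 0 = 0"
  by (simp add: poly_eq_iff coeff_formal_pderiv)

definition upolys_in :: "'n set \<Rightarrow> ('n, 'k::field_char_0) mpoly poly set" where
  "upolys_in V = {r. \<forall>j. coeff r j \<in> polys_in V}"

lemma upolys_in_intros:
  "0 \<in> upolys_in V"
  "r \<in> upolys_in V \<Longrightarrow> t \<in> upolys_in V \<Longrightarrow> r + t \<in> upolys_in V"
  "r \<in> upolys_in V \<Longrightarrow> t \<in> upolys_in V \<Longrightarrow> r - t \<in> upolys_in V"
  "r \<in> upolys_in V \<Longrightarrow> t \<in> upolys_in V \<Longrightarrow> r * t \<in> upolys_in V"
  "c \<in> polys_in V \<Longrightarrow> r \<in> upolys_in V \<Longrightarrow> smult c r \<in> upolys_in V"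
  "c \<in> polys_in V \<Longrightarrow> monom c m \<in> upolys_in V"
  "r \<in> upolys_in V \<Longrightarrow> formal_pderiv r \<in> upolys_in V"
  "r \<in> upolys_in V \<Longrightarrow> map_poly (mpderiv i) r \<in> upolys_in V"
  by (auto simp: upolys_in_def coeff_mult coeff_formal_pderiv coeff_map_poly mpderiv_polys_in
      intro!: polys_in_diff polys_in_sum polys_in_of_nat intro: polys_in.intros
      simp del: of_nat_Suc)

text \<open>
  \<open>k[V, x]\<close> consists of the polynomials in \<open>x\<close> over \<open>k[V]\<close>, evaluated at \<open>x\<close>.
\<close>

lemma polys_in_insert:
  assumes "a \<in> polys_in (insert x V)"
  obtains r where "r \<in> upolys_in V" "a = poly r (mvar x)"
proof -
  from assms have "\<exists>r. r \<in> upolys_in V \<and> a = poly r (mvar x)"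
  proof (induction rule: polys_in.induct)
    case (const c)
    have "[:mconst c:] \<in> upolys_in V"
      by (auto simp: upolys_in_def coeff_pCons polys_in.intros split: nat.splits)
    then show ?case by (intro exI[of _ "[:mconst c:]"]) auto
  next
    case (var i)
    show ?case
    proof (cases "i \<in> V")
      case True
      have "[:mvar i:] \<in> upolys_in V"
        using True by (auto simp: upolys_in_def coeff_pCons polys_in.intros split: nat.splits)
      then show ?thesis by (intro exI[of _ "[:mvar i:]"]) auto
    next
      case False
      have "monom 1 1 \<in> upolys_in V" by (intro upolys_in_intros(6)) simp
      then show ?thesis using var False by (intro exI[of _ "monom 1 1"]) (auto simp: poly_monom)
    qed
  next
    case (add a b)
    then show ?case by (metis poly_add upolys_in_intros(2))
  next
    case (mult a b)
    then show ?case by (metis poly_mult upolys_in_intros(4))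
  qed
  then show ?thesis using that by blast
qed

lemma mpderiv_poly:
  "mpderiv i (poly r y) = poly (map_poly (mpderiv i) r) y + poly (formal_pderiv r) y * mpderiv i y"
  by (induction r)
     (auto simp: mpderiv_add mpderiv_mult map_poly_pCons formal_pderiv_pCons algebra_simps)

text \<open>
  Division with remainder without dividing by coefficients: multiplying \<open>g\<close> by a power of the leading
  coefficient of \<open>h\<close> takes the place of making \<open>h\<close> monic. The bound on the remainder is stated by
  vanishing coefficients, so that for constant \<open>h\<close> it says that the remainder is zero.
\<close>

lemma pseudo_division_upolys_in:
  assumes h: "h \<in> upolys_in V" and g: "g \<in> upolys_in V"
  obtains m q r where "q \<in> upolys_in V" "r \<in> upolys_in V" "\<forall>j\<ge>degree h. coeff r j = 0"
    "smult (lead_coeff h ^ m) g = q * h + r"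
proof -
  define c where "c = lead_coeff h"
  have c: "c \<in> polys_in V" using h by (auto simp: c_def upolys_in_def)
  have "\<exists>m q r. q \<in> upolys_in V \<and> r \<in> upolys_in V \<and> (\<forall>j\<ge>degree h. coeff r j = 0) \<and>
      smult (c ^ m) g = q * h + r"
    if "\<forall>j\<ge>n. coeff g j = 0" "g \<in> upolys_in V" for n
    using that
  proof (induction n arbitrary: g)
    case 0
    then show ?case
      by (intro exI[of _ "0 :: nat"] exI[of _ "0 :: ('a, 'b) mpoly poly"])
         (auto simp: upolys_in_intros poly_eq_iff)
  next
    case (Suc n)
    show ?case
    proof (cases "n < degree h")
      case True
      with Suc.prems show ?thesis
        by (intro exI[of _ "0 :: nat"] exI[of _ "0 :: ('a, 'b) mpoly poly"] exI[of _ g])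
           (auto simp: upolys_in_intros)
    next
      case False
      \<comment> \<open>One step of long division: after scaling \<open>g\<close> by \<open>c\<close>, subtracting \<open>u h\<close> cancels the coefficient at \<open>n\<close>.\<close>
      define u where "u = monom (coeff g n) (n - degree h)"
      define g' where "g' = smult c g - u * h"
      have u: "u \<in> upolys_in V"
        using Suc.prems by (auto simp: u_def upolys_in_def intro!: upolys_in_intros)
      have "g' \<in> upolys_in V"
        unfolding g'_def using u c h Suc.prems by (intro upolys_in_intros)
      moreover have "coeff g' j = 0" if "j \<ge> n" for j
      proof (cases "j = n")
        case True
        then show ?thesis using False
          by (simp add: g'_def u_def coeff_monom_mult c_def)
      next
        case neq: False
        then have "j - (n - degree h) > degree h" using that False by auto
        then show ?thesis using Suc.prems(1) that neq
          by (simp add: g'_def u_def coeff_monom_mult coeff_eq_0)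
      qed
      ultimately obtain m q r where *: "q \<in> upolys_in V" "r \<in> upolys_in V"
        "\<forall>j\<ge>degree h. coeff r j = 0" "smult (c ^ m) g' = q * h + r"
        using Suc.IH by blast
      have "smult (c ^ Suc m) g = smult (c ^ m) g' + smult (c ^ m) u * h"
        by (simp add: g'_def smult_diff_right mult.commute)
      also have "\<dots> = (q + smult (c ^ m) u) * h + r"
        by (simp add: *(4) algebra_simps)
      finally have "smult (c ^ Suc m) g = (q + smult (c ^ m) u) * h + r" .
      moreover have "c ^ m \<in> polys_in V"
        by (induction m) (auto intro: polys_in.mult c)
      then have "q + smult (c ^ m) u \<in> upolys_in V"
        using * u by (intro upolys_in_intros)
      ultimately show ?thesis using * by blast
    qed
  qed
  from this[of "Suc (degree g)"] show ?thesis
    using that g by (auto simp: c_def coeff_eq_0 Suc_le_eq)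
qed

locale prime_ideal_mpoly = ring_ideal \<pp> for \<pp> :: "('n, 'k::field_char_0) mpoly set" +
  assumes one: "1 \<notin> \<pp>" and prime: "a * b \<in> \<pp> \<Longrightarrow> a \<in> \<pp> \<or> b \<in> \<pp>"
begin

lemma mconst_in_iff: "mconst c \<in> \<pp> \<longleftrightarrow> c = 0"
proof
  assume *: "mconst c \<in> \<pp>"
  show "c = 0"
  proof (rule ccontr)
    assume "c \<noteq> 0"
    with mult[OF *, of "mconst (inverse c)"] one show False by (simp add: mconst_mult)
  qed
qed (simp add: zero)

lemma of_nat_in_iff: "of_nat n \<in> \<pp> \<longleftrightarrow> n = 0"
  using mconst_in_iff[of "of_nat n"] by (simp add: mconst_of_nat)

lemma power: "a \<notin> \<pp> \<Longrightarrow> a ^ n \<notin> \<pp>"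
  by (induction n) (use one prime in auto)

text \<open>
  \<open>g\<close> becomes zero in \<open>\<pp>/\<pp>\<^sup>2\<close> localized at \<open>\<pp>\<close>, the conormal space at the generic point of the
  variety of \<open>\<pp>\<close>.
\<close>

definition conormal_zero :: "('n, 'k) mpoly \<Rightarrow> bool" where
  "conormal_zero g \<longleftrightarrow> (\<exists>s. s \<notin> \<pp> \<and> s * g \<in> ideal_square \<pp>)"

lemma conormal_zero_add:
  assumes "conormal_zero g" "conormal_zero g'" shows "conormal_zero (g + g')"
proof -
  from assms obtain s s' where s: "s \<notin> \<pp>" "s * g \<in> ideal_square \<pp>" "s' \<notin> \<pp>" "s' * g' \<in> ideal_square \<pp>"
    by (auto simp: conormal_zero_def)
  then have "s' * (s * g) + s * (s' * g') \<in> ideal_square \<pp>"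
    by (intro ideal_square.add[OF square_mult square_mult])
  moreover have "s' * (s * g) + s * (s' * g') = (s * s') * (g + g')"
    by (simp add: algebra_simps)
  moreover have "s * s' \<notin> \<pp>" using s prime by blast
  ultimately show ?thesis by (auto simp: conormal_zero_def)
qed

lemma conormal_zero_square: "g \<in> ideal_square \<pp> \<Longrightarrow> conormal_zero g"
  using one by (auto simp: conormal_zero_def intro!: exI[of _ 1])

lemma conormal_zero_mult: assumes "conormal_zero g" shows "conormal_zero (c * g)"
proof -
  from assms obtain s where "s \<notin> \<pp>" "s * g \<in> ideal_square \<pp>" by (auto simp: conormal_zero_def)
  with square_mult[of "s * g" c] show ?thesis
    by (auto simp: conormal_zero_def algebra_simps)
qed

lemma conormal_zero_cancel: assumes "conormal_zero (c * g)" "c \<notin> \<pp>" shows "conormal_zero g"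
  using assms prime unfolding conormal_zero_def by (metis mult.assoc)

lemma conormal_zero_sum: "(\<And>m. m \<in> K \<Longrightarrow> conormal_zero (g m)) \<Longrightarrow> conormal_zero (sum g K)"
  using conormal_zero_square[OF ideal_square.prod[OF zero zero]]
  by (induction K rule: infinite_finite_induct) (auto intro: conormal_zero_add)

text \<open>
  If \<open>1, x, \<dots>, x\<^bsup>d-1\<^esup>\<close> are linearly independent over \<open>k[V]\<close> modulo \<open>\<pp>\<close> (\<open>indep\<close>), then membership in
  \<open>\<pp>\<close> of a polynomial in \<open>x\<close> of degree below \<open>d\<close>, and of its derivatives in directions other than
  \<open>x\<close>, is inherited by its coefficients. These live in \<open>k[V]\<close>, where the claim is supposed to be known.
\<close>

lemma conormal_zero_poly:
  assumes V: "\<And>a. a \<in> polys_in V \<Longrightarrow> a \<in> \<pp> \<Longrightarrow> (\<And>i. mpderiv i a \<in> \<pp>) \<Longrightarrow> conormal_zero a"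
    and indep: "\<And>t. t \<in> upolys_in V \<Longrightarrow> (\<forall>j\<ge>d. coeff t j = 0) \<Longrightarrow> poly t (mvar x) \<in> \<pp> \<Longrightarrow> \<forall>j. coeff t j \<in> \<pp>"
    and x: "x \<notin> V" and r: "r \<in> upolys_in V" "\<forall>j\<ge>d. coeff r j = 0"
    and in_p: "poly r (mvar x) \<in> \<pp>" "\<And>i. i \<noteq> x \<Longrightarrow> mpderiv i (poly r (mvar x)) \<in> \<pp>"
  shows "conormal_zero (poly r (mvar x))"
proof -
  have "conormal_zero (coeff r j)" for j
  proof (rule V)
    show "coeff r j \<in> polys_in V" using r by (auto simp: upolys_in_def)
    then have x0: "mpderiv x (coeff r j) = 0" using x by (rule mpderiv_polys_in_outside)
    show "coeff r j \<in> \<pp>" using indep[OF r in_p(1)] by simp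
    show "mpderiv i (coeff r j) \<in> \<pp>" for i
    proof (cases "i = x")
      case False
      then have "mpderiv i (poly r (mvar x)) = poly (map_poly (mpderiv i) r) (mvar x)"
        using mpderiv_poly[of i r "mvar x"] by (simp add: mpderiv_mvar)
      then have "poly (map_poly (mpderiv i) r) (mvar x) \<in> \<pp>"
        using in_p(2)[OF False] by simp
      with indep[of "map_poly (mpderiv i) r"] r show ?thesis
        by (simp add: upolys_in_intros coeff_map_poly)
    qed (simp add: x0 zero)
  qed
  then show ?thesis
    unfolding poly_altdef by (intro conormal_zero_sum) (subst mult.commute, rule conormal_zero_mult)
qed

text \<open>
  The conormal space at the generic point embeds into the differentials: a \<open>g \<in> \<pp>\<close> whose partial
  derivatives all lie in \<open>\<pp>\<close> is zero in it. The variables occurring in \<open>g\<close> are adjoined one at a time,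
  as one does for a field extension. If the new variable \<open>x\<close> is transcendental over the others modulo
  \<open>\<pp>\<close>, the hypotheses pass to the coefficients of \<open>g\<close> in \<open>x\<close>. Otherwise let \<open>h\<close> be a relation for \<open>x\<close>
  of least degree. In characteristic zero it is separable, \<open>h'(x) \<notin> \<pp>\<close>. Up to a factor
  outside \<open>\<pp>\<close>, \<open>g = q h + r\<close> with \<open>r\<close> of smaller degree than \<open>h\<close>. Differentiating in \<open>x\<close> gives
  \<open>q h' \<in> \<pp>\<close>, hence \<open>q \<in> \<pp>\<close> and \<open>q h \<in> \<pp>\<^sup>2\<close>; the remainder \<open>r\<close> is treated through its coefficients.
\<close>

lemma conormal_zero_polys_in:
  assumes "finite V" "g \<in> polys_in V" "g \<in> \<pp>" "\<And>i. mpderiv i g \<in> \<pp>"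
  shows "conormal_zero g"
  using assms
proof (induction V arbitrary: g rule: finite_induct)
  case empty
  from empty.prems(1) have "\<exists>c. g = mconst c"
  proof (induction rule: polys_in.induct)
    case (add a b)
    then show ?case by (metis mconst_def single_add)
  qed (auto simp: mconst_mult)
  then have "g = 0" using empty.prems(2) by (auto simp: mconst_in_iff)
  then show ?case using conormal_zero_square[OF ideal_square.prod[OF zero zero]] by simp
next
  case (insert x V)
  let ?x = "mvar x :: ('n, 'k) mpoly"
  obtain u where u: "u \<in> upolys_in V" "g = poly u ?x"
    using polys_in_insert[OF insert.prems(1)] by blast
  \<comment> \<open>The nontrivial algebraic relations satisfied by \<open>x\<close> over \<open>k[V]\<close> modulo \<open>\<pp>\<close>.\<close>
  define H where "H = {h \<in> upolys_in V. poly h ?x \<in> \<pp> \<and> (\<exists>j. coeff h j \<notin> \<pp>)}"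
  show ?case
  proof (cases "H = {}")
    case True
    have "\<forall>j. coeff t j \<in> \<pp>" if "t \<in> upolys_in V" "poly t ?x \<in> \<pp>" for t
      using True that by (auto simp: H_def)
    moreover have "\<forall>j\<ge>Suc (degree u). coeff u j = 0" by (simp add: coeff_eq_0 Suc_le_eq)
    ultimately show ?thesis
      using conormal_zero_poly[OF insert.IH _ insert.hyps(2) u(1), of "Suc (degree u)"]
        insert.prems(2,3) unfolding u(2) by blast
  next
    case False
    then obtain h where h: "h \<in> H" and h_min: "\<And>t. t \<in> H \<Longrightarrow> degree h \<le> degree t"
      using ex_has_least_nat[of "\<lambda>t. t \<in> H" _ degree] by blast
    define d where "d = degree h"
    have hV: "h \<in> upolys_in V" and hp: "poly h ?x \<in> \<pp>" using h by (auto simp: H_def)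
    have indep: "\<forall>j. coeff t j \<in> \<pp>"
      if "t \<in> upolys_in V" "\<forall>j\<ge>d. coeff t j = 0" "poly t ?x \<in> \<pp>" for t
    proof (rule ccontr)
      assume "\<not> (\<forall>j. coeff t j \<in> \<pp>)"
      then have "t \<in> H" and "t \<noteq> 0" using that zero by (auto simp: H_def)
      with h_min[of t] have "coeff t (degree t) = 0" using that by (simp add: d_def)
      with \<open>t \<noteq> 0\<close> show False by simp
    qed
    have d_pos: "d > 0"
    proof (rule ccontr)
      assume "\<not> d > 0"
      then obtain c where "h = [:c:]" using degree_eq_zeroE[of h] by (auto simp: d_def)
      then have "coeff h j \<in> \<pp>" for j
        using hp zero by (cases j) auto
      with h show False by (auto simp: H_def zero)
    qed
    \<comment> \<open>Otherwise dropping the leading term would give a relation of smaller degree.\<close>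
    have lead: "lead_coeff h \<notin> \<pp>"
    proof
      assume l: "lead_coeff h \<in> \<pp>"
      let ?t = "h - monom (lead_coeff h) d"
      have "lead_coeff h \<in> polys_in V" using hV by (simp add: upolys_in_def)
      then have "?t \<in> upolys_in V" using hV by (intro upolys_in_intros)
      moreover have "\<forall>j\<ge>d. coeff ?t j = 0" by (auto simp: d_def coeff_eq_0)
      moreover have "poly ?t ?x \<in> \<pp>"
        using hp l by (auto simp: poly_monom intro: diff mult_right)
      ultimately have "\<forall>j. coeff ?t j \<in> \<pp>" by (rule indep)
      then have *: "coeff ?t j \<in> \<pp>" for j by blast
      have "coeff h j \<in> \<pp>" for j
        using *[of j] l by (cases "j = d") (auto simp: d_def)
      then show False using h by (auto simp: H_def)
    qed
    \<comment> \<open>A nontrivial relation of smaller degree is impossible, and the coefficient of \<open>h'\<close> at \<open>d - 1\<close> is \<open>d\<close> times the leading one, where \<open>d\<close> is invertible in characteristic zero.\<close>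
    have h': "poly (formal_pderiv h) ?x \<notin> \<pp>"
    proof
      assume "poly (formal_pderiv h) ?x \<in> \<pp>"
      moreover have "\<forall>j\<ge>d. coeff (formal_pderiv h) j = 0"
        by (auto simp: coeff_formal_pderiv d_def coeff_eq_0 simp del: of_nat_Suc)
      ultimately have "coeff (formal_pderiv h) (d - 1) \<in> \<pp>"
        using indep[of "formal_pderiv h"] hV upolys_in_intros(7) by blast
      then have "of_nat d * lead_coeff h \<in> \<pp>"
        using d_pos by (simp add: coeff_formal_pderiv d_def del: of_nat_Suc)
      then show False
        using prime[of "of_nat d" "lead_coeff h"] lead of_nat_in_iff[of d] d_pos by simp
    qed
    obtain m q r where div: "q \<in> upolys_in V" "r \<in> upolys_in V" "\<forall>j\<ge>d. coeff r j = 0"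
        "smult (lead_coeff h ^ m) u = q * h + r"
      using pseudo_division_upolys_in[OF hV u(1)] unfolding d_def by metis
    define c where "c = lead_coeff h ^ m"
    have c: "c \<notin> \<pp>" using lead by (simp add: c_def power)
    have cg: "c * g = poly q ?x * poly h ?x + poly r ?x"
      using arg_cong[OF div(4), of "\<lambda>t. poly t ?x"] by (simp add: u(2) c_def)
    then have r_eq: "poly r ?x = c * g - poly q ?x * poly h ?x" by simp
    have r_p: "poly r ?x \<in> \<pp>"
      unfolding r_eq using insert.prems(2) hp by (intro diff mult)
    then have r_coeff: "\<forall>j. coeff r j \<in> \<pp>" using indep div by blast
    have no_x: "poly (map_poly (mpderiv x) t) ?x = 0" if "t \<in> upolys_in V" for t
    proof -
      have "map_poly (mpderiv x) t = 0"
        using that insert.hyps(2)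
        by (auto simp: poly_eq_iff coeff_map_poly upolys_in_def intro: mpderiv_polys_in_outside)
      then show ?thesis by simp
    qed
    \<comment> \<open>Modulo \<open>\<pp>\<close>, the derivative in \<open>x\<close> of \<open>c g = q h + r\<close> is \<open>q h'\<close>.\<close>
    have "poly q ?x \<in> \<pp>"
    proof -
      have "mpderiv x (c * g) \<in> \<pp>"
        unfolding mpderiv_mult using insert.prems(2,3) by (intro add mult) auto
      moreover have "poly (formal_pderiv r) ?x \<in> \<pp>"
        unfolding poly_altdef using r_coeff
        by (intro sum mult_right) (auto simp: coeff_formal_pderiv intro: mult simp del: of_nat_Suc)
      moreover have "mpderiv x (c * g) = poly (formal_pderiv q) ?x * poly h ?x
            + poly q ?x * poly (formal_pderiv h) ?x + poly (formal_pderiv r) ?x"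
        unfolding cg using div hV
        by (simp add: mpderiv_add mpderiv_mult mpderiv_poly mpderiv_mvar no_x)
      ultimately have "poly q ?x * poly (formal_pderiv h) ?x \<in> \<pp>"
        using diff[OF diff[OF _ _] mult[OF hp], of "mpderiv x (c * g)" "poly (formal_pderiv r) ?x"
            "poly (formal_pderiv q) ?x"] by simp
      then show ?thesis using prime h' by blast
    qed
    then have qh: "poly q ?x * poly h ?x \<in> ideal_square \<pp>"
      using hp by (rule ideal_square.prod)
    have "conormal_zero (poly r ?x)"
    proof (rule conormal_zero_poly[OF insert.IH indep insert.hyps(2) div(2,3) r_p])
      show "mpderiv i (poly r ?x) \<in> \<pp>" for i
        unfolding r_eq mpderiv_mult mpderiv_diff using insert.prems(2,3) hp \<open>poly q ?x \<in> \<pp>\<close>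
        by (intro diff add) (simp_all add: mult mult_right)
    qed
    with qh have "conormal_zero (c * g)"
      unfolding cg by (rule conormal_zero_add[OF conormal_zero_square])
    then show ?thesis using c by (rule conormal_zero_cancel)
  qed
qed

end

text \<open>
  \<open>conormal_zero_polys_in\<close> at a minimal prime over \<open>J\<close> that avoids \<open>a\<close>. Elements of this prime are
  multiplied into \<open>J\<close>, and products of two of them into the square of \<open>J\<close>, by factors outside the prime;
  such factors keep \<open>a\<close> out of \<open>J\<close>.
\<close>

lemma radical_ideal_conormal:
  fixes J :: "('n::finite, 'k::field_char_0) mpoly set" and g a :: "('n::finite, 'k::field_char_0) mpoly"
  assumes J: "ring_ideal J" and radical: "\<forall>b m. b ^ m \<in> J \<longrightarrow> b \<in> J" and a: "a \<notin> J"
    and g: "g \<in> J" "\<And>i. mpderiv i g \<in> J"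
  obtains s where "s * g \<in> ideal_square J" "s * a \<notin> J"
proof -
  interpret ring_ideal J by fact
  obtain M where *: "1 \<in> M \<and> (\<forall>b\<in>M. \<forall>c\<in>M. b * c \<in> M) \<and> a \<in> M \<and>
    (\<forall>b. b \<notin> M \<longleftrightarrow> (\<exists>s\<in>M. s * b \<in> J))"
    using maximal_multiplicative_set[OF radical a] by (elim exE) (rule that)
  have M: "1 \<in> M" "\<And>b c. b \<in> M \<Longrightarrow> c \<in> M \<Longrightarrow> b * c \<in> M" "a \<in> M"
    using * by simp_all
  have M_iff: "b \<notin> M \<longleftrightarrow> (\<exists>s\<in>M. s * b \<in> J)" for b
    using * by (elim conjE) (erule spec)
  \<comment> \<open>Sums and multiples of elements carried into \<open>J\<close> are carried into \<open>J\<close>, so the complement of \<open>M\<close> is an ideal; it is prime as \<open>M\<close> is multiplicative.\<close>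
  interpret p: prime_ideal_mpoly "- M"
  proof
    show "0 \<in> - M" using M_iff[of 0] M(1) zero by auto
    show "b + c \<in> - M" if "b \<in> - M" "c \<in> - M" for b c
    proof -
      from that obtain s t where st: "s \<in> M" "t \<in> M" "s * b \<in> J" "t * c \<in> J"
        using M_iff by blast
      have "(s * t) * (b + c) = t * (s * b) + s * (t * c)" by (simp add: algebra_simps)
      also have "\<dots> \<in> J" using st by (intro add[OF mult mult])
      finally show ?thesis using M_iff[of "b + c"] M(2)[OF st(1,2)] by auto
    qed
    show "c * b \<in> - M" if "b \<in> - M" for b c
    proof -
      from that obtain s where "s \<in> M" "s * b \<in> J" using M_iff by blast
      then show ?thesis
        using M_iff[of "c * b"] mult[of "s * b" c] by (auto simp: algebra_simps)
    qed
    show "1 \<notin> - M" using M(1) by simp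
    show "b \<in> - M \<or> c \<in> - M" if "b * c \<in> - M" for b c using M(2) that by blast
  qed
  have J_M: "b \<in> - M" if "b \<in> J" for b
    using M_iff[of b] bexI[of "\<lambda>s. s * b \<in> J" 1 M] M(1) that by simp
  have clear: "\<exists>s\<in>M. s * b \<in> ideal_square J" if "b \<in> ideal_square (- M)" for b
    using that
  proof (induction rule: ideal_square.induct)
    case (prod b c)
    then obtain s t where st: "s \<in> M" "t \<in> M" "s * b \<in> J" "t * c \<in> J"
      using M_iff by blast
    then have "(s * b) * (t * c) \<in> ideal_square J" by (intro ideal_square.prod)
    moreover have "(s * b) * (t * c) = (s * t) * (b * c)" by (simp add: algebra_simps)
    ultimately show ?case using M(2) st by metis
  next
    case (add b c)
    then obtain s t where st: "s \<in> M" "t \<in> M" "s * b \<in> ideal_square J" "t * c \<in> ideal_square J"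
      by blast
    then have "t * (s * b) + s * (t * c) \<in> ideal_square J"
      by (intro ideal_square.add[OF square_mult square_mult])
    moreover have "t * (s * b) + s * (t * c) = (s * t) * (b + c)" by (simp add: algebra_simps)
    ultimately show ?case using M(2) st by metis
  qed
  have "p.conormal_zero g"
    by (rule p.conormal_zero_polys_in[OF finite polys_in_UNIV]) (use g J_M in blast)+
  then obtain s where s: "s \<in> M" "s * g \<in> ideal_square (- M)"
    by (auto simp: p.conormal_zero_def)
  from clear[OF s(2)] obtain t where t: "t \<in> M" "t * (s * g) \<in> ideal_square J" by blast
  have "t * s * a \<in> M" using M s t by blast
  then have "t * s * a \<notin> J" using J_M by blast
  with t(2) show ?thesis
    by (intro that[of "t * s"]) (simp_all add: mult.assoc)
qed

section \<open>The Koszul complex and the conormal module\<close>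

lemma mpoly_ring_simps:
  "carrier (mpoly_ring :: ('n, 'k::field_char_0) mpoly ring) = UNIV"
  "\<zero>\<^bsub>(mpoly_ring :: ('n, 'k) mpoly ring)\<^esub> = 0"
  "\<one>\<^bsub>(mpoly_ring :: ('n, 'k) mpoly ring)\<^esub> = 1"
  "a \<oplus>\<^bsub>(mpoly_ring :: ('n, 'k) mpoly ring)\<^esub> b = a + b"
  "a \<otimes>\<^bsub>(mpoly_ring :: ('n, 'k) mpoly ring)\<^esub> b = a * b"
  by (simp_all add: ring_of_type_algebra_def)

lemma mpoly_ring_cring: "cring (mpoly_ring :: ('n, 'k::field_char_0) mpoly ring)"
  by (rule cring_from_type_algebra)

lemma ideal_mpoly_ring_iff:
  "ideal J (mpoly_ring :: ('n, 'k::field_char_0) mpoly ring) \<longleftrightarrow> ring_ideal J"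
proof
  interpret S: cring "mpoly_ring :: ('n, 'k) mpoly ring" by (rule mpoly_ring_cring)
  assume "ideal J (mpoly_ring :: ('n, 'k) mpoly ring)"
  then interpret ideal J "mpoly_ring :: ('n, 'k) mpoly ring" .
  show "ring_ideal J"
    using additive_subgroup.zero_closed additive_subgroup.a_closed I_l_closed
    by (unfold_locales) (use zero_closed a_closed I_l_closed in \<open>auto simp: mpoly_ring_simps\<close>)
next
  interpret S: cring "mpoly_ring :: ('n, 'k) mpoly ring" by (rule mpoly_ring_cring)
  assume "ring_ideal J"
  then interpret ring_ideal J .
  show "ideal J (mpoly_ring :: ('n, 'k) mpoly ring)"
  proof (rule idealI)
    have "\<ominus>\<^bsub>(mpoly_ring :: ('n, 'k) mpoly ring)\<^esub> a = - a" for a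
      by (rule S.minus_equality) (auto simp: mpoly_ring_simps)
    then have "inv\<^bsub>add_monoid (mpoly_ring :: ('n, 'k) mpoly ring)\<^esub> a \<in> J" if "a \<in> J" for a
      using uminus[OF that] by (simp add: a_inv_def)
    then show "subgroup J (add_monoid (mpoly_ring :: ('n, 'k) mpoly ring))"
      by (intro subgroup.intro) (simp_all add: mpoly_ring_simps zero add)
  qed (auto simp: mpoly_ring_simps mult mult_right S.ring_axioms)
qed

lemma mem_gen_ideal_iff: "a \<in> gen_ideal k f \<longleftrightarrow> (\<exists>v. a = (\<Sum>\<mu><k. v \<mu> * f \<mu>))"
proof -
  interpret S: cring "mpoly_ring :: ('a, 'b) mpoly ring" by (rule mpoly_ring_cring)
  define J where "J = {a. \<exists>v. a = (\<Sum>\<mu><k. v \<mu> * f \<mu>)}"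
  have "ring_ideal J"
  proof
    show "0 \<in> J" by (auto simp: J_def intro!: exI[of _ "\<lambda>_. 0"])
    show "a + b \<in> J" if "a \<in> J" "b \<in> J" for a b
    proof -
      from that obtain v u where "a = (\<Sum>\<mu><k. v \<mu> * f \<mu>)" "b = (\<Sum>\<mu><k. u \<mu> * f \<mu>)"
        by (auto simp: J_def)
      then have "a + b = (\<Sum>\<mu><k. (v \<mu> + u \<mu>) * f \<mu>)"
        by (simp add: distrib_right sum.distrib)
      then show ?thesis by (auto simp: J_def)
    qed
    show "c * a \<in> J" if "a \<in> J" for a c
    proof -
      from that obtain v where "a = (\<Sum>\<mu><k. v \<mu> * f \<mu>)" by (auto simp: J_def)
      then have "c * a = (\<Sum>\<mu><k. (c * v \<mu>) * f \<mu>)" by (simp add: sum_distrib_left mult.assoc)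
      then show ?thesis by (auto simp: J_def)
    qed
  qed
  moreover have "f ` {..<k} \<subseteq> J"
  proof
    fix a assume "a \<in> f ` {..<k}"
    then obtain \<nu> where "\<nu> < k" "a = f \<nu>" by auto
    then have "a = (\<Sum>\<mu><k. (if \<mu> = \<nu> then 1 else 0) * f \<mu>)"
      by (simp add: if_distrib[of "\<lambda>x. x * _"] cong: if_cong)
    then show "a \<in> J" by (auto simp: J_def)
  qed
  ultimately have "gen_ideal k f \<subseteq> J"
    unfolding gen_ideal_def by (intro S.genideal_minimal) (simp add: ideal_mpoly_ring_iff)
  moreover have "a \<in> gen_ideal k f" if "a \<in> J" for a
  proof -
    have "ideal (gen_ideal k f) mpoly_ring"
      unfolding gen_ideal_def by (rule S.genideal_ideal) (simp add: mpoly_ring_simps)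
    then interpret ring_ideal "gen_ideal k f" by (simp add: ideal_mpoly_ring_iff)
    have "f ` {..<k} \<subseteq> gen_ideal k f"
      unfolding gen_ideal_def by (rule S.genideal_self) (simp add: mpoly_ring_simps)
    with that show ?thesis by (auto simp: J_def intro!: sum mult)
  qed
  ultimately show ?thesis by (auto simp: J_def)
qed

lemma ring_ideal_gen_ideal: "ring_ideal (gen_ideal k f)"
proof -
  interpret S: cring "mpoly_ring :: ('a, 'b) mpoly ring" by (rule mpoly_ring_cring)
  have "ideal (gen_ideal k f) mpoly_ring"
    unfolding gen_ideal_def by (rule S.genideal_ideal) (simp add: mpoly_ring_simps)
  then show ?thesis by (simp add: ideal_mpoly_ring_iff)
qed

text \<open>
  A syzygy is a one-cycle of the Koszul complex, hence a boundary, and the coefficients of a boundary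
  are combinations of the \<open>f\<^sub>\<mu>\<close>.
\<close>

lemma koszul_syzygy_coeff:
  assumes ci: "complete_intersection k f" and syz: "(\<Sum>\<mu><k. v \<mu> * f \<mu>) = 0" and \<nu>: "\<nu> < k"
  shows "v \<nu> \<in> gen_ideal k f"
proof -
  interpret I: ring_ideal "gen_ideal k f" by (rule ring_ideal_gen_ideal)
  let ?M = "koszul_module k :: (('a, 'b) mpoly, nat set \<Rightarrow> ('a, 'b) mpoly) module"
  let ?C = "cycles ?M (koszul_gr k) (koszul_diff k f) 1"
  let ?B = "boundaries (koszul_gr k) (koszul_diff k f) 1"
  have mem: "c \<in> carrier ?M \<longleftrightarrow> c \<in> extensional (Pow {..<k})" for c
    by (auto simp: koszul_module_def free_module_def pow_module_def mpoly_ring_simps PiE_def)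
  have zero_M: "\<zero>\<^bsub>?M\<^esub> = (\<lambda>T\<in>Pow {..<k}. 0)"
    by (simp add: koszul_module_def free_module_def pow_module_def mpoly_ring_simps)
  \<comment> \<open>The Koszul chain \<open>\<Sum>\<^sub>\<mu> v\<^sub>\<mu> y\<^sub>\<mu>\<close>.\<close>
  define c where "c = (\<lambda>T\<in>Pow {..<k}. if card T = 1 then v (the_elem T) else 0)"
  have c_gr: "c \<in> koszul_gr k 1"
    by (auto simp: koszul_gr_def mem c_def split: if_splits)
  have "(\<Sum>\<mu>\<in>{..<k} - T. (- 1) ^ card {\<nu> \<in> T. \<nu> < \<mu>} * f \<mu> * c (insert \<mu> T)) = 0"
    if T: "T \<in> Pow {..<k}" for T
  proof (cases "T = {}")
    case True
    then show ?thesis using syz by (simp add: c_def mult.commute)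
  next
    case False
    have "finite T" using T finite_subset by auto
    then have "card (insert \<mu> T) \<noteq> 1" if "\<mu> \<notin> T" for \<mu>
      using False that by simp
    then have "c (insert \<mu> T) = 0" if "\<mu> \<in> {..<k} - T" for \<mu>
      using that T by (simp add: c_def)
    then show ?thesis by (intro sum.neutral) simp
  qed
  then have c_cycle: "c \<in> carrier ?C"
    using c_gr by (auto simp: cycles_def zero_M koszul_diff_def)
  have "trivial_group (?C Mod ?B)"
    using ci by (simp add: complete_intersection_def homology_def)
  then have "carrier (?C Mod ?B) = {?B}" by (simp add: trivial_group_def)
  with c_cycle have coset: "?B #>\<^bsub>?C\<^esub> c = ?B"
    by (auto simp: carrier_FactGroup)
  have "\<zero>\<^bsub>?M\<^esub> \<in> ?B"
    unfolding boundaries_def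
    by (rule image_eqI[of _ _ "\<zero>\<^bsub>?M\<^esub>"])
       (auto simp: zero_M koszul_diff_def koszul_gr_def mem intro!: sum.neutral[symmetric])
  moreover have "\<zero>\<^bsub>?M\<^esub> \<oplus>\<^bsub>?M\<^esub> c = c"
    by (auto simp: koszul_module_def free_module_def pow_module_def mpoly_ring_simps c_def)
  ultimately have "c \<in> ?B #>\<^bsub>?C\<^esub> c"
    by (force simp: r_coset_def cycles_def)
  then obtain c' where c': "c = koszul_diff k f c'"
    unfolding coset by (auto simp: boundaries_def)
  have "v \<nu> = c {\<nu>}" using \<nu> by (simp add: c_def)
  also have "\<dots> = (\<Sum>\<mu>\<in>{..<k} - {\<nu>}. (- 1) ^ card {\<nu>' \<in> {\<nu>}. \<nu>' < \<mu>} * f \<mu> * c' (insert \<mu> {\<nu>}))"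
    using \<nu> by (subst c') (simp add: koszul_diff_def)
  also have "\<dots> \<in> gen_ideal k f"
  proof (rule I.sum)
    fix \<mu> assume "\<mu> \<in> {..<k} - {\<nu>}"
    then have "f \<mu> = (\<Sum>\<mu>'<k. (if \<mu>' = \<mu> then 1 else 0) * f \<mu>')"
      by (simp add: if_distrib[of "\<lambda>x. x * _"] cong: if_cong)
    then have "f \<mu> \<in> gen_ideal k f" by (auto simp: mem_gen_ideal_iff)
    then show "(- 1) ^ card {\<nu>' \<in> {\<nu>}. \<nu>' < \<mu>} * f \<mu> * c' (insert \<mu> {\<nu>}) \<in> gen_ideal k f"
      by (intro I.mult_right[OF I.mult])
  qed
  finally show ?thesis .
qed

text \<open>
  The classes of the \<open>f\<^sub>\<mu>\<close> are linearly independent in \<open>I/I\<^sup>2\<close>: an element of \<open>I\<^sup>2\<close> is also a combination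
  of the \<open>f\<^sub>\<mu>\<close> with coefficients in \<open>I\<close>, and two combinations with the same value differ by a syzygy.
\<close>

lemma conormal_coeff:
  assumes ci: "complete_intersection k f"
    and sq: "(\<Sum>\<mu><k. v \<mu> * f \<mu>) \<in> ideal_square (gen_ideal k f)" and \<nu>: "\<nu> < k"
  shows "v \<nu> \<in> gen_ideal k f"
proof -
  interpret I: ring_ideal "gen_ideal k f" by (rule ring_ideal_gen_ideal)
  have "\<exists>u. (\<forall>\<mu>. u \<mu> \<in> gen_ideal k f) \<and> b = (\<Sum>\<mu><k. u \<mu> * f \<mu>)"
    if "b \<in> ideal_square (gen_ideal k f)" for b
    using that
  proof (induction rule: ideal_square.induct)
    case (prod a b)
    then obtain u where "b = (\<Sum>\<mu><k. u \<mu> * f \<mu>)" by (auto simp: mem_gen_ideal_iff)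
    then have "a * b = (\<Sum>\<mu><k. (a * u \<mu>) * f \<mu>)" by (simp add: sum_distrib_left mult.assoc)
    then show ?case using prod I.mult_right by (intro exI[of _ "\<lambda>\<mu>. a * u \<mu>"]) auto
  next
    case (add a b)
    then obtain u t where "\<forall>\<mu>. u \<mu> \<in> gen_ideal k f" "a = (\<Sum>\<mu><k. u \<mu> * f \<mu>)"
      "\<forall>\<mu>. t \<mu> \<in> gen_ideal k f" "b = (\<Sum>\<mu><k. t \<mu> * f \<mu>)" by blast
    then show ?case
      by (intro exI[of _ "\<lambda>\<mu>. u \<mu> + t \<mu>"]) (auto simp: distrib_right sum.distrib I.add)
  qed
  from this[OF sq] obtain u where u: "\<And>\<mu>. u \<mu> \<in> gen_ideal k f"
    "(\<Sum>\<mu><k. v \<mu> * f \<mu>) = (\<Sum>\<mu><k. u \<mu> * f \<mu>)" by blast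
  then have "(\<Sum>\<mu><k. (v \<mu> - u \<mu>) * f \<mu>) = 0" by (simp add: left_diff_distrib sum_subtractf)
  from koszul_syzygy_coeff[OF ci this \<nu>] have "v \<nu> - u \<nu> \<in> gen_ideal k f" .
  from I.add[OF this u(1)[of \<nu>]] show ?thesis by simp
qed

text \<open>
  If the Jacobian matrix kills \<open>v\<close> modulo \<open>I\<close>, then by the product rule \<open>g = \<Sum>\<^sub>\<mu> v\<^sub>\<mu> f\<^sub>\<mu>\<close> vanishes to second
  order along \<open>I\<close>, so a multiple of \<open>g\<close> lies in \<open>I\<^sup>2\<close>; now compare coefficients.
\<close>

lemma jacobian_injective_mod_ideal:
  fixes f :: "nat \<Rightarrow> ('n::finite, 'k::field_char_0) mpoly"
  assumes ci: "complete_intersection k f"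
    and radical: "\<forall>b m. b ^ m \<in> gen_ideal k f \<longrightarrow> b \<in> gen_ideal k f"
    and ker: "\<And>i. (\<Sum>\<mu><k. v \<mu> * mpderiv i (f \<mu>)) \<in> gen_ideal k f" and \<nu>: "\<nu> < k"
  shows "v \<nu> \<in> gen_ideal k f"
proof (rule ccontr)
  interpret I: ring_ideal "gen_ideal k f" by (rule ring_ideal_gen_ideal)
  assume not_in: "v \<nu> \<notin> gen_ideal k f"
  define g where "g = (\<Sum>\<mu><k. v \<mu> * f \<mu>)"
  have g: "g \<in> gen_ideal k f" by (auto simp: g_def mem_gen_ideal_iff)
  have "mpderiv i g = (\<Sum>\<mu><k. mpderiv i (v \<mu>) * f \<mu>) + (\<Sum>\<mu><k. v \<mu> * mpderiv i (f \<mu>))" for i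
    by (simp add: g_def mpderiv_sum mpderiv_mult sum.distrib)
  moreover have "(\<Sum>\<mu><k. mpderiv i (v \<mu>) * f \<mu>) \<in> gen_ideal k f" for i
    by (auto simp: mem_gen_ideal_iff)
  ultimately have dg: "mpderiv i g \<in> gen_ideal k f" for i using ker I.add by simp
  obtain s where s: "s * g \<in> ideal_square (gen_ideal k f)" "s * v \<nu> \<notin> gen_ideal k f"
    by (rule radical_ideal_conormal[OF ring_ideal_gen_ideal radical not_in g dg])
  have "s * g = (\<Sum>\<mu><k. (s * v \<mu>) * f \<mu>)" by (simp add: g_def sum_distrib_left mult.assoc)
  with s(1) have "s * v \<nu> \<in> gen_ideal k f"
    by (intro conormal_coeff[OF ci _ \<nu>, of "\<lambda>\<mu>. s * v \<mu>"]) simp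
  with s(2) show False by simp
qed

section \<open>The Koszul bracket on the one-forms of a polynomial algebra\<close>

text \<open>
  A one-form \<open>\<Sum>\<^sub>l U\<^sub>l dx\<^sub>l\<close> is its tuple of coefficients, and \<open>grad a\<close> is \<open>da\<close>.
\<close>

abbreviation (input) grad :: "('n, 'k::field_char_0) mpoly \<Rightarrow> 'n \<Rightarrow> ('n, 'k) mpoly" where
  "grad a \<equiv> \<lambda>l. mpderiv l a"

lemma one_form_induct [case_names smult add grad]:
  assumes smult: "\<And>a V. Q V \<Longrightarrow> Q (\<lambda>l. a * V l)"
    and add: "\<And>V W. Q V \<Longrightarrow> Q W \<Longrightarrow> Q (\<lambda>l. V l + W l)"
    and grad: "\<And>i. Q (grad (mvar i))"
  shows "Q (V :: 'n::finite \<Rightarrow> ('n, 'k::field_char_0) mpoly)"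
proof -
  have zero: "Q (\<lambda>l. 0)" using smult[OF grad, of 0] by simp
  have "Q (\<lambda>l. \<Sum>i\<in>K. V i * mpderiv l (mvar i))" if "finite K" for K
    using that
  proof induction
    case (insert i K)
    from add[OF smult[OF grad, of "V i" i] this(3)] insert show ?case by simp
  qed (simp add: zero)
  from this[of UNIV] show ?thesis
    by (simp add: mpderiv_mvar if_distrib cong: if_cong)
qed

locale poisson_polynomial_algebra =
  fixes P :: "('n::finite, 'k::field_char_0) mpoly \<Rightarrow> ('n, 'k) mpoly \<Rightarrow> ('n, 'k) mpoly"
  assumes poisson: "poisson_bracket P"
begin

lemma P_add_left: "P (a + b) c = P a c + P b c"
  and P_anti: "P a b = - P b a"
  and P_mult_right: "P a (b * c) = P a b * c + b * P a c"
  using poisson unfolding poisson_bracket_def by blast+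

lemma P_jacobi: "P a (P b c) + P b (P c a) + P c (P a b) = 0"
  using poisson unfolding poisson_bracket_def by blast

lemma P_add_right: "P a (b + c) = P a b + P a c"
  by (metis P_anti P_add_left minus_add_distrib)

lemma P_mult_left: "P (b * c) a = P b a * c + b * P c a"
  using P_mult_right[of a b c] P_anti[of "b * c" a] P_anti[of b a] P_anti[of c a] by simp

lemma P_zero [simp]: "P a 0 = 0" "P 0 a = 0"
  using P_add_right[of a 0 0] P_add_left[of 0 0 a] by simp_all

lemma P_uminus_right: "P a (- b) = - P a b"
  using P_add_right[of a b "- b"] by (simp add: eq_neg_iff_add_eq_0 add.commute)

lemma P_one [simp]: "P 1 a = 0"
  using P_mult_left[of 1 1 a] by simp

lemma P_mconst [simp]: "P (mconst t) a = 0" "P a (mconst t) = 0"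
proof -
  have "P (mconst t * 1) a = mconst t * P 1 a"
    using poisson unfolding poisson_bracket_def by blast
  then show "P (mconst t) a = 0" by simp
  then show "P a (mconst t) = 0" using P_anti[of a] by simp
qed

lemma P_leibniz_jacobi: "P a (P b c) = P (P a b) c + P b (P a c)"
proof -
  have "P b (P c a) = - P b (P a c)" by (subst P_anti[of c a]) (rule P_uminus_right)
  moreover have "P c (P a b) = - P (P a b) c" by (rule P_anti)
  ultimately show ?thesis using P_jacobi[of a b c] by (simp add: algebra_simps)
qed

text \<open>
  The contraction of the one-form \<open>U\<close> with the Poisson bivector.
\<close>

definition anchor :: "('n \<Rightarrow> ('n, 'k) mpoly) \<Rightarrow> ('n, 'k) mpoly \<Rightarrow> ('n, 'k) mpoly" where
  "anchor U c = (\<Sum>i\<in>UNIV. U i * P (mvar i) c)"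

lemma anchor_add: "anchor U (a + b) = anchor U a + anchor U b"
  by (simp add: anchor_def P_add_right distrib_left sum.distrib)

lemma anchor_mult: "anchor U (a * b) = anchor U a * b + a * anchor U b"
  by (simp add: anchor_def P_mult_right distrib_left sum.distrib sum_distrib_left sum_distrib_right mult_ac)

lemma anchor_zero [simp]: "anchor U 0 = 0" and anchor_mconst [simp]: "anchor U (mconst t) = 0"
  by (simp_all add: anchor_def)

lemma anchor_uminus: "anchor U (- a) = - anchor U a"
  by (simp add: anchor_def P_uminus_right sum_negf)

lemma anchor_diff: "anchor U (a - b) = anchor U a - anchor U b"
  using anchor_add[of U a "- b"] by (simp add: anchor_uminus)

lemma anchor_sum: "anchor U (sum g K) = (\<Sum>m\<in>K. anchor U (g m))"
  by (induction K rule: infinite_finite_induct) (auto simp: anchor_add)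

lemma anchor_add_left: "anchor (\<lambda>l. U l + W l) c = anchor U c + anchor W c"
  by (simp add: anchor_def distrib_right sum.distrib)

lemma anchor_diff_left: "anchor (\<lambda>l. U l - W l) c = anchor U c - anchor W c"
  by (simp add: anchor_def left_diff_distrib sum_subtractf)

lemma anchor_smult_left: "anchor (\<lambda>l. a * U l) c = a * anchor U c"
  by (simp add: anchor_def sum_distrib_left mult.assoc)

lemma anchor_grad: "anchor (grad a) c = P a c"
  unfolding anchor_def
  using derivation_chain_rule[of "\<lambda>a. P a c" a] by (simp add: P_add_left P_mult_left)

lemma P_eq_sum: "P a b = (\<Sum>i\<in>UNIV. \<Sum>j\<in>UNIV. mpderiv i a * mpderiv j b * P (mvar i) (mvar j))"
proof -
  have "P a b = (\<Sum>i\<in>UNIV. mpderiv i a * P (mvar i) b)"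
    using anchor_grad[of a b] by (simp add: anchor_def)
  moreover have "P (mvar i) b = (\<Sum>j\<in>UNIV. mpderiv j b * P (mvar i) (mvar j))" for i
    by (rule derivation_chain_rule) (simp_all add: P_add_right P_mult_right)
  ultimately show ?thesis by (simp add: sum_distrib_left mult.assoc)
qed

text \<open>
  The coordinates of the Koszul bracket: its values \<open>[dx\<^sub>i, dx\<^sub>j] = d{x\<^sub>i, x\<^sub>j}\<close> are extended to all
  one-forms by the Leibniz rule for \<open>anchor\<close> in both arguments.
\<close>

definition bracket :: "('n \<Rightarrow> ('n, 'k) mpoly) \<Rightarrow> ('n \<Rightarrow> ('n, 'k) mpoly) \<Rightarrow> 'n \<Rightarrow> ('n, 'k) mpoly" where
  "bracket U W = (\<lambda>l. anchor U (W l) - anchor W (U l) +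
     (\<Sum>i\<in>UNIV. \<Sum>j\<in>UNIV. U i * W j * mpderiv l (P (mvar i) (mvar j))))"

text \<open>
  The three sums that arise on differentiating \<open>P_eq_sum\<close> are the three terms of \<open>bracket\<close>.
\<close>

lemma bracket_grad: "bracket (grad a) (grad b) = grad (P a b)"
proof
  fix l
  have "mpderiv l (P a b) =
      (\<Sum>i\<in>UNIV. \<Sum>j\<in>UNIV. mpderiv i (mpderiv l a) * mpderiv j b * P (mvar i) (mvar j)) +
      (\<Sum>i\<in>UNIV. \<Sum>j\<in>UNIV. mpderiv i a * mpderiv j (mpderiv l b) * P (mvar i) (mvar j)) +
      (\<Sum>i\<in>UNIV. \<Sum>j\<in>UNIV. mpderiv i a * mpderiv j b * mpderiv l (P (mvar i) (mvar j)))"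
    unfolding P_eq_sum[of a b]
    by (simp add: mpderiv_sum mpderiv_mult sum.distrib distrib_right distrib_left
        mpderiv_commute[of l] mult.assoc)
  then show "bracket (grad a) (grad b) l = mpderiv l (P a b)"
    unfolding P_eq_sum[of "mpderiv l a" b, symmetric] P_eq_sum[of a "mpderiv l b", symmetric]
    using P_anti[of "mpderiv l a" b] by (simp add: bracket_def anchor_grad)
qed

lemma bracket_anti: "bracket U W = (\<lambda>l. - bracket W U l)"
proof
  fix l
  have "(\<Sum>i\<in>UNIV. \<Sum>j\<in>UNIV. U i * W j * mpderiv l (P (mvar i) (mvar j)))
      = (\<Sum>j\<in>UNIV. \<Sum>i\<in>UNIV. U i * W j * mpderiv l (P (mvar i) (mvar j)))"
    by (rule sum.swap)
  also have "\<dots> = - (\<Sum>i\<in>UNIV. \<Sum>j\<in>UNIV. W i * U j * mpderiv l (P (mvar i) (mvar j)))"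
    unfolding sum_negf[symmetric]
    by (intro sum.cong refl, subst P_anti) (simp add: mpderiv_uminus mult.commute)
  finally show "bracket U W l = - bracket W U l" by (simp add: bracket_def)
qed

lemma bracket_add_right: "bracket U (\<lambda>l. W l + V l) = (\<lambda>l. bracket U W l + bracket U V l)"
  by (simp add: bracket_def anchor_add anchor_add_left algebra_simps sum.distrib)

lemma bracket_leibniz: "bracket U (\<lambda>l. a * W l) = (\<lambda>l. a * bracket U W l + anchor U a * W l)"
proof
  fix l
  have "(\<Sum>i\<in>UNIV. \<Sum>j\<in>UNIV. U i * (a * W j) * mpderiv l (P (mvar i) (mvar j)))
     = a * (\<Sum>i\<in>UNIV. \<Sum>j\<in>UNIV. U i * W j * mpderiv l (P (mvar i) (mvar j)))"
    by (simp add: sum_distrib_left mult_ac)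
  then show "bracket U (\<lambda>l. a * W l) l = a * bracket U W l + anchor U a * W l"
    by (simp add: bracket_def anchor_mult anchor_smult_left algebra_simps)
qed

lemma bracket_uminus_right: "bracket U (\<lambda>l. - W l) = (\<lambda>l. - bracket U W l)"
proof -
  have "anchor U (- 1) = 0" using anchor_uminus[of U 1] anchor_mconst[of U 1] by simp
  then show ?thesis using bracket_leibniz[of U "- 1" W] by simp
qed

lemma bracket_diff_right: "bracket U (\<lambda>l. W l - V l) = (\<lambda>l. bracket U W l - bracket U V l)"
  using bracket_add_right[of U W "\<lambda>l. - V l"] by (simp add: bracket_uminus_right)

lemma bracket_add_left: "bracket (\<lambda>l. W l + V l) U = (\<lambda>l. bracket W U l + bracket V U l)"
  unfolding bracket_anti[of "\<lambda>l. W l + V l" U] bracket_anti[of W U] bracket_anti[of V U] by (simp add: bracket_add_right)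

text \<open>
  The derivatives of the coefficients in the commutator match the first two terms of \<open>bracket\<close>; the rest is
  the Jacobi identity for \<open>x\<^sub>i\<close>, \<open>x\<^sub>j\<close> and \<open>c\<close>.
\<close>

lemma anchor_bracket: "anchor (bracket U W) c = anchor U (anchor W c) - anchor W (anchor U c)"
proof -
  have expand: "anchor U (anchor W c) = (\<Sum>l\<in>UNIV. anchor U (W l) * P (mvar l) c)
      + (\<Sum>i\<in>UNIV. \<Sum>j\<in>UNIV. U i * W j * P (mvar i) (P (mvar j) c))" for U W
  proof -
    have "anchor U (anchor W c) = (\<Sum>l\<in>UNIV. anchor U (W l) * P (mvar l) c) + (\<Sum>j\<in>UNIV. W j * anchor U (P (mvar j) c))"
      by (simp add: anchor_def[of W] anchor_sum anchor_mult sum.distrib)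
    also have "(\<Sum>j\<in>UNIV. W j * anchor U (P (mvar j) c))
        = (\<Sum>j\<in>UNIV. \<Sum>i\<in>UNIV. U i * W j * P (mvar i) (P (mvar j) c))"
      by (simp add: anchor_def sum_distrib_left mult_ac)
    finally show ?thesis by (subst sum.swap)
  qed
  have bracket: "(\<Sum>i\<in>UNIV. \<Sum>j\<in>UNIV. U i * W j * P (P (mvar i) (mvar j)) c)
     = (\<Sum>l\<in>UNIV. (\<Sum>i\<in>UNIV. \<Sum>j\<in>UNIV. U i * W j * mpderiv l (P (mvar i) (mvar j))) * P (mvar l) c)"
  proof -
    have "(\<Sum>i\<in>UNIV. \<Sum>j\<in>UNIV. U i * W j * P (P (mvar i) (mvar j)) c)
      = (\<Sum>i\<in>UNIV. \<Sum>j\<in>UNIV. \<Sum>l\<in>UNIV. U i * W j * mpderiv l (P (mvar i) (mvar j)) * P (mvar l) c)"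
    proof -
      have "P (P (mvar i) (mvar j)) c = (\<Sum>l\<in>UNIV. mpderiv l (P (mvar i) (mvar j)) * P (mvar l) c)" for i j
        using anchor_grad[of "P (mvar i) (mvar j)" c] by (simp add: anchor_def)
      then show ?thesis by (simp add: sum_distrib_left mult_ac)
    qed
    also have "\<dots> = (\<Sum>i\<in>UNIV. \<Sum>l\<in>UNIV. \<Sum>j\<in>UNIV. U i * W j * mpderiv l (P (mvar i) (mvar j)) * P (mvar l) c)"
      by (intro sum.cong refl sum.swap)
    also have "\<dots> = (\<Sum>l\<in>UNIV. \<Sum>i\<in>UNIV. \<Sum>j\<in>UNIV. U i * W j * mpderiv l (P (mvar i) (mvar j)) * P (mvar l) c)"
      by (rule sum.swap)
    finally show ?thesis by (simp add: sum_distrib_right)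
  qed
  have jac: "(\<Sum>i\<in>UNIV. \<Sum>j\<in>UNIV. U i * W j * P (P (mvar i) (mvar j)) c)
     = (\<Sum>i\<in>UNIV. \<Sum>j\<in>UNIV. U i * W j * P (mvar i) (P (mvar j) c))
       - (\<Sum>i\<in>UNIV. \<Sum>j\<in>UNIV. W i * U j * P (mvar i) (P (mvar j) c))"
  proof -
    have "(\<Sum>i\<in>UNIV. \<Sum>j\<in>UNIV. W i * U j * P (mvar i) (P (mvar j) c))
       = (\<Sum>j\<in>UNIV. \<Sum>i\<in>UNIV. W i * U j * P (mvar i) (P (mvar j) c))"
      by (rule sum.swap)
    also have "\<dots> = (\<Sum>i\<in>UNIV. \<Sum>j\<in>UNIV. U i * W j * P (mvar j) (P (mvar i) c))"
      by (intro sum.cong refl) (simp add: mult.commute)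
    finally have "(\<Sum>i\<in>UNIV. \<Sum>j\<in>UNIV. W i * U j * P (mvar i) (P (mvar j) c))
       = (\<Sum>i\<in>UNIV. \<Sum>j\<in>UNIV. U i * W j * P (mvar j) (P (mvar i) c))" .
    moreover have "P (P a b) c = P a (P b c) - P b (P a c)" for a b
      using P_leibniz_jacobi[of a b c] by simp
    ultimately show ?thesis by (simp add: right_diff_distrib sum_subtractf)
  qed
  have "anchor (bracket U W) c = (\<Sum>l\<in>UNIV. anchor U (W l) * P (mvar l) c) - (\<Sum>l\<in>UNIV. anchor W (U l) * P (mvar l) c)
     + (\<Sum>l\<in>UNIV. (\<Sum>i\<in>UNIV. \<Sum>j\<in>UNIV. U i * W j * mpderiv l (P (mvar i) (mvar j))) * P (mvar l) c)"
    unfolding anchor_def[of "bracket U W"] by (simp add: bracket_def distrib_right left_diff_distrib sum.distrib sum_subtractf)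
  then show ?thesis
    unfolding expand bracket[symmetric] jac by simp
qed

text \<open>
  The cyclic form makes linearity in the last argument enough for linearity in all three.
\<close>

definition jacobiator ::
    "('n \<Rightarrow> ('n, 'k) mpoly) \<Rightarrow> ('n \<Rightarrow> ('n, 'k) mpoly) \<Rightarrow> ('n \<Rightarrow> ('n, 'k) mpoly) \<Rightarrow> 'n \<Rightarrow> ('n, 'k) mpoly" where
  "jacobiator U W V = (\<lambda>l. bracket U (bracket W V) l + bracket W (bracket V U) l + bracket V (bracket U W) l)"

lemma jacobiator_cyclic: "jacobiator U W V = jacobiator W V U"
  by (simp add: jacobiator_def algebra_simps)

lemma jacobiator_add: "jacobiator U W (\<lambda>l. V l + V' l) = (\<lambda>l. jacobiator U W V l + jacobiator U W V' l)"
  by (simp add: jacobiator_def bracket_add_right bracket_add_left algebra_simps)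

text \<open>
  The terms in which \<open>a\<close> is differentiated once cancel in pairs, and those in which it is differentiated
  twice cancel by \<open>anchor_bracket\<close>.
\<close>

lemma jacobiator_smult: "jacobiator U W (\<lambda>l. a * V l) = (\<lambda>l. a * jacobiator U W V l)"
proof
  fix l
  have left: "bracket (\<lambda>l. a * V l) Y = (\<lambda>l. a * bracket V Y l - anchor Y a * V l)" for Y
    unfolding bracket_anti[of "\<lambda>l. a * V l" Y] bracket_anti[of V Y] by (simp add: bracket_leibniz algebra_simps)
  have WU: "bracket W U = (\<lambda>l. - bracket U W l)" by (rule bracket_anti)
  show "jacobiator U W (\<lambda>l. a * V l) l = a * jacobiator U W V l"
    unfolding jacobiator_def bracket_leibniz left bracket_add_right bracket_diff_right anchor_bracket
    using fun_cong[OF bracket_anti[of V U], of l]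
    by (simp add: algebra_simps)
qed

text \<open>
  By linearity it suffices to treat exact forms, where \<open>bracket_grad\<close> turns the jacobiator into the
  differential of the Jacobi identity for \<open>P\<close>.
\<close>

lemma jacobiator_zero: "jacobiator U W V = (\<lambda>l. 0)"
proof -
  have ggg: "jacobiator (grad a) (grad b) (grad c) = (\<lambda>l. 0)" for a b c
    using P_jacobi[of a b c] by (simp add: jacobiator_def bracket_grad mpderiv_add[symmetric])
  have extend: "jacobiator U W V = (\<lambda>l. 0)" if "\<And>c. jacobiator U W (grad c) = (\<lambda>l. 0)" for U W V
    by (induction V rule: one_form_induct) (simp_all add: jacobiator_add jacobiator_smult that)
  have ggV: "jacobiator (grad a) (grad b) V = (\<lambda>l. 0)" for a b V
    by (rule extend) (rule ggg)
  have "jacobiator V (grad a) W = (\<lambda>l. 0)" for a V W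
    by (rule extend) (subst jacobiator_cyclic, rule ggV)
  then have "jacobiator W V (grad a) = (\<lambda>l. 0)" for a V W
    by (metis jacobiator_cyclic)
  then show ?thesis by (rule extend)
qed

lemma bracket_jacobi: "bracket U (bracket W V) = (\<lambda>l. bracket (bracket U W) V l + bracket W (bracket U V) l)"
proof
  fix l
  have "bracket W (bracket V U) l = - bracket W (bracket U V) l"
    by (subst bracket_anti[of V U]) (simp add: bracket_uminus_right)
  moreover have "bracket V (bracket U W) l = - bracket (bracket U W) V l" by (simp add: bracket_anti[of V])
  ultimately show "bracket U (bracket W V) l = bracket (bracket U W) V l + bracket W (bracket U V) l"
    using fun_cong[OF jacobiator_zero[of U W V], of l] by (simp add: jacobiator_def algebra_simps)
qed

end

section \<open>The action of one-forms on the conormal module\<close>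

locale relations =
  fixes k :: nat and f :: "nat \<Rightarrow> ('n::finite, 'k::field_char_0) mpoly"
begin

abbreviation I :: "('n, 'k) mpoly set" where "I \<equiv> gen_ideal k f"

sublocale I: ring_ideal I by (rule ring_ideal_gen_ideal)

definition combination :: "(nat \<Rightarrow> ('n, 'k) mpoly) \<Rightarrow> ('n, 'k) mpoly" where
  "combination V = (\<Sum>\<mu><k. V \<mu> * f \<mu>)"

text \<open>
  The differential \<open>\<partial>\<close> on polynomial lifts: \<open>V\<close> times the Jacobian matrix of \<open>f\<close>.
\<close>

definition jacobian :: "(nat \<Rightarrow> ('n, 'k) mpoly) \<Rightarrow> 'n \<Rightarrow> ('n, 'k) mpoly" where
  "jacobian V = (\<lambda>l. \<Sum>\<mu><k. V \<mu> * mpderiv l (f \<mu>))"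

lemma combination_in_ideal: "combination V \<in> I"
  by (auto simp: combination_def mem_gen_ideal_iff)

text \<open>
  By the product rule, \<open>\<partial> V\<close> is the conormal map \<open>I/I\<^sup>2 \<rightarrow> \<Omega>\<close>, \<open>g \<mapsto> dg\<close>, in coordinates. Facts about \<open>\<partial>\<close>
  are proved below by passing to the exact form \<open>d (combination V)\<close>.
\<close>

lemma jacobian_cong_grad: "jacobian V l - mpderiv l (combination V) \<in> I"
proof -
  have "jacobian V l - mpderiv l (combination V) = - combination (\<lambda>\<mu>. mpderiv l (V \<mu>))"
    by (simp add: jacobian_def combination_def mpderiv_sum mpderiv_mult sum.distrib)
  then show ?thesis using I.uminus[OF combination_in_ideal] by simp
qed

end

locale poisson_complete_intersection = poisson_polynomial_algebra P + relations k f
  for P :: "('n::finite, 'k::field_char_0) mpoly \<Rightarrow> ('n, 'k) mpoly \<Rightarrow> ('n, 'k) mpoly"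
    and k :: nat and f :: "nat \<Rightarrow> ('n, 'k) mpoly" +
  fixes Z :: "'n \<Rightarrow> nat \<Rightarrow> nat \<Rightarrow> ('n, 'k) mpoly"
  assumes poisson_ideal: "poisson_ideal P (gen_ideal k f)"
    and Z: "\<mu> < k \<Longrightarrow> P (mvar i) (f \<mu>) = (\<Sum>\<nu><k. Z i \<mu> \<nu> * f \<nu>)"
    and ci: "complete_intersection k f"
begin

lemma P_in_ideal: "a \<in> I \<Longrightarrow> P a b \<in> I" "a \<in> I \<Longrightarrow> P b a \<in> I"
proof -
  show *: "P a b \<in> I" if "a \<in> I" using poisson_ideal that by (auto simp: poisson_ideal_def)
  show "P b a \<in> I" if "a \<in> I" using I.uminus[OF *[OF that]] P_anti[of b a] by simp
qed

lemma anchor_in_ideal: "c \<in> I \<Longrightarrow> anchor U c \<in> I"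
  unfolding anchor_def by (intro I.sum I.mult P_in_ideal)

lemma anchor_in_ideal_left: "(\<And>l. U l \<in> I) \<Longrightarrow> anchor U c \<in> I"
  unfolding anchor_def by (intro I.sum I.mult_right)

lemma bracket_in_ideal: "(\<And>l. W l \<in> I) \<Longrightarrow> bracket U W l \<in> I"
  unfolding bracket_def
  by (intro I.add[OF I.diff[OF anchor_in_ideal anchor_in_ideal_left]] I.sum I.mult_right[OF I.mult])

lemma bracket_cong:
  assumes "\<And>l. U l - U' l \<in> I" "\<And>l. W l - W' l \<in> I"
  shows "bracket U W l - bracket U' W' l \<in> I"
proof -
  have "bracket U W l - bracket U' W' l = bracket U (\<lambda>l. W l - W' l) l - bracket W' (\<lambda>l. U l - U' l) l"
    using fun_cong[OF bracket_anti[of W' U], of l] fun_cong[OF bracket_anti[of W' U'], of l]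
    by (simp add: bracket_diff_right)
  also have "\<dots> \<in> I" by (rule I.diff[OF bracket_in_ideal bracket_in_ideal]) (rule assms)+
  finally show ?thesis .
qed

text \<open>
  The bracket \<open>[U, V]\<close> of an element of degree zero with one of degree one: the values
  \<open>[e\<^sub>i, \<epsilon>\<^sub>\<mu>] = \<Sum>\<^sub>\<nu> Z\<^sub>i\<^sub>\<mu>\<^sub>\<nu> \<epsilon>\<^sub>\<nu>\<close> are extended linearly in \<open>U\<close> and by the Leibniz rule in \<open>V\<close>.
\<close>

definition act :: "('n \<Rightarrow> ('n, 'k) mpoly) \<Rightarrow> (nat \<Rightarrow> ('n, 'k) mpoly) \<Rightarrow> nat \<Rightarrow> ('n, 'k) mpoly" where
  "act U V = (\<lambda>\<nu>. anchor U (V \<nu>) + (\<Sum>i\<in>UNIV. \<Sum>\<mu><k. U i * V \<mu> * Z i \<mu> \<nu>))"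

lemma combination_zero_imp: "combination V = 0 \<Longrightarrow> \<nu> < k \<Longrightarrow> V \<nu> \<in> I"
  unfolding combination_def by (rule koszul_syzygy_coeff[OF ci])

lemma act_in_ideal: "(\<And>\<mu>. \<mu> < k \<Longrightarrow> V \<mu> \<in> I) \<Longrightarrow> \<nu> < k \<Longrightarrow> act U V \<nu> \<in> I"
  unfolding act_def by (intro I.add anchor_in_ideal I.sum I.mult_right I.mult) auto

lemma act_in_ideal_left: "(\<And>l. U l \<in> I) \<Longrightarrow> act U V \<nu> \<in> I"
  unfolding act_def by (intro I.add anchor_in_ideal_left I.sum I.mult_right) auto

lemma act_add_left: "act (\<lambda>l. U l + W l) V = (\<lambda>\<nu>. act U V \<nu> + act W V \<nu>)"
  by (simp add: act_def anchor_add_left sum.distrib algebra_simps)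

lemma act_diff_left: "act (\<lambda>l. U l - W l) V = (\<lambda>\<nu>. act U V \<nu> - act W V \<nu>)"
  by (simp add: act_def anchor_diff_left sum_subtractf algebra_simps)

lemma act_smult_left: "act (\<lambda>l. a * U l) V = (\<lambda>\<nu>. a * act U V \<nu>)"
  by (simp add: act_def anchor_smult_left sum_distrib_left distrib_left mult_ac)

lemma act_add_right: "act U (\<lambda>\<mu>. V \<mu> + V' \<mu>) = (\<lambda>\<nu>. act U V \<nu> + act U V' \<nu>)"
  by (simp add: act_def anchor_add sum.distrib algebra_simps)

lemma act_leibniz: "act U (\<lambda>\<mu>. a * V \<mu>) = (\<lambda>\<nu>. a * act U V \<nu> + anchor U a * V \<nu>)"
  by (simp add: act_def anchor_mult sum_distrib_left distrib_left mult_ac) (simp add: algebra_simps)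

lemma act_diff_right: "act U (\<lambda>\<mu>. V \<mu> - V' \<mu>) = (\<lambda>\<nu>. act U V \<nu> - act U V' \<nu>)"
  by (simp add: act_def anchor_diff sum_subtractf algebra_simps)

lemma act_zero [simp]: "act (\<lambda>l. 0) V = (\<lambda>\<nu>. 0)" "act U (\<lambda>\<mu>. 0) = (\<lambda>\<nu>. 0)"
  by (simp_all add: act_def anchor_def)

lemma act_cong:
  assumes "\<And>l. U l - U' l \<in> I" "\<And>\<mu>. \<mu> < k \<Longrightarrow> V \<mu> - V' \<mu> \<in> I" "\<nu> < k"
  shows "act U V \<nu> - act U' V' \<nu> \<in> I"
proof -
  have "act U V \<nu> - act U' V' \<nu> = act U (\<lambda>\<mu>. V \<mu> - V' \<mu>) \<nu> + act (\<lambda>l. U l - U' l) V' \<nu>"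
    by (simp add: act_diff_right act_diff_left)
  also have "\<dots> \<in> I" by (rule I.add[OF act_in_ideal act_in_ideal_left]) (use assms in auto)
  finally show ?thesis .
qed

text \<open>
  The action lifts the derivation \<open>anchor U\<close> of \<open>I\<close> to coefficients; this is the meaning of
  the equations satisfied by \<open>Z\<close>, and it holds before reduction modulo \<open>I\<close>.
\<close>

lemma combination_act: "combination (act U V) = anchor U (combination V)"
proof -
  have "anchor U (f \<mu>) = (\<Sum>i\<in>UNIV. \<Sum>\<nu><k. U i * Z i \<mu> \<nu> * f \<nu>)" if "\<mu> < k" for \<mu>
    by (simp add: anchor_def Z[OF that] sum_distrib_left mult.assoc)
  then have "(\<Sum>\<mu><k. V \<mu> * anchor U (f \<mu>))
      = (\<Sum>\<mu><k. \<Sum>i\<in>UNIV. \<Sum>\<nu><k. U i * V \<mu> * Z i \<mu> \<nu> * f \<nu>)"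
    by (simp add: sum_distrib_left mult_ac)
  also have "\<dots> = (\<Sum>\<mu><k. \<Sum>\<nu><k. \<Sum>i\<in>UNIV. U i * V \<mu> * Z i \<mu> \<nu> * f \<nu>)"
    by (intro sum.cong refl sum.swap)
  also have "\<dots> = (\<Sum>\<nu><k. \<Sum>\<mu><k. \<Sum>i\<in>UNIV. U i * V \<mu> * Z i \<mu> \<nu> * f \<nu>)"
    by (rule sum.swap)
  also have "\<dots> = (\<Sum>\<nu><k. \<Sum>i\<in>UNIV. \<Sum>\<mu><k. U i * V \<mu> * Z i \<mu> \<nu> * f \<nu>)"
    by (intro sum.cong refl sum.swap)
  finally show ?thesis
    by (simp add: combination_def act_def anchor_sum anchor_mult distrib_right sum.distrib sum_distrib_right)
qed

text \<open>
  The curvature of the action is a syzygy, since \<open>anchor\<close> is a homomorphism of Lie algebras; so its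
  entries lie in \<open>I\<close>.
\<close>

lemma act_flat:
  assumes "\<nu> < k"
  shows "act (bracket U W) V \<nu> - (act U (act W V) \<nu> - act W (act U V) \<nu>) \<in> I"
proof -
  have combination_diff: "combination (\<lambda>\<nu>. V \<nu> - V' \<nu>) = combination V - combination V'" for V V'
    by (simp add: combination_def left_diff_distrib sum_subtractf)
  show ?thesis
    using assms by (intro combination_zero_imp) (simp_all add: combination_diff combination_act anchor_bracket)
qed

text \<open>
  On exact \<open>U\<close> this is \<open>bracket_grad\<close>. For general \<open>U\<close> the two sides differ by derivatives of the
  coefficients of \<open>U\<close> times brackets with \<open>c\<close>, and brackets with \<open>c\<close> are in \<open>I\<close> because \<open>I\<close> is a
  Poisson ideal.
\<close>

lemma bracket_grad_ideal:
  assumes c: "c \<in> I"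
  shows "bracket U (grad c) l - mpderiv l (anchor U c) \<in> I"
proof -
  have "mpderiv l (P (mvar i) c) = P (mvar i) (mpderiv l c)
      + (\<Sum>j\<in>UNIV. mpderiv j c * mpderiv l (P (mvar i) (mvar j)))" for i
  proof -
    have "mpderiv l (P (mvar i) c) = bracket (grad (mvar i)) (grad c) l" by (simp add: bracket_grad)
    also have "anchor (grad c) (mpderiv l (mvar i)) = 0"
      using anchor_mconst[of "grad c" 1] by (simp add: mpderiv_mvar)
    then have "bracket (grad (mvar i)) (grad c) l = P (mvar i) (mpderiv l c)
        + (\<Sum>i'\<in>UNIV. mpderiv i' (mvar i) * (\<Sum>j\<in>UNIV. mpderiv j c * mpderiv l (P (mvar i') (mvar j))))"
      by (simp add: bracket_def anchor_grad sum_distrib_left mult.assoc)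
    also have "\<dots> = P (mvar i) (mpderiv l c) + (\<Sum>j\<in>UNIV. mpderiv j c * mpderiv l (P (mvar i) (mvar j)))"
      by (simp add: mpderiv_mvar if_distrib[of "\<lambda>x. x * _"] cong: if_cong)
    finally show ?thesis .
  qed
  then have "mpderiv l (anchor U c) = (\<Sum>i\<in>UNIV. mpderiv l (U i) * P (mvar i) c) + anchor U (mpderiv l c)
      + (\<Sum>i\<in>UNIV. \<Sum>j\<in>UNIV. U i * mpderiv j c * mpderiv l (P (mvar i) (mvar j)))"
    by (simp add: anchor_def mpderiv_sum mpderiv_mult sum.distrib distrib_left sum_distrib_left mult.assoc)
  then have "bracket U (grad c) l - mpderiv l (anchor U c) = - P c (U l) - (\<Sum>i\<in>UNIV. mpderiv l (U i) * P (mvar i) c)"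
    by (simp add: bracket_def anchor_grad)
  also have "\<dots> \<in> I" using c by (intro I.diff I.uminus I.sum I.mult P_in_ideal)
  finally show ?thesis .
qed

text \<open>
  Compatibility of \<open>\<partial>\<close> with the bracket of degrees zero and one: modulo \<open>I\<close> both sides are the differential
  of \<open>anchor U (combination V)\<close>.
\<close>

lemma bracket_jacobian: "bracket U (jacobian V) l - jacobian (act U V) l \<in> I"
proof -
  have "bracket U (\<lambda>l. jacobian V l - mpderiv l (combination V)) l \<in> I" by (intro bracket_in_ideal jacobian_cong_grad)
  then have "bracket U (jacobian V) l - bracket U (grad (combination V)) l \<in> I" by (simp add: bracket_diff_right)
  moreover have "bracket U (grad (combination V)) l - mpderiv l (combination (act U V)) \<in> I"
    unfolding combination_act by (intro bracket_grad_ideal combination_in_ideal)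
  moreover have "jacobian (act U V) l - mpderiv l (combination (act U V)) \<in> I" by (rule jacobian_cong_grad)
  ultimately have "(bracket U (jacobian V) l - bracket U (grad (combination V)) l) + (bracket U (grad (combination V)) l - mpderiv l (combination (act U V)))
      - (jacobian (act U V) l - mpderiv l (combination (act U V))) \<in> I"
    by (rule I.diff[OF I.add])
  then show ?thesis by simp
qed

text \<open>
  Compatibility of \<open>\<partial>\<close> with the bracket of two elements of degree one, which is zero. With
  \<open>g\<close> and \<open>g'\<close> for the combinations of \<open>V\<close> and \<open>V'\<close>, the sum of the two actions has combination
  \<open>{g, g'} + {g', g} = 0\<close>, so it is a syzygy.
\<close>

lemma act_jacobian:
  assumes "\<nu> < k" shows "act (jacobian V) V' \<nu> + act (jacobian V') V \<nu> \<in> I"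
proof -
  have cong: "act (jacobian V) V' \<nu> - act (grad (combination V)) V' \<nu> \<in> I" for V V'
  proof -
    have "act (\<lambda>l. jacobian V l - mpderiv l (combination V)) V' \<nu> \<in> I" by (intro act_in_ideal_left jacobian_cong_grad)
    then show ?thesis by (simp add: act_diff_left)
  qed
  have combination_add: "combination (\<lambda>\<nu>. V \<nu> + V' \<nu>) = combination V + combination V'" for V V'
    by (simp add: combination_def distrib_right sum.distrib)
  have "act (grad (combination V)) V' \<nu> + act (grad (combination V')) V \<nu> \<in> I"
    using assms P_anti[of "combination V" "combination V'"] by (intro combination_zero_imp) (simp_all add: combination_add combination_act anchor_grad)
  from I.add[OF I.add[OF cong[of V V'] cong[of V' V]] this] show ?thesis
    by (simp add: algebra_simps)
qed

lemma anchor_jacobian: "anchor (jacobian V) c \<in> I"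
proof -
  have "anchor (\<lambda>l. jacobian V l - mpderiv l (combination V)) c \<in> I" by (intro anchor_in_ideal_left jacobian_cong_grad)
  then have "anchor (jacobian V) c - P (combination V) c \<in> I" by (simp add: anchor_diff_left anchor_grad)
  from I.add[OF this P_in_ideal(1)[OF combination_in_ideal, of V c]] show ?thesis by simp
qed

end

section \<open>Submodules, quotients and free modules\<close>

lemma lin_mapsD:
  assumes "h \<in> lin_maps R M N"
  shows "x \<in> carrier M \<Longrightarrow> h x \<in> carrier N"
    "x \<in> carrier M \<Longrightarrow> y \<in> carrier M \<Longrightarrow> h (x \<oplus>\<^bsub>M\<^esub> y) = h x \<oplus>\<^bsub>N\<^esub> h y"
    "a \<in> carrier R \<Longrightarrow> x \<in> carrier M \<Longrightarrow> h (a \<odot>\<^bsub>M\<^esub> x) = a \<odot>\<^bsub>N\<^esub> h x"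
  using assms by (auto simp: lin_maps_def)

lemma lin_map_zero:
  assumes "module R M" "module R N" "h \<in> lin_maps R M N"
  shows "h \<zero>\<^bsub>M\<^esub> = \<zero>\<^bsub>N\<^esub>"
proof -
  interpret M: module R M by fact
  interpret N: module R N by fact
  have "h (\<zero>\<^bsub>R\<^esub> \<odot>\<^bsub>M\<^esub> \<zero>\<^bsub>M\<^esub>) = \<zero>\<^bsub>R\<^esub> \<odot>\<^bsub>N\<^esub> h \<zero>\<^bsub>M\<^esub>"
    by (rule lin_mapsD[OF assms(3)]) auto
  then show ?thesis using lin_mapsD(1)[OF assms(3), of "\<zero>\<^bsub>M\<^esub>"] by simp
qed

lemma lin_map_minus:
  assumes "module R M" "module R N" "h \<in> lin_maps R M N" "x \<in> carrier M" "y \<in> carrier M"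
  shows "h (x \<ominus>\<^bsub>M\<^esub> y) = h x \<ominus>\<^bsub>N\<^esub> h y"
proof -
  interpret M: module R M by fact
  interpret N: module R N by fact
  have "h (\<ominus>\<^bsub>M\<^esub> y) \<oplus>\<^bsub>N\<^esub> h y = \<zero>\<^bsub>N\<^esub>"
    using lin_mapsD(2)[OF assms(3), of "\<ominus>\<^bsub>M\<^esub> y" y] assms lin_map_zero[OF assms(1-3)]
    by (simp add: M.l_neg)
  then have "h (\<ominus>\<^bsub>M\<^esub> y) = \<ominus>\<^bsub>N\<^esub> h y"
    using assms lin_mapsD(1)[OF assms(3)] N.minus_equality by (metis M.a_inv_closed)
  then show ?thesis
    using lin_mapsD(2)[OF assms(3), of x "\<ominus>\<^bsub>M\<^esub> y"] assms by (simp add: a_minus_def)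
qed

lemma submodule_lin_vimage:
  assumes "module R M" "module R N" "h \<in> lin_maps R M N" "submodule H R N"
  shows "submodule {x \<in> carrier M. h x \<in> H} R M"
proof -
  interpret M: module R M by fact
  interpret N: module R N by fact
  note E = N.submoduleE[OF assms(4)]
  have "\<zero>\<^bsub>N\<^esub> \<in> H" using assms(4) subgroup.one_closed[of H "add_monoid N"]
    by (simp add: submodule_def)
  moreover have "h (\<ominus>\<^bsub>M\<^esub> x) \<in> H" if "x \<in> carrier M" "h x \<in> H" for x
    using lin_map_minus[OF assms(1-3), of "\<zero>\<^bsub>M\<^esub>" x] that E(3)[OF that(2)] lin_map_zero[OF assms(1-3)]
      lin_mapsD(1)[OF assms(3)]
    by (simp add: a_minus_def)
  ultimately show ?thesis
    using lin_mapsD[OF assms(3)] lin_map_zero[OF assms(1-3)] E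
    by (intro M.submoduleI) auto
qed

lemma (in module) span_submodule:
  assumes "G \<subseteq> carrier M"
  shows "submodule (span_submodule R M G) R M" "G \<subseteq> span_submodule R M G"
    "submodule H R M \<Longrightarrow> G \<subseteq> H \<Longrightarrow> span_submodule R M G \<subseteq> H"
proof -
  have zero: "\<zero>\<^bsub>M\<^esub> \<in> H" if "submodule H R M" for H
    using that subgroup.one_closed[of H "add_monoid M"] by (simp add: submodule_def)
  have "span_submodule R M G \<subseteq> carrier M"
    unfolding span_submodule_def using carrier_is_submodule assms by blast
  then show "submodule (span_submodule R M G) R M"
    by (intro submoduleI) (auto simp: span_submodule_def zero submoduleE)
qed (auto simp: span_submodule_def)

lemma pow_module_simps:
  "carrier (pow_module R J) = {u. (\<forall>j\<in>J. u j \<in> carrier R) \<and> u \<in> extensional J}"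
  "\<zero>\<^bsub>pow_module R J\<^esub> = (\<lambda>j\<in>J. \<zero>\<^bsub>R\<^esub>)"
  "u \<oplus>\<^bsub>pow_module R J\<^esub> v = (\<lambda>j\<in>J. u j \<oplus>\<^bsub>R\<^esub> v j)"
  "a \<odot>\<^bsub>pow_module R J\<^esub> u = (\<lambda>j\<in>J. a \<otimes>\<^bsub>R\<^esub> u j)"
  by (auto simp: pow_module_def PiE_iff extensional_def)

lemma pow_module_is_module:
  assumes "cring R" shows "module R (pow_module R J)"
proof -
  interpret cring R by fact
  show ?thesis
  proof (rule moduleI)
    show "abelian_group (pow_module R J)"
    proof (rule abelian_groupI)
      show "\<exists>v\<in>carrier (pow_module R J). v \<oplus>\<^bsub>pow_module R J\<^esub> u = \<zero>\<^bsub>pow_module R J\<^esub>"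
        if "u \<in> carrier (pow_module R J)" for u
      proof -
        have "u j \<in> carrier R" if "j \<in> J" for j
          using that \<open>u \<in> carrier (pow_module R J)\<close> by (auto simp: pow_module_simps)
        then show ?thesis
          by (intro bexI[of _ "\<lambda>j\<in>J. \<ominus>\<^bsub>R\<^esub> u j"]) (auto simp: pow_module_simps l_neg intro!: restrict_ext)
      qed
    qed (auto simp: pow_module_simps a_ac extensional_def fun_eq_iff restrict_def)
  qed (auto simp: pow_module_simps assms l_distr r_distr m_assoc extensional_def fun_eq_iff restrict_def)
qed

lemma free_module_simps:
  "carrier (free_module R J) =
     {u. (\<forall>j\<in>J. u j \<in> carrier R) \<and> u \<in> extensional J \<and> finite {j \<in> J. u j \<noteq> \<zero>\<^bsub>R\<^esub>}}"
  "\<zero>\<^bsub>free_module R J\<^esub> = (\<lambda>j\<in>J. \<zero>\<^bsub>R\<^esub>)"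
  "u \<oplus>\<^bsub>free_module R J\<^esub> v = (\<lambda>j\<in>J. u j \<oplus>\<^bsub>R\<^esub> v j)"
  "a \<odot>\<^bsub>free_module R J\<^esub> u = (\<lambda>j\<in>J. a \<otimes>\<^bsub>R\<^esub> u j)"
  by (auto simp: free_module_def pow_module_def PiE_iff extensional_def)

lemma pow_module_minus:
  assumes "cring R" "u \<in> carrier (pow_module R J)"
  shows "\<ominus>\<^bsub>pow_module R J\<^esub> u = (\<lambda>j\<in>J. \<ominus>\<^bsub>R\<^esub> u j)"
proof -
  interpret cring R by fact
  interpret M: module R "pow_module R J" by (rule pow_module_is_module) fact
  have "u j \<in> carrier R" if "j \<in> J" for j
    using that assms(2) by (auto simp: pow_module_simps)
  then show ?thesis
    using assms(2)
    by (intro M.minus_equality) (auto simp: pow_module_simps l_neg intro!: restrict_ext)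
qed

lemma free_module_is_module:
  assumes "cring R" shows "module R (free_module R J)"
proof -
  interpret cring R by fact
  interpret M: module R "pow_module R J" by (rule pow_module_is_module) fact
  let ?F = "carrier (free_module R J)"
  have "submodule ?F R (pow_module R J)"
  proof (rule M.submoduleI)
    show "\<ominus>\<^bsub>pow_module R J\<^esub> u \<in> ?F" if "u \<in> ?F" for u
    proof -
      have "{j \<in> J. \<ominus>\<^bsub>R\<^esub> u j \<noteq> \<zero>\<^bsub>R\<^esub>} \<subseteq> {j \<in> J. u j \<noteq> \<zero>\<^bsub>R\<^esub>}" by auto
      then show ?thesis
        using that by (auto simp: pow_module_minus assms pow_module_simps free_module_simps cong: conj_cong
            intro: finite_subset)
    qed
    show "u \<oplus>\<^bsub>pow_module R J\<^esub> v \<in> ?F" if "u \<in> ?F" "v \<in> ?F" for u v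
    proof -
      have "{j \<in> J. u j \<oplus>\<^bsub>R\<^esub> v j \<noteq> \<zero>\<^bsub>R\<^esub>} \<subseteq> {j \<in> J. u j \<noteq> \<zero>\<^bsub>R\<^esub>} \<union> {j \<in> J. v j \<noteq> \<zero>\<^bsub>R\<^esub>}"
        by auto
      then show ?thesis
        using that by (auto simp: free_module_simps pow_module_simps cong: conj_cong intro: finite_subset)
    qed
    show "a \<odot>\<^bsub>pow_module R J\<^esub> u \<in> ?F" if "a \<in> carrier R" "u \<in> ?F" for a u
    proof -
      have "{j \<in> J. a \<otimes>\<^bsub>R\<^esub> u j \<noteq> \<zero>\<^bsub>R\<^esub>} \<subseteq> {j \<in> J. u j \<noteq> \<zero>\<^bsub>R\<^esub>}" using that by auto
      then show ?thesis
        using that by (auto simp: free_module_simps pow_module_simps cong: conj_cong intro: finite_subset)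
    qed
  qed (auto simp: free_module_simps pow_module_simps cong: conj_cong)
  from submodule.submodule_is_module[OF this M.module_axioms] show ?thesis
    by (simp add: free_module_def)
qed

lemma unit_vec_closed: "cring R \<Longrightarrow> unit_vec R J j \<in> carrier (free_module R J)"
proof -
  assume "cring R"
  then interpret cring R .
  have "{i \<in> J. (if i = j then \<one>\<^bsub>R\<^esub> else \<zero>\<^bsub>R\<^esub>) \<noteq> \<zero>\<^bsub>R\<^esub>} \<subseteq> {j}" by auto
  then show ?thesis
    by (auto simp: free_module_simps unit_vec_def cong: conj_cong intro: finite_subset)
qed

lemma sum_module_simps:
  "carrier (sum_module M N) = carrier M \<times> carrier N"
  "\<zero>\<^bsub>sum_module M N\<^esub> = (\<zero>\<^bsub>M\<^esub>, \<zero>\<^bsub>N\<^esub>)"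
  "(x, y) \<oplus>\<^bsub>sum_module M N\<^esub> (x', y') = (x \<oplus>\<^bsub>M\<^esub> x', y \<oplus>\<^bsub>N\<^esub> y')"
  "a \<odot>\<^bsub>sum_module M N\<^esub> (x, y) = (a \<odot>\<^bsub>M\<^esub> x, a \<odot>\<^bsub>N\<^esub> y)"
  by (simp_all add: sum_module_def)

lemma sum_module_is_module:
  assumes "module R M" "module R N" shows "module R (sum_module M N)"
proof -
  interpret M: module R M by fact
  interpret N: module R N by fact
  show ?thesis
  proof (rule moduleI)
    show "abelian_group (sum_module M N)"
    proof (rule abelian_groupI)
      show "\<exists>v\<in>carrier (sum_module M N). v \<oplus>\<^bsub>sum_module M N\<^esub> u = \<zero>\<^bsub>sum_module M N\<^esub>"
        if "u \<in> carrier (sum_module M N)" for u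
        using that
        by (intro bexI[of _ "(\<ominus>\<^bsub>M\<^esub> fst u, \<ominus>\<^bsub>N\<^esub> snd u)"])
           (auto simp: sum_module_simps M.l_neg N.l_neg)
    qed (auto simp: sum_module_simps M.a_ac N.a_ac)
  qed (auto simp: sum_module_simps M.R.is_cring M.smult_l_distr N.smult_l_distr
      M.smult_r_distr N.smult_r_distr M.smult_assoc1 N.smult_assoc1)
qed

locale quotient_module = module R M for R (structure) and M (structure) +
  fixes H
  assumes H: "submodule H R M"
begin

lemma H_subgroup: "abelian_subgroup H M"
  using H by (intro abelian_subgroupI3 additive_subgroupI) (auto simp: submodule_def M.abelian_group_axioms)

sublocale H: abelian_subgroup H M by (rule H_subgroup)

lemma coset_eq_iff:
  assumes "x \<in> carrier M" "y \<in> carrier M"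
  shows "H +>\<^bsub>M\<^esub> x = H +>\<^bsub>M\<^esub> y \<longleftrightarrow> x \<ominus>\<^bsub>M\<^esub> y \<in> H"
proof
  assume "H +>\<^bsub>M\<^esub> x = H +>\<^bsub>M\<^esub> y"
  then have "x \<in> H +>\<^bsub>M\<^esub> y" using H.a_rcos_self assms by auto
  then show "x \<ominus>\<^bsub>M\<^esub> y \<in> H" using H.a_rcos_module assms by (simp add: a_minus_def)
next
  assume "x \<ominus>\<^bsub>M\<^esub> y \<in> H"
  then have "x \<in> H +>\<^bsub>M\<^esub> y" using H.a_rcos_module assms by (simp add: a_minus_def)
  then show "H +>\<^bsub>M\<^esub> x = H +>\<^bsub>M\<^esub> y"
    using H.a_repr_independence' assms by auto
qed

lemma coset_zero_iff: "x \<in> carrier M \<Longrightarrow> H +>\<^bsub>M\<^esub> x = H \<longleftrightarrow> x \<in> H"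
  using coset_eq_iff[of x "\<zero>\<^bsub>M\<^esub>"] H.a_subset M.minus_equality[of "\<zero>\<^bsub>M\<^esub>" "\<zero>\<^bsub>M\<^esub>"]
  by (simp add: a_minus_def)

lemma quot_simps:
  "carrier (quot_module M H) = (\<lambda>x. H +>\<^bsub>M\<^esub> x) ` carrier M"
  "\<zero>\<^bsub>quot_module M H\<^esub> = H"
  by (auto simp: quot_module_def A_RCOSETS_def')

lemma quot_add:
  "x \<in> carrier M \<Longrightarrow> y \<in> carrier M \<Longrightarrow>
     (H +>\<^bsub>M\<^esub> x) \<oplus>\<^bsub>quot_module M H\<^esub> (H +>\<^bsub>M\<^esub> y) = H +>\<^bsub>M\<^esub> (x \<oplus>\<^bsub>M\<^esub> y)"
  by (simp add: quot_module_def H.a_rcos_sum)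

lemma quot_smult:
  assumes "a \<in> carrier R" "x \<in> carrier M"
  shows "a \<odot>\<^bsub>quot_module M H\<^esub> (H +>\<^bsub>M\<^esub> x) = H +>\<^bsub>M\<^esub> (a \<odot>\<^bsub>M\<^esub> x)"
proof -
  have "H +>\<^bsub>M\<^esub> (a \<odot>\<^bsub>M\<^esub> y) = H +>\<^bsub>M\<^esub> (a \<odot>\<^bsub>M\<^esub> x)" if y: "y \<in> H +>\<^bsub>M\<^esub> x" for y
  proof -
    have yM: "y \<in> carrier M" using y assms H.a_elemrcos_carrier by blast
    then have "y \<ominus>\<^bsub>M\<^esub> x \<in> H" using H.a_rcos_module assms y by (simp add: a_minus_def)
    then have "a \<odot>\<^bsub>M\<^esub> (y \<ominus>\<^bsub>M\<^esub> x) \<in> H" using submodule.smult_closed[OF H] assms by simp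
    then have "a \<odot>\<^bsub>M\<^esub> y \<ominus>\<^bsub>M\<^esub> a \<odot>\<^bsub>M\<^esub> x \<in> H"
      using assms yM by (simp add: a_minus_def smult_r_distr smult_r_minus)
    then show ?thesis using assms yM by (simp add: coset_eq_iff)
  qed
  then have "(\<Union>y\<in>H +>\<^bsub>M\<^esub> x. H +>\<^bsub>M\<^esub> (a \<odot>\<^bsub>M\<^esub> y)) = (\<Union>y\<in>H +>\<^bsub>M\<^esub> x. H +>\<^bsub>M\<^esub> (a \<odot>\<^bsub>M\<^esub> x))"
    by (intro SUP_cong refl)
  also have "\<dots> = H +>\<^bsub>M\<^esub> (a \<odot>\<^bsub>M\<^esub> x)"
    using H.a_rcos_self[of x] assms by (intro UN_constant[THEN trans]) auto
  finally show ?thesis by (simp add: quot_module_def)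
qed

lemma quot_module_is_module: "module R (quot_module M H)"
proof (rule moduleI)
  show "abelian_group (quot_module M H)"
  proof (rule abelian_groupI)
    show "\<zero>\<^bsub>quot_module M H\<^esub> \<in> carrier (quot_module M H)"
      unfolding quot_simps
      by (rule image_eqI[of _ _ "\<zero>\<^bsub>M\<^esub>"]) (use coset_zero_iff[of "\<zero>\<^bsub>M\<^esub>"] in auto)
    show "\<zero>\<^bsub>quot_module M H\<^esub> \<oplus>\<^bsub>quot_module M H\<^esub> x = x" if "x \<in> carrier (quot_module M H)" for x
    proof -
      from that obtain m where m: "m \<in> carrier M" "x = H +>\<^bsub>M\<^esub> m" by (auto simp: quot_simps)
      have "H = H +>\<^bsub>M\<^esub> \<zero>\<^bsub>M\<^esub>" using coset_zero_iff[of "\<zero>\<^bsub>M\<^esub>"] by auto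
      then show ?thesis using m quot_add[of "\<zero>\<^bsub>M\<^esub>" m] by (simp add: quot_simps)
    qed
    show "\<exists>y\<in>carrier (quot_module M H). y \<oplus>\<^bsub>quot_module M H\<^esub> x = \<zero>\<^bsub>quot_module M H\<^esub>"
      if "x \<in> carrier (quot_module M H)" for x
    proof -
      from that obtain m where m: "m \<in> carrier M" "x = H +>\<^bsub>M\<^esub> m" by (auto simp: quot_simps)
      have "H = H +>\<^bsub>M\<^esub> \<zero>\<^bsub>M\<^esub>" using coset_zero_iff[of "\<zero>\<^bsub>M\<^esub>"] by auto
      then show ?thesis using m
        by (intro bexI[of _ "H +>\<^bsub>M\<^esub> (\<ominus>\<^bsub>M\<^esub> m)"]) (auto simp: quot_simps quot_add M.l_neg)
    qed
  qed (auto simp: quot_simps quot_add M.a_ac)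
qed (auto simp: quot_simps quot_add quot_smult smult_l_distr smult_r_distr smult_assoc1 R.is_cring)

end

lemma free_module_induct:
  assumes R: "cring R" and w: "w \<in> carrier (free_module R J)"
    and basis: "\<And>a j. a \<in> carrier R \<Longrightarrow> j \<in> J \<Longrightarrow> Q (a \<odot>\<^bsub>free_module R J\<^esub> unit_vec R J j)"
    and Q_zero: "Q \<zero>\<^bsub>free_module R J\<^esub>"
    and Q_add: "\<And>u v. u \<in> carrier (free_module R J) \<Longrightarrow> v \<in> carrier (free_module R J) \<Longrightarrow> Q u \<Longrightarrow> Q v
      \<Longrightarrow> Q (u \<oplus>\<^bsub>free_module R J\<^esub> v)"
  shows "Q w"
proof -
  interpret cring R by fact
  interpret F: module R "free_module R J" by (rule free_module_is_module) fact
  have "Q u" if "finite K" "u \<in> carrier (free_module R J)" "{j \<in> J. u j \<noteq> \<zero>\<^bsub>R\<^esub>} \<subseteq> K" for K u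
    using that
  proof (induction K arbitrary: u rule: finite_induct)
    case empty
    then have "u = \<zero>\<^bsub>free_module R J\<^esub>"
      by (auto simp: free_module_simps fun_eq_iff extensional_def)
    then show ?case using Q_zero by simp
  next
    case (insert j K)
    show ?case
    proof (cases "j \<in> J")
      case False
      then show ?thesis using insert by blast
    next
      case True
      define v where "v = (\<lambda>i\<in>J. if i = j then \<zero>\<^bsub>R\<^esub> else u i)"
      have "{i \<in> J. v i \<noteq> \<zero>\<^bsub>R\<^esub>} \<subseteq> {i \<in> J. u i \<noteq> \<zero>\<^bsub>R\<^esub>}" by (auto simp: v_def)
      then have v: "v \<in> carrier (free_module R J)"
        using insert.prems by (auto simp: free_module_simps v_def cong: conj_cong intro: finite_subset)
      have "Q v"
        using insert.prems by (intro insert.IH v) (auto simp: v_def)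
      have uj: "u j \<in> carrier R" using insert.prems True by (auto simp: free_module_simps)
      have "u = (u j \<odot>\<^bsub>free_module R J\<^esub> unit_vec R J j) \<oplus>\<^bsub>free_module R J\<^esub> v"
        using insert.prems uj True
        by (auto simp: free_module_simps fun_eq_iff v_def unit_vec_def extensional_def)
      moreover have "Q (\<dots>)"
        using uj True v \<open>Q v\<close> by (intro Q_add basis F.smult_closed unit_vec_closed R)
      ultimately show ?thesis by simp
    qed
  qed
  from this[OF _ w order_refl] w show ?thesis by (simp add: free_module_simps)
qed

text \<open>
  The universal property of the free module, for an arbitrary index set: the Kaehler differentials are
  presented on the free module whose basis is the whole ring.
\<close>

lemma free_module_lift:
  assumes R: "cring R" and N: "module R N" and g: "\<And>j. j \<in> J \<Longrightarrow> g j \<in> carrier N"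
  shows "\<exists>E\<in>lin_maps R (free_module R J) N. \<forall>j\<in>J. E (unit_vec R J j) = g j"
proof -
  interpret cring R by fact
  interpret N: module R N by fact
  interpret F: module R "free_module R J" by (rule free_module_is_module) fact
  let ?F = "free_module R J" and ?S = "\<lambda>u. {j \<in> J. u j \<noteq> \<zero>\<^bsub>R\<^esub>}"
  define E where "E u = (\<Oplus>\<^bsub>N\<^esub>j\<in>?S u. u j \<odot>\<^bsub>N\<^esub> g j)" for u
  \<comment> \<open>Sums of families with different supports are compared over a common finite index set.\<close>
  have E_eq: "E u = (\<Oplus>\<^bsub>N\<^esub>j\<in>K. u j \<odot>\<^bsub>N\<^esub> g j)"
    if "finite K" "K \<subseteq> J" "?S u \<subseteq> K" "u \<in> carrier ?F" for u K
    unfolding E_def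
    using that g by (intro N.add.finprod_mono_neutral_cong_left) (auto simp: free_module_simps)
  have "E \<in> lin_maps R ?F N"
    unfolding lin_maps_def
  proof (intro CollectI conjI ballI)
    show "E \<in> carrier ?F \<rightarrow> carrier N"
      using g by (auto simp: E_def free_module_simps intro!: N.finsum_closed)
    show "E (u \<oplus>\<^bsub>?F\<^esub> v) = E u \<oplus>\<^bsub>N\<^esub> E v" if u: "u \<in> carrier ?F" and v: "v \<in> carrier ?F" for u v
    proof -
      let ?K = "?S u \<union> ?S v"
      have K: "finite ?K" "?K \<subseteq> J" using u v by (auto simp: free_module_simps)
      have "E (u \<oplus>\<^bsub>?F\<^esub> v) = (\<Oplus>\<^bsub>N\<^esub>j\<in>?K. (u \<oplus>\<^bsub>?F\<^esub> v) j \<odot>\<^bsub>N\<^esub> g j)"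
        using u v by (intro E_eq K F.a_closed) (auto simp: free_module_simps)
      also have "\<dots> = (\<Oplus>\<^bsub>N\<^esub>j\<in>?K. u j \<odot>\<^bsub>N\<^esub> g j \<oplus>\<^bsub>N\<^esub> v j \<odot>\<^bsub>N\<^esub> g j)"
        using u v g by (intro N.finsum_cong') (auto simp: free_module_simps N.smult_l_distr)
      also have "\<dots> = E u \<oplus>\<^bsub>N\<^esub> E v"
        using u v g K E_eq[OF K _ u] E_eq[OF K _ v]
        by (subst N.finsum_addf) (auto simp: free_module_simps)
      finally show ?thesis .
    qed
    show "E (a \<odot>\<^bsub>?F\<^esub> u) = a \<odot>\<^bsub>N\<^esub> E u" if a: "a \<in> carrier R" and u: "u \<in> carrier ?F" for a u
    proof -
      let ?K = "?S u"
      have K: "finite ?K" "?K \<subseteq> J" using u by (auto simp: free_module_simps)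
      have "E (a \<odot>\<^bsub>?F\<^esub> u) = (\<Oplus>\<^bsub>N\<^esub>j\<in>?K. (a \<odot>\<^bsub>?F\<^esub> u) j \<odot>\<^bsub>N\<^esub> g j)"
        using u a by (intro E_eq K F.smult_closed) (auto simp: free_module_simps)
      also have "\<dots> = (\<Oplus>\<^bsub>N\<^esub>j\<in>?K. a \<odot>\<^bsub>N\<^esub> (u j \<odot>\<^bsub>N\<^esub> g j))"
        using u a g by (intro N.finsum_cong') (auto simp: free_module_simps N.smult_assoc1)
      also have "\<dots> = a \<odot>\<^bsub>N\<^esub> E u"
        using u a g K by (subst N.finsum_smult_ldistr[symmetric]) (auto simp: free_module_simps E_def)
      finally show ?thesis .
    qed
  qed
  moreover have "E (unit_vec R J j) = g j" if j: "j \<in> J" for j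
  proof -
    have "E (unit_vec R J j) = (\<Oplus>\<^bsub>N\<^esub>i\<in>{j}. unit_vec R J j i \<odot>\<^bsub>N\<^esub> g i)"
      using j by (intro E_eq unit_vec_closed R) (auto simp: unit_vec_def)
    then show ?thesis using j g[OF j] by (simp add: unit_vec_def)
  qed
  ultimately show ?thesis by blast
qed


text \<open>
  The definition of \<open>fg_projective\<close> asks for a basis indexed by an initial segment of the natural numbers, so
  a basis indexed by the variables has to be renumbered.
\<close>

lemma fg_projective_of_free:
  assumes M: "module R M" and J: "finite J"
    and s: "s \<in> lin_maps R M (free_module R J)" and r: "r \<in> lin_maps R (free_module R J) M"
    and rs: "\<And>x. x \<in> carrier M \<Longrightarrow> r (s x) = x"
  shows "fg_projective R M"
proof -
  interpret M: module R M by fact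
  obtain b where b: "bij_betw b {..<card J} J"
    using ex_bij_betw_nat_finite[OF J] by (auto simp: atLeast0LessThan)
  define c where "c = inv_into {..<card J} b"
  have bJ: "b i \<in> J" if "i < card J" for i using b that by (auto simp: bij_betw_def)
  have cJ: "c j < card J" "b (c j) = j" if "j \<in> J" for j
    using that bij_betw_inv_into[OF b] bij_betw_inv_into_right[OF b that]
    by (auto simp: c_def bij_betw_def)
  define s' where "s' x = (\<lambda>i\<in>{..<card J}. s x (b i))" for x
  define r' where "r' u = r (\<lambda>j\<in>J. u (c j))" for u
  have s'_lin: "s' \<in> lin_maps R M (free_module R {..<card J})"
    using s bJ by (auto simp: lin_maps_def s'_def free_module_simps Pi_def intro!: restrict_ext)
  have r'_lin: "r' \<in> lin_maps R (free_module R {..<card J}) M"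
    unfolding lin_maps_def
  proof (intro CollectI conjI ballI)
    have mem: "(\<lambda>j\<in>J. u (c j)) \<in> carrier (free_module R J)"
      if "u \<in> carrier (free_module R {..<card J})" for u
      using that cJ J by (auto simp: free_module_simps)
    show "r' \<in> carrier (free_module R {..<card J}) \<rightarrow> carrier M"
      using mem lin_mapsD(1)[OF r] by (auto simp: r'_def)
    fix u v assume u: "u \<in> carrier (free_module R {..<card J})"
    {
      assume v: "v \<in> carrier (free_module R {..<card J})"
      have "(\<lambda>j\<in>J. (u \<oplus>\<^bsub>free_module R {..<card J}\<^esub> v) (c j))
          = (\<lambda>j\<in>J. u (c j)) \<oplus>\<^bsub>free_module R J\<^esub> (\<lambda>j\<in>J. v (c j))"
        using cJ by (auto simp: free_module_simps intro!: restrict_ext)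
      then show "r' (u \<oplus>\<^bsub>free_module R {..<card J}\<^esub> v) = r' u \<oplus>\<^bsub>M\<^esub> r' v"
        unfolding r'_def using lin_mapsD(2)[OF r mem mem] u v by simp
    next
      fix a assume a: "a \<in> carrier R"
      have "(\<lambda>j\<in>J. (a \<odot>\<^bsub>free_module R {..<card J}\<^esub> u) (c j)) = a \<odot>\<^bsub>free_module R J\<^esub> (\<lambda>j\<in>J. u (c j))"
        using cJ by (auto simp: free_module_simps intro!: restrict_ext)
      then show "r' (a \<odot>\<^bsub>free_module R {..<card J}\<^esub> u) = a \<odot>\<^bsub>M\<^esub> r' u"
        unfolding r'_def using lin_mapsD(3)[OF r a mem] u by simp
    }
  qed
  have "r' (s' x) = x" if x: "x \<in> carrier M" for x
  proof -
    have "s x \<in> extensional J" using lin_mapsD(1)[OF s x] by (simp add: free_module_simps)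
    then have "(\<lambda>j\<in>J. s' x (c j)) = s x"
      using cJ by (auto simp: s'_def extensional_def fun_eq_iff)
    then show ?thesis using rs x by (simp add: r'_def)
  qed
  then show ?thesis
    unfolding fg_projective_def using M s'_lin r'_lin by blast
qed

lemma der_module_is_module:
  assumes R: "cring R" and \<iota>: "\<And>c. \<iota> c \<in> carrier R"
  shows "module R (der_module \<iota> R)"
proof -
  interpret R: cring R by fact
  interpret W: module R "pow_module R (carrier R)" by (rule pow_module_is_module) fact
  let ?D = "derivations \<iota> R"
  have der: "E \<in> ?D \<longleftrightarrow> E \<in> carrier (pow_module R (carrier R)) \<and>
       (\<forall>a\<in>carrier R. \<forall>b\<in>carrier R. E (a \<oplus>\<^bsub>R\<^esub> b) = E a \<oplus>\<^bsub>R\<^esub> E b) \<and>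
       (\<forall>c. \<forall>a\<in>carrier R. E (\<iota> c \<otimes>\<^bsub>R\<^esub> a) = \<iota> c \<otimes>\<^bsub>R\<^esub> E a) \<and>
       (\<forall>a\<in>carrier R. \<forall>b\<in>carrier R. E (a \<otimes>\<^bsub>R\<^esub> b) = E a \<otimes>\<^bsub>R\<^esub> b \<oplus>\<^bsub>R\<^esub> a \<otimes>\<^bsub>R\<^esub> E b)" for E
    by (auto simp: derivations_def pow_module_simps PiE_iff)
  have "submodule ?D R (pow_module R (carrier R))"
  proof (rule W.submoduleI)
    show "?D \<subseteq> carrier (pow_module R (carrier R))" by (auto simp: der)
    show "\<zero>\<^bsub>pow_module R (carrier R)\<^esub> \<in> ?D"
      using \<iota> by (auto simp: der) (auto simp: pow_module_simps)
    show "E \<oplus>\<^bsub>pow_module R (carrier R)\<^esub> F \<in> ?D" if "E \<in> ?D" "F \<in> ?D" for E F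
      using that \<iota> unfolding der
      by (auto simp: pow_module_simps R.r_distr R.l_distr R.a_ac)
    show "\<ominus>\<^bsub>pow_module R (carrier R)\<^esub> E \<in> ?D" if E: "E \<in> ?D" for E
    proof -
      have "E \<in> carrier (pow_module R (carrier R))" using E by (simp add: der)
      then show ?thesis
        using E \<iota> unfolding der
        by (auto simp: pow_module_minus[OF R] R.minus_add R.r_minus R.l_minus)
           (auto simp: pow_module_simps R.minus_add R.r_minus R.l_minus)
    qed
    show "a \<odot>\<^bsub>pow_module R (carrier R)\<^esub> E \<in> ?D" if "a \<in> carrier R" "E \<in> ?D" for a E
      using that \<iota> unfolding der
      by (auto simp: pow_module_simps R.r_distr R.l_distr R.m_ac)
  qed
  from submodule.submodule_is_module[OF this W.module_axioms] show ?thesis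
    by (simp add: der_module_def)
qed

lemma der_module_simps:
  "carrier (der_module \<iota> R) = derivations \<iota> R"
  "\<zero>\<^bsub>der_module \<iota> R\<^esub> = (\<lambda>a\<in>carrier R. \<zero>\<^bsub>R\<^esub>)"
  "E \<oplus>\<^bsub>der_module \<iota> R\<^esub> F = (\<lambda>a\<in>carrier R. E a \<oplus>\<^bsub>R\<^esub> F a)"
  "a \<odot>\<^bsub>der_module \<iota> R\<^esub> E = (\<lambda>b\<in>carrier R. a \<otimes>\<^bsub>R\<^esub> E b)"
  by (simp_all add: der_module_def pow_module_def)

section \<open>Two-term complexes and maps in homology\<close>

lemma (in abelian_group) minus_eq_zeroD:
  assumes "x \<ominus> y = \<zero>" "x \<in> carrier G" "y \<in> carrier G" shows "x = y"
  using add.inv_solve_right[of \<zero> x y] assms by (simp add: a_minus_def)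

lemma graded_module_two_term:
  assumes M: "module R M" and gr: "\<And>d. submodule (gr d) R M"
    and gr_trivial: "\<And>d. d \<noteq> 0 \<Longrightarrow> d \<noteq> 1 \<Longrightarrow> gr d = {\<zero>\<^bsub>M\<^esub>}"
    and decomp: "\<And>x. x \<in> carrier M \<Longrightarrow> \<exists>x0\<in>gr 0. \<exists>x1\<in>gr 1. x = x0 \<oplus>\<^bsub>M\<^esub> x1"
    and disjoint: "gr 0 \<inter> gr 1 = {\<zero>\<^bsub>M\<^esub>}"
  shows "graded_module R M gr"
proof -
  interpret module R M by fact
  have gr_carrier: "x \<in> carrier M" if "x \<in> gr d" for x d
    using submoduleE(1)[OF gr, of d] that by blast
  have gr_zero: "\<zero>\<^bsub>M\<^esub> \<in> gr d" for d
    using gr[of d] subgroup.one_closed[of "gr d" "add_monoid M"] by (simp add: submodule_def)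
  have sum_eq: "(\<Oplus>\<^bsub>M\<^esub>d\<in>{d. c d \<noteq> \<zero>\<^bsub>M\<^esub>}. c d) = c 0 \<oplus>\<^bsub>M\<^esub> c 1" if "\<forall>d. c d \<in> gr d" for c
  proof -
    have "(\<Oplus>\<^bsub>M\<^esub>d\<in>{d. c d \<noteq> \<zero>\<^bsub>M\<^esub>}. c d) = (\<Oplus>\<^bsub>M\<^esub>d\<in>{0, 1}. c d)"
    proof (rule M.add.finprod_mono_neutral_cong_left)
      have "c d = \<zero>\<^bsub>M\<^esub>" if "d \<noteq> 0" "d \<noteq> 1" for d
        using \<open>\<forall>d. c d \<in> gr d\<close> gr_trivial[OF that] by blast
      then show "{d. c d \<noteq> \<zero>\<^bsub>M\<^esub>} \<subseteq> {0, 1}" by blast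
      show "c \<in> {0, 1} \<rightarrow> carrier M" using that gr_carrier by blast
    qed auto
    then show ?thesis using that gr_carrier[of "c 0" 0] gr_carrier[of "c 1" 1] by simp
  qed
  show ?thesis
  proof (intro graded_module.intro M graded_module_axioms.intro gr)
    fix x assume "x \<in> carrier M"
    then obtain x0 x1 where x: "x0 \<in> gr 0" "x1 \<in> gr 1" "x = x0 \<oplus>\<^bsub>M\<^esub> x1"
      using decomp by blast
    define c where "c d = (if d = 0 then x0 else if d = 1 then x1 else \<zero>\<^bsub>M\<^esub>)" for d :: int
    have c_gr: "\<forall>d. c d \<in> gr d" using x gr_zero by (simp add: c_def)
    show "\<exists>!c. (\<forall>d. c d \<in> gr d) \<and> finite {d. c d \<noteq> \<zero>\<^bsub>M\<^esub>} \<and> x = (\<Oplus>\<^bsub>M\<^esub>d\<in>{d. c d \<noteq> \<zero>\<^bsub>M\<^esub>}. c d)"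
    proof (rule ex1I[of _ c])
      have "{d. c d \<noteq> \<zero>\<^bsub>M\<^esub>} \<subseteq> {0, 1}" by (auto simp: c_def)
      then have "finite {d. c d \<noteq> \<zero>\<^bsub>M\<^esub>}" using finite_subset by blast
      then show "(\<forall>d. c d \<in> gr d) \<and> finite {d. c d \<noteq> \<zero>\<^bsub>M\<^esub>} \<and> x = (\<Oplus>\<^bsub>M\<^esub>d\<in>{d. c d \<noteq> \<zero>\<^bsub>M\<^esub>}. c d)"
        using c_gr sum_eq[OF c_gr] x(3) by (simp add: c_def)
    next
      fix c' assume c': "(\<forall>d. c' d \<in> gr d) \<and> finite {d. c' d \<noteq> \<zero>\<^bsub>M\<^esub>} \<and> x = (\<Oplus>\<^bsub>M\<^esub>d\<in>{d. c' d \<noteq> \<zero>\<^bsub>M\<^esub>}. c' d)"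
      then have eq: "x0 \<oplus>\<^bsub>M\<^esub> x1 = c' 0 \<oplus>\<^bsub>M\<^esub> c' 1" using sum_eq[of c'] x(3) by simp
      have mem: "x0 \<in> carrier M" "x1 \<in> carrier M" "c' 0 \<in> carrier M" "c' 1 \<in> carrier M"
        using x c' gr_carrier by blast+
      have "x0 \<ominus>\<^bsub>M\<^esub> c' 0 = (x0 \<oplus>\<^bsub>M\<^esub> x1) \<ominus>\<^bsub>M\<^esub> (c' 0 \<oplus>\<^bsub>M\<^esub> x1)"
        using mem by (simp add: a_minus_def M.minus_add M.a_ac M.r_neg2 M.r_neg1)
      also have "\<dots> = c' 1 \<ominus>\<^bsub>M\<^esub> x1"
        unfolding eq using mem by (simp add: a_minus_def M.minus_add M.a_ac M.r_neg2 M.r_neg1)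
          (simp add: M.a_comm[of "\<ominus>\<^bsub>M\<^esub> x1" "\<ominus>\<^bsub>M\<^esub> c' 0"] M.r_neg2)
      finally have e: "x0 \<ominus>\<^bsub>M\<^esub> c' 0 = c' 1 \<ominus>\<^bsub>M\<^esub> x1" .
      have "x0 \<ominus>\<^bsub>M\<^esub> c' 0 \<in> gr 0" "c' 1 \<ominus>\<^bsub>M\<^esub> x1 \<in> gr 1"
        using x c' submoduleE(3,5)[OF gr] by (simp_all add: a_minus_def)
      with e disjoint have "x0 \<ominus>\<^bsub>M\<^esub> c' 0 = \<zero>\<^bsub>M\<^esub>" "c' 1 \<ominus>\<^bsub>M\<^esub> x1 = \<zero>\<^bsub>M\<^esub>" by auto
      with mem have "c' 0 = x0" "c' 1 = x1" by (auto dest: M.minus_eq_zeroD)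
      moreover have "c' d = \<zero>\<^bsub>M\<^esub>" if "d \<noteq> 0" "d \<noteq> 1" for d
        using c' gr_trivial[OF that] by blast
      ultimately show "c' = c" by (auto simp: c_def fun_eq_iff)
    qed
  qed
qed

text \<open>
  The isomorphism theorem for the map on cosets in the form in which it is used to define maps in homology.
\<close>

lemma FactGroup_map_iso:
  assumes Z: "comm_group Z" and Z': "comm_group Z'" and B: "subgroup B Z" and B': "subgroup B' Z'"
    and h: "h \<in> hom Z Z'" and inj: "\<And>x. x \<in> carrier Z \<Longrightarrow> h x \<in> B' \<longleftrightarrow> x \<in> B"
    and surj: "\<And>y. y \<in> carrier Z' \<Longrightarrow> \<exists>x\<in>carrier Z. h x = y"
  shows "(\<lambda>C. \<Union>x\<in>C. B' #>\<^bsub>Z'\<^esub> h x) \<in> iso (Z Mod B) (Z' Mod B')"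
proof -
  interpret Z: comm_group Z by fact
  interpret Z': comm_group Z' by fact
  interpret B: normal B Z by (rule Z.subgroup_imp_normal[OF B])
  interpret B': normal B' Z' by (rule Z'.subgroup_imp_normal[OF B'])
  interpret h: group_hom Z Z' h by unfold_locales (rule h)
  have coset: "H #>\<^bsub>G\<^esub> x = H #>\<^bsub>G\<^esub> y \<longleftrightarrow> x \<otimes>\<^bsub>G\<^esub> inv\<^bsub>G\<^esub> y \<in> H"
    if "group G" "subgroup H G" "x \<in> carrier G" "y \<in> carrier G" for G :: "('x, 'y) monoid_scheme" and H x y
  proof -
    interpret G: group G by fact
    show ?thesis
      using that G.repr_independence[of x H y] G.rcos_self[of x H]
        subgroup.rcos_module[OF that(2,1,4,3)] by auto
  qed
  have val: "(\<Union>x'\<in>B #>\<^bsub>Z\<^esub> x. B' #>\<^bsub>Z'\<^esub> h x') = B' #>\<^bsub>Z'\<^esub> h x" if x: "x \<in> carrier Z" for x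
  proof -
    have "B' #>\<^bsub>Z'\<^esub> h x' = B' #>\<^bsub>Z'\<^esub> h x" if "x' \<in> B #>\<^bsub>Z\<^esub> x" for x'
    proof -
      have x': "x' \<in> carrier Z" using that x B.subset by (auto simp: r_coset_def)
      then have "x' \<otimes>\<^bsub>Z\<^esub> inv\<^bsub>Z\<^esub> x \<in> B" using that B.rcos_module[OF Z.is_group x x'] by simp
      then have "h (x' \<otimes>\<^bsub>Z\<^esub> inv\<^bsub>Z\<^esub> x) \<in> B'"
        using x x' by (intro inj[THEN iffD2]) simp_all
      moreover have "h (x' \<otimes>\<^bsub>Z\<^esub> inv\<^bsub>Z\<^esub> x) = h x' \<otimes>\<^bsub>Z'\<^esub> inv\<^bsub>Z'\<^esub> h x" using x x' by simp
      ultimately show ?thesis using x x' coset[OF Z'.is_group B', of "h x'" "h x"] by simp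
    qed
    moreover have "x \<in> B #>\<^bsub>Z\<^esub> x" using Z.rcos_self[OF x B] .
    ultimately show ?thesis by blast
  qed
  show ?thesis
    unfolding iso_def bij_betw_def
  proof (intro CollectI conjI)
    show "(\<lambda>C. \<Union>x\<in>C. B' #>\<^bsub>Z'\<^esub> h x) \<in> hom (Z Mod B) (Z' Mod B')"
      unfolding hom_def
      by (auto simp: carrier_FactGroup val B.rcos_sum B'.rcos_sum)
    show "inj_on (\<lambda>C. \<Union>x\<in>C. B' #>\<^bsub>Z'\<^esub> h x) (carrier (Z Mod B))"
    proof (rule inj_onI)
      fix C C' assume "C \<in> carrier (Z Mod B)" "C' \<in> carrier (Z Mod B)"
      then obtain x y where xy: "x \<in> carrier Z" "C = B #>\<^bsub>Z\<^esub> x" "y \<in> carrier Z" "C' = B #>\<^bsub>Z\<^esub> y"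
        by (auto simp: carrier_FactGroup)
      assume "(\<Union>x\<in>C. B' #>\<^bsub>Z'\<^esub> h x) = (\<Union>x\<in>C'. B' #>\<^bsub>Z'\<^esub> h x)"
      then have "h (x \<otimes>\<^bsub>Z\<^esub> inv\<^bsub>Z\<^esub> y) \<in> B'"
        using xy val coset[OF Z'.is_group B', of "h x" "h y"] by simp
      then have "x \<otimes>\<^bsub>Z\<^esub> inv\<^bsub>Z\<^esub> y \<in> B" by (intro inj[THEN iffD1]) (use xy in auto)
      then show "C = C'" using xy coset[OF Z.is_group B] by simp
    qed
    show "(\<lambda>C. \<Union>x\<in>C. B' #>\<^bsub>Z'\<^esub> h x) ` carrier (Z Mod B) = carrier (Z' Mod B')"
    proof
      show "(\<lambda>C. \<Union>x\<in>C. B' #>\<^bsub>Z'\<^esub> h x) ` carrier (Z Mod B) \<subseteq> carrier (Z' Mod B')"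
        by (auto simp: carrier_FactGroup val)
      show "carrier (Z' Mod B') \<subseteq> (\<lambda>C. \<Union>x\<in>C. B' #>\<^bsub>Z'\<^esub> h x) ` carrier (Z Mod B)"
      proof
        fix C assume "C \<in> carrier (Z' Mod B')"
        then obtain y where y: "y \<in> carrier Z'" "C = B' #>\<^bsub>Z'\<^esub> y" by (auto simp: carrier_FactGroup)
        then obtain x where "x \<in> carrier Z" "h x = y" using surj by blast
        then show "C \<in> (\<lambda>C. \<Union>x\<in>C. B' #>\<^bsub>Z'\<^esub> h x) ` carrier (Z Mod B)"
          using y val[of x] by (intro image_eqI[of _ _ "B #>\<^bsub>Z\<^esub> x"]) (simp_all add: carrier_FactGroup)
      qed
    qed
  qed
qed

lemma (in chain_complex) cycles_boundaries:
  shows "comm_group (cycles M gr \<delta> d)" "subgroup (boundaries gr \<delta> d) (cycles M gr \<delta> d)"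
proof -
  have gr_carrier: "gr e \<subseteq> carrier M" for e using submoduleE(1)[OF gr_submodule] .
  have zero: "\<zero>\<^bsub>M\<^esub> \<in> gr e" for e
    using gr_submodule[of e] subgroup.one_closed[of "gr e" "add_monoid M"] by (simp add: submodule_def)
  have d0: "\<delta> \<zero>\<^bsub>M\<^esub> = \<zero>\<^bsub>M\<^esub>" by (rule lin_map_zero[OF module_axioms module_axioms diff_linear])
  have dm: "\<delta> (\<ominus>\<^bsub>M\<^esub> x) = \<ominus>\<^bsub>M\<^esub> \<delta> x" if "x \<in> carrier M" for x
    using lin_map_minus[OF module_axioms module_axioms diff_linear, of "\<zero>\<^bsub>M\<^esub>" x] that d0
      lin_mapsD(1)[OF diff_linear] by (simp add: a_minus_def)
  note da = lin_mapsD(2)[OF diff_linear]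
  have C_carrier: "carrier (cycles M gr \<delta> d) \<subseteq> carrier M"
    using gr_carrier by (auto simp: cycles_def)
  show cg: "comm_group (cycles M gr \<delta> d)"
  proof (rule comm_groupI)
    show "\<exists>y\<in>carrier (cycles M gr \<delta> d). y \<otimes>\<^bsub>cycles M gr \<delta> d\<^esub> x = \<one>\<^bsub>cycles M gr \<delta> d\<^esub>"
      if "x \<in> carrier (cycles M gr \<delta> d)" for x
      using that gr_carrier submoduleE(3)[OF gr_submodule]
      by (intro bexI[of _ "\<ominus>\<^bsub>M\<^esub> x"]) (auto simp: cycles_def dm M.l_neg subset_iff)
  qed (use gr_carrier zero submoduleE(5)[OF gr_submodule] in
      \<open>auto simp: cycles_def d0 da subset_iff M.a_assoc intro: M.a_comm\<close>)
  interpret C: comm_group "cycles M gr \<delta> d" by (rule cg)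
  have inv_eq: "inv\<^bsub>cycles M gr \<delta> d\<^esub> x = \<ominus>\<^bsub>M\<^esub> x" if "x \<in> carrier (cycles M gr \<delta> d)" for x
    using that gr_carrier submoduleE(3)[OF gr_submodule]
    by (intro C.inv_equality) (auto simp: cycles_def dm M.l_neg subset_iff)
  have B: "boundaries gr \<delta> d \<subseteq> carrier (cycles M gr \<delta> d)"
    using diff_degree[of _ "d + 1"] diff_diff gr_carrier by (auto simp: boundaries_def cycles_def)
  show "subgroup (boundaries gr \<delta> d) (cycles M gr \<delta> d)"
  proof (rule C.subgroupI[OF B])
    show "boundaries gr \<delta> d \<noteq> {}" using zero by (auto simp: boundaries_def)
    show "inv\<^bsub>cycles M gr \<delta> d\<^esub> x \<in> boundaries gr \<delta> d" if x: "x \<in> boundaries gr \<delta> d" for x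
    proof -
      from x obtain y where "y \<in> gr (d + 1)" "x = \<delta> y" by (auto simp: boundaries_def)
      then have "\<ominus>\<^bsub>M\<^esub> x = \<delta> (\<ominus>\<^bsub>M\<^esub> y)" "\<ominus>\<^bsub>M\<^esub> y \<in> gr (d + 1)"
        using dm gr_carrier submoduleE(3)[OF gr_submodule] by (auto simp: subset_iff)
      moreover have "inv\<^bsub>cycles M gr \<delta> d\<^esub> x = \<ominus>\<^bsub>M\<^esub> x" using B x by (intro inv_eq) auto
      ultimately show ?thesis by (auto simp: boundaries_def)
    qed
    show "x \<otimes>\<^bsub>cycles M gr \<delta> d\<^esub> y \<in> boundaries gr \<delta> d"
      if "x \<in> boundaries gr \<delta> d" "y \<in> boundaries gr \<delta> d" for x y
    proof -
      from that obtain x' y' where "x' \<in> gr (d + 1)" "x = \<delta> x'" "y' \<in> gr (d + 1)" "y = \<delta> y'"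
        by (auto simp: boundaries_def)
      then have "x \<oplus>\<^bsub>M\<^esub> y = \<delta> (x' \<oplus>\<^bsub>M\<^esub> y')" "x' \<oplus>\<^bsub>M\<^esub> y' \<in> gr (d + 1)"
        using da gr_carrier submoduleE(5)[OF gr_submodule] by (auto simp: subset_iff)
      then show ?thesis by (auto simp: boundaries_def cycles_def)
    qed
  qed
qed

lemma homology_isoI:
  assumes h: "chain_map R M gr \<delta> N gr' \<delta>' h"
    and inj: "\<And>x. x \<in> gr d \<Longrightarrow> \<delta> x = \<zero>\<^bsub>M\<^esub> \<Longrightarrow> h x \<in> boundaries gr' \<delta>' d \<longleftrightarrow> x \<in> boundaries gr \<delta> d"
    and surj: "\<And>y. y \<in> gr' d \<Longrightarrow> \<delta>' y = \<zero>\<^bsub>N\<^esub> \<Longrightarrow> \<exists>x\<in>gr d. \<delta> x = \<zero>\<^bsub>M\<^esub> \<and> h x = y"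
  shows "homology_iso M gr \<delta> N gr' \<delta>' h d"
proof -
  interpret M: chain_complex R M gr \<delta> using h by (simp add: chain_map_def)
  interpret N: chain_complex R N gr' \<delta>' using h by (simp add: chain_map_def)
  have hl: "h \<in> lin_maps R M N" using h by (simp add: chain_map_def)
  have hM: "\<forall>d. \<forall>x\<in>gr d. h x \<in> gr' d" "\<forall>x\<in>carrier M. h (\<delta> x) = \<delta>' (h x)"
    using h by (simp_all add: chain_map_def)
  have gr_carrier: "x \<in> carrier M" if "x \<in> gr d" for x d
    using M.submoduleE(1)[OF M.gr_submodule] that by blast
  have h0: "h \<zero>\<^bsub>M\<^esub> = \<zero>\<^bsub>N\<^esub>" by (rule lin_map_zero[OF M.module_axioms N.module_axioms hl])
  have "\<delta>' (h x) = \<zero>\<^bsub>N\<^esub>" if "x \<in> gr d" "\<delta> x = \<zero>\<^bsub>M\<^esub>" for x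
    using hM(2)[rule_format, of x] gr_carrier that h0 by simp
  then have "h \<in> hom (cycles M gr \<delta> d) (cycles N gr' \<delta>' d)"
    using hM(1) lin_mapsD(2)[OF hl] gr_carrier by (auto simp: hom_def cycles_def)
  note hom = this
  have eq: "homology_map N gr' \<delta>' d h = (\<lambda>C. \<Union>x\<in>C. boundaries gr' \<delta>' d #>\<^bsub>cycles N gr' \<delta>' d\<^esub> h x)"
    by (simp add: homology_map_def fun_eq_iff)
  show ?thesis
    unfolding homology_iso_def homology_def eq
  proof (rule FactGroup_map_iso[OF M.cycles_boundaries(1) N.cycles_boundaries(1)
      M.cycles_boundaries(2) N.cycles_boundaries(2) hom])
    show "h x \<in> boundaries gr' \<delta>' d \<longleftrightarrow> x \<in> boundaries gr \<delta> d" if "x \<in> carrier (cycles M gr \<delta> d)" for x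
      using that inj by (simp add: cycles_def)
    show "\<exists>x\<in>carrier (cycles M gr \<delta> d). h x = y" if "y \<in> carrier (cycles N gr' \<delta>' d)" for y
      using that surj[of y] by (auto simp: cycles_def)
  qed
qed

section \<open>Kaehler differentials\<close>

locale commutative_algebra = cring R for R (structure) +
  fixes \<iota> :: "'k \<Rightarrow> 'a"
  assumes structure_map_closed: "\<iota> c \<in> carrier R"
begin

abbreviation F where "F \<equiv> free_module R (carrier R)"
abbreviation s where "s \<equiv> unit_vec R (carrier R)"
abbreviation \<Omega> where "\<Omega> \<equiv> kaehler \<iota> R"
abbreviation d where "d \<equiv> kaehler_d \<iota> R"
abbreviation KS where "KS \<equiv> kaehler_submodule \<iota> R"

lemma module_F: "module R F"
  by (rule free_module_is_module) (rule is_cring)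

sublocale F: module R F by (rule module_F)

lemma s_closed [simp, intro]: "s a \<in> carrier F"
  by (rule unit_vec_closed) (rule is_cring)

lemma relations_closed: "kaehler_relations \<iota> R \<subseteq> carrier F"
  using structure_map_closed by (auto simp: kaehler_relations_def Let_def)

lemmas KS_span = F.span_submodule[OF relations_closed, folded kaehler_submodule_def]

sublocale Q: quotient_module R F KS
  by (intro quotient_module.intro module_F quotient_module_axioms.intro KS_span(1))

lemma module_kaehler: "module R \<Omega>"
  using Q.quot_module_is_module by (simp add: kaehler_def)

sublocale \<Omega>: module R \<Omega> by (rule module_kaehler)

lemma d_closed [simp, intro]: "d a \<in> carrier \<Omega>"
  by (auto simp: kaehler_d_def kaehler_def Q.quot_simps)

lemma KS_relations:
  assumes "a \<in> carrier R" "b \<in> carrier R"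
  shows "s (a \<oplus> b) \<ominus>\<^bsub>F\<^esub> (s a \<oplus>\<^bsub>F\<^esub> s b) \<in> KS"
    "s (\<iota> c \<otimes> a) \<ominus>\<^bsub>F\<^esub> \<iota> c \<odot>\<^bsub>F\<^esub> s a \<in> KS"
    "s (a \<otimes> b) \<ominus>\<^bsub>F\<^esub> (b \<odot>\<^bsub>F\<^esub> s a \<oplus>\<^bsub>F\<^esub> a \<odot>\<^bsub>F\<^esub> s b) \<in> KS"
  by (rule subsetD[OF KS_span(2)], unfold kaehler_relations_def Let_def, use assms in blast)+

lemma d_add: "a \<in> carrier R \<Longrightarrow> b \<in> carrier R \<Longrightarrow> d (a \<oplus> b) = d a \<oplus>\<^bsub>\<Omega>\<^esub> d b"
  unfolding kaehler_d_def kaehler_def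
  by (simp add: Q.quot_add Q.coset_eq_iff KS_relations)

lemma d_smult: "a \<in> carrier R \<Longrightarrow> d (\<iota> c \<otimes> a) = \<iota> c \<odot>\<^bsub>\<Omega>\<^esub> d a"
  unfolding kaehler_d_def kaehler_def
  by (simp add: Q.quot_smult Q.coset_eq_iff KS_relations structure_map_closed)

lemma d_mult: "a \<in> carrier R \<Longrightarrow> b \<in> carrier R \<Longrightarrow>
    d (a \<otimes> b) = b \<odot>\<^bsub>\<Omega>\<^esub> d a \<oplus>\<^bsub>\<Omega>\<^esub> a \<odot>\<^bsub>\<Omega>\<^esub> d b"
  unfolding kaehler_d_def kaehler_def
  by (simp add: Q.quot_add Q.quot_smult Q.coset_eq_iff KS_relations)

lemma d_one: "d \<one> = \<zero>\<^bsub>\<Omega>\<^esub>"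
proof -
  have "d \<one> = d \<one> \<oplus>\<^bsub>\<Omega>\<^esub> d \<one>" using d_mult[of \<one> \<one>] by simp
  then show ?thesis using \<Omega>.M.add.l_cancel_one'[of "d \<one>" "d \<one>"] by simp
qed

lemma kaehler_induct [consumes 1, case_names generator add]:
  assumes x: "x \<in> carrier \<Omega>"
    and gen: "\<And>a b. a \<in> carrier R \<Longrightarrow> b \<in> carrier R \<Longrightarrow> Q (a \<odot>\<^bsub>\<Omega>\<^esub> d b)"
    and Q_add: "\<And>x y. x \<in> carrier \<Omega> \<Longrightarrow> y \<in> carrier \<Omega> \<Longrightarrow> Q x \<Longrightarrow> Q y \<Longrightarrow> Q (x \<oplus>\<^bsub>\<Omega>\<^esub> y)"
  shows "Q x"
proof -
  obtain w where w: "w \<in> carrier F" "x = KS +>\<^bsub>F\<^esub> w"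
    using x by (auto simp: kaehler_def Q.quot_simps)
  have closed: "KS +>\<^bsub>F\<^esub> u \<in> carrier \<Omega>" if "u \<in> carrier F" for u
    using that by (auto simp: kaehler_def Q.quot_simps)
  have gen': "Q (KS +>\<^bsub>F\<^esub> (a \<odot>\<^bsub>F\<^esub> s b))" if "a \<in> carrier R" "b \<in> carrier R" for a b
    using gen[OF that] that by (simp add: kaehler_def kaehler_d_def Q.quot_smult)
  have "Q (KS +>\<^bsub>F\<^esub> w)"
    using w(1)
  proof (rule free_module_induct[OF is_cring, where Q = "\<lambda>w. Q (KS +>\<^bsub>F\<^esub> w)"])
    have "\<zero>\<^bsub>F\<^esub> = \<zero> \<odot>\<^bsub>F\<^esub> s \<zero>" by simp
    then show "Q (KS +>\<^bsub>F\<^esub> \<zero>\<^bsub>F\<^esub>)" using gen'[of \<zero> \<zero>] by simp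
    show "Q (KS +>\<^bsub>F\<^esub> (u \<oplus>\<^bsub>F\<^esub> v))"
      if "u \<in> carrier F" "v \<in> carrier F" "Q (KS +>\<^bsub>F\<^esub> u)" "Q (KS +>\<^bsub>F\<^esub> v)" for u v
      using Q_add[OF closed closed that(3,4)] that(1,2) by (simp add: kaehler_def Q.quot_add)
  qed (rule gen')
  then show ?thesis by (simp add: w)
qed

text \<open>
  Every derivation factors through \<open>\<Omega>\<close>: its linear extension to the free module kills the relations.
\<close>

lemma kaehler_universal:
  assumes N: "module R N" and g: "\<And>a. a \<in> carrier R \<Longrightarrow> g a \<in> carrier N"
    and g_add: "\<And>a b. a \<in> carrier R \<Longrightarrow> b \<in> carrier R \<Longrightarrow> g (a \<oplus> b) = g a \<oplus>\<^bsub>N\<^esub> g b"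
    and g_smult: "\<And>c a. a \<in> carrier R \<Longrightarrow> g (\<iota> c \<otimes> a) = \<iota> c \<odot>\<^bsub>N\<^esub> g a"
    and g_mult: "\<And>a b. a \<in> carrier R \<Longrightarrow> b \<in> carrier R \<Longrightarrow>
      g (a \<otimes> b) = b \<odot>\<^bsub>N\<^esub> g a \<oplus>\<^bsub>N\<^esub> a \<odot>\<^bsub>N\<^esub> g b"
  shows "\<exists>h\<in>lin_maps R \<Omega> N. \<forall>a\<in>carrier R. h (d a) = g a"
proof -
  interpret N: module R N by fact
  have "\<exists>E\<in>lin_maps R F N. \<forall>a\<in>carrier R. E (s a) = g a"
    by (rule free_module_lift[OF is_cring N]) (rule g)
  then obtain E where E: "E \<in> lin_maps R F N" "\<And>a. a \<in> carrier R \<Longrightarrow> E (s a) = g a"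
    by auto
  note E_lin = lin_mapsD[OF E(1)] lin_map_minus[OF module_F N E(1)]
  have "submodule {\<zero>\<^bsub>N\<^esub>} R N"
    by (rule N.submoduleI) (auto intro: N.M.minus_equality)
  from submodule_lin_vimage[OF module_F N E(1) this]
  have ker: "submodule {w \<in> carrier F. E w = \<zero>\<^bsub>N\<^esub>} R F" by simp
  have minus_self: "x \<ominus>\<^bsub>N\<^esub> x = \<zero>\<^bsub>N\<^esub>" if "x \<in> carrier N" for x
    using that by (simp add: a_minus_def N.M.r_neg)
  have E_add: "E (s (a \<oplus> b) \<ominus>\<^bsub>F\<^esub> (s a \<oplus>\<^bsub>F\<^esub> s b)) = \<zero>\<^bsub>N\<^esub>"
    and E_mult: "E (s (a \<otimes> b) \<ominus>\<^bsub>F\<^esub> (b \<odot>\<^bsub>F\<^esub> s a \<oplus>\<^bsub>F\<^esub> a \<odot>\<^bsub>F\<^esub> s b)) = \<zero>\<^bsub>N\<^esub>"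
    if "a \<in> carrier R" "b \<in> carrier R" for a b
    using that g by (simp_all add: E_lin E(2) g_add g_mult minus_self)
  have E_smult: "E (s (\<iota> c \<otimes> a) \<ominus>\<^bsub>F\<^esub> \<iota> c \<odot>\<^bsub>F\<^esub> s a) = \<zero>\<^bsub>N\<^esub>"
    if "a \<in> carrier R" for a c
    using that g by (simp add: E_lin E(2) g_smult minus_self structure_map_closed)
  have "kaehler_relations \<iota> R \<subseteq> {w \<in> carrier F. E w = \<zero>\<^bsub>N\<^esub>}"
  proof
    fix w assume w: "w \<in> kaehler_relations \<iota> R"
    then have "E w = \<zero>\<^bsub>N\<^esub>"
      unfolding kaehler_relations_def Let_def
      by (elim UnE CollectE exE conjE) (simp_all only: E_add E_smult E_mult)
    with w relations_closed show "w \<in> {w \<in> carrier F. E w = \<zero>\<^bsub>N\<^esub>}" by blast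
  qed
  from KS_span(3)[OF ker this] have KS: "E w = \<zero>\<^bsub>N\<^esub>" if "w \<in> KS" for w using that by blast
  define h where "h C = E (SOME w. w \<in> carrier F \<and> KS +>\<^bsub>F\<^esub> w = C)" for C
  have h: "h (KS +>\<^bsub>F\<^esub> w) = E w" if w: "w \<in> carrier F" for w
  proof -
    define u where "u = (SOME u. u \<in> carrier F \<and> KS +>\<^bsub>F\<^esub> u = KS +>\<^bsub>F\<^esub> w)"
    have u: "u \<in> carrier F \<and> KS +>\<^bsub>F\<^esub> u = KS +>\<^bsub>F\<^esub> w"
      unfolding u_def by (rule someI[of _ w]) (simp add: w)
    then have "E (u \<ominus>\<^bsub>F\<^esub> w) = \<zero>\<^bsub>N\<^esub>" using w by (intro KS) (simp add: Q.coset_eq_iff[symmetric])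
    then have "E u \<ominus>\<^bsub>N\<^esub> E w = \<zero>\<^bsub>N\<^esub>" using u w by (simp add: E_lin)
    then show ?thesis using N.M.minus_eq_zeroD E_lin(1) u w by (simp add: h_def u_def[symmetric])
  qed
  have "h \<in> lin_maps R \<Omega> N"
    unfolding lin_maps_def
    by (auto simp: kaehler_def Q.quot_simps Q.quot_add Q.quot_smult h E_lin)
  moreover have "h (d a) = g a" if "a \<in> carrier R" for a
    using that by (simp add: kaehler_d_def h E)
  ultimately show ?thesis by blast
qed

end


text \<open>
  A biadditive bracket is determined by its values on the elements \<open>a db\<close>, which generate \<open>\<Omega>\<close>.
\<close>

lemma (in commutative_algebra) koszul_bracket_unique:
  assumes K: "is_koszul_bracket \<iota> R pb K" and K': "is_koszul_bracket \<iota> R pb K'"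
    and xy: "x \<in> carrier \<Omega>" "y \<in> carrier \<Omega>"
  shows "K x y = K' x y"
proof -
  have K_add: "K (x \<oplus>\<^bsub>\<Omega>\<^esub> y) z = K x z \<oplus>\<^bsub>\<Omega>\<^esub> K y z" "K x (y \<oplus>\<^bsub>\<Omega>\<^esub> z) = K x y \<oplus>\<^bsub>\<Omega>\<^esub> K x z"
    if "is_koszul_bracket \<iota> R pb K" "x \<in> carrier \<Omega>" "y \<in> carrier \<Omega>" "z \<in> carrier \<Omega>" for K x y z
    using that unfolding is_koszul_bracket_def Let_def by blast+
  have gen: "K (a1 \<odot>\<^bsub>\<Omega>\<^esub> d a2) (b1 \<odot>\<^bsub>\<Omega>\<^esub> d b2) = K' (a1 \<odot>\<^bsub>\<Omega>\<^esub> d a2) (b1 \<odot>\<^bsub>\<Omega>\<^esub> d b2)"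
    if "a1 \<in> carrier R" "a2 \<in> carrier R" "b1 \<in> carrier R" "b2 \<in> carrier R" for a1 a2 b1 b2
    using K K' that unfolding is_koszul_bracket_def Let_def by simp
  have right: "K (a \<odot>\<^bsub>\<Omega>\<^esub> d b) y = K' (a \<odot>\<^bsub>\<Omega>\<^esub> d b) y" if "a \<in> carrier R" "b \<in> carrier R" for a b
    using xy(2)
  proof (induction rule: kaehler_induct)
    case (generator a' b')
    then show ?case by (rule gen[OF that])
  next
    case (add y z)
    have "a \<odot>\<^bsub>\<Omega>\<^esub> d b \<in> carrier \<Omega>" using that by simp
    then show ?case using add by (simp add: K_add[OF K] K_add[OF K'])
  qed
  show ?thesis
    using xy(1)
  proof (induction rule: kaehler_induct)
    case (generator a b)
    then show ?case by (rule right)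
  next
    case (add x z)
    then show ?case using xy(2) by (simp add: K_add[OF K] K_add[OF K'])
  qed
qed

section \<open>The cotangent complex of a quotient of a polynomial algebra\<close>

context relations
begin

abbreviation A where "A \<equiv> quot_alg k f"
abbreviation cls where "cls \<equiv> quot_cls k f"
abbreviation L where "L \<equiv> cot_module k f"
abbreviation const where "const \<equiv> quot_const k f"

lemma ideal_I: "ideal I mpoly_ring"
  by (simp add: ideal_mpoly_ring_iff I.ring_ideal_axioms)

interpretation S: cring "mpoly_ring :: ('n, 'k) mpoly ring" by (rule mpoly_ring_cring)
interpretation J: ideal I "mpoly_ring :: ('n, 'k) mpoly ring" by (rule ideal_I)

lemma cls_eq: "cls s = {a + s |a. a \<in> I}"
  by (auto simp: quot_cls_def a_r_coset_def' mpoly_ring_simps)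

lemma cls_eq_iff: "cls s = cls t \<longleftrightarrow> s - t \<in> I"
proof
  assume "cls s = cls t"
  moreover have "s \<in> cls s" unfolding cls_eq using I.zero by force
  ultimately show "s - t \<in> I" unfolding cls_eq by auto
next
  assume st: "s - t \<in> I"
  have "a + s = (a + (s - t)) + t" "a + t = (a - (s - t)) + s" for a by simp_all
  then show "cls s = cls t"
    unfolding cls_eq using I.add[OF _ st] I.diff[OF _ st] by blast
qed

lemma cring_A: "cring A"
  unfolding quot_alg_def by (rule J.quotient_is_cring) (rule mpoly_ring_cring)

sublocale A: cring A by (rule cring_A)

lemma A_simps:
  "carrier A = range cls"
  "\<zero>\<^bsub>A\<^esub> = cls 0" "\<one>\<^bsub>A\<^esub> = cls 1"
  "cls s \<oplus>\<^bsub>A\<^esub> cls t = cls (s + t)"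
  "cls s \<otimes>\<^bsub>A\<^esub> cls t = cls (s * t)"
proof -
  show "carrier A = range cls"
    by (auto simp: quot_alg_def FactRing_def A_RCOSETS_def' quot_cls_def mpoly_ring_simps)
  show "\<zero>\<^bsub>A\<^esub> = cls 0" by (auto simp: quot_alg_def FactRing_def cls_eq)
  show "\<one>\<^bsub>A\<^esub> = cls 1" by (simp add: quot_alg_def FactRing_def quot_cls_def mpoly_ring_simps)
  show "cls s \<oplus>\<^bsub>A\<^esub> cls t = cls (s + t)"
    using J.a_rcos_sum[of s t] by (simp add: quot_alg_def FactRing_def quot_cls_def mpoly_ring_simps)
  show "cls s \<otimes>\<^bsub>A\<^esub> cls t = cls (s * t)"
    using J.rcoset_mult_add[of s t] by (simp add: quot_alg_def FactRing_def quot_cls_def mpoly_ring_simps)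
qed

lemma cls_closed [simp, intro]: "cls s \<in> carrier A"
  by (simp add: A_simps)

lemma cls_minus: "\<ominus>\<^bsub>A\<^esub> cls s = cls (- s)"
  by (rule A.minus_equality) (simp_all add: A_simps)

lemma cls_diff: "cls s \<ominus>\<^bsub>A\<^esub> cls t = cls (s - t)"
  by (simp add: a_minus_def cls_minus A_simps)

definition rep where "rep a = (SOME s. cls s = a)"

lemma cls_rep: "a \<in> carrier A \<Longrightarrow> cls (rep a) = a"
  unfolding rep_def by (rule someI_ex) (auto simp: A_simps)

lemma rep_cls: "rep (cls s) - s \<in> I"
  using cls_rep[of "cls s"] by (simp add: cls_eq_iff)

text \<open>
  Elements of \<open>L\<close> are written through polynomial lifts of their coordinates. The tuple \<open>V\<close> is
  indexed by all natural numbers, and its entries from \<open>k\<close> on are disregarded.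
\<close>

definition emb :: "('n \<Rightarrow> ('n, 'k) mpoly) \<Rightarrow> (nat \<Rightarrow> ('n, 'k) mpoly) \<Rightarrow> ('n, 'k) cot" where
  "emb U V = ((\<lambda>l. cls (U l)), (\<lambda>\<mu>\<in>{..<k}. cls (V \<mu>)))"

lemma emb_eq_iff:
  "emb U V = emb U' V' \<longleftrightarrow> (\<forall>l. U l - U' l \<in> I) \<and> (\<forall>\<mu><k. V \<mu> - V' \<mu> \<in> I)"
  by (auto simp: emb_def fun_eq_iff cls_eq_iff restrict_def)

lemma emb_restrict: "emb U (\<lambda>\<mu>. if \<mu> < k then V \<mu> else 0) = emb U V"
  by (simp add: emb_eq_iff I.zero)

lemma module_L: "module A L"
  unfolding cot_module_def by (intro sum_module_is_module free_module_is_module cring_A)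

sublocale L: module A L by (rule module_L)

lemma L_carrier: "carrier L = {emb U V |U V. True}"
proof
  show "carrier L \<subseteq> {emb U V |U V. True}"
  proof
    fix x assume "x \<in> carrier L"
    then obtain u v where x: "x = (u, v)" "\<forall>l. u l \<in> carrier A" "\<forall>\<mu><k. v \<mu> \<in> carrier A" "v \<in> extensional {..<k}"
      by (auto simp: cot_module_def sum_module_simps free_module_simps)
    then have "x = emb (\<lambda>l. rep (u l)) (\<lambda>\<mu>. rep (v \<mu>))"
      by (auto simp: emb_def cls_rep extensional_def fun_eq_iff)
    then show "x \<in> {emb U V |U V. True}" by blast
  qed
  show "{emb U V |U V. True} \<subseteq> carrier L"
    by (auto simp: cot_module_def sum_module_simps free_module_simps emb_def)
qed

lemma emb_closed [simp, intro]: "emb U V \<in> carrier L"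
  by (auto simp: L_carrier)

lemma L_cases: assumes "x \<in> carrier L" obtains U V where "x = emb U V"
  using assms by (auto simp: L_carrier)

lemma L_simps:
  "\<zero>\<^bsub>L\<^esub> = emb (\<lambda>l. 0) (\<lambda>\<mu>. 0)"
  "emb U V \<oplus>\<^bsub>L\<^esub> emb U' V' = emb (\<lambda>l. U l + U' l) (\<lambda>\<mu>. V \<mu> + V' \<mu>)"
  "cls a \<odot>\<^bsub>L\<^esub> emb U V = emb (\<lambda>l. a * U l) (\<lambda>\<mu>. a * V \<mu>)"
  by (auto simp: cot_module_def sum_module_simps free_module_simps emb_def A_simps fun_eq_iff)

lemma emb_minus: "\<ominus>\<^bsub>L\<^esub> emb U V = emb (\<lambda>l. - U l) (\<lambda>\<mu>. - V \<mu>)"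
  by (rule L.minus_equality) (simp_all add: L_simps)

lemma cot_e_eq: "cot_e k f i = emb (\<lambda>l. if l = i then 1 else 0) (\<lambda>\<mu>. 0)"
  by (auto simp: cot_e_def emb_def unit_vec_def free_module_simps A_simps fun_eq_iff)

lemma cot_eps_eq: "cot_eps k f \<nu> = emb (\<lambda>l. 0) (\<lambda>\<mu>. if \<mu> = \<nu> then 1 else 0)"
  by (auto simp: cot_eps_def emb_def unit_vec_def free_module_simps A_simps fun_eq_iff)

lemma cot_gr_eq:
  "cot_gr k f d = (if d = 0 then {emb U (\<lambda>\<mu>. 0) |U. True}
     else if d = 1 then {emb (\<lambda>l. 0) V |V. True} else {\<zero>\<^bsub>L\<^esub>})"
proof -
  let ?A1 = "free_module A {..<k}" and ?A0 = "free_module A (UNIV :: 'n set)"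
  have z0: "\<zero>\<^bsub>?A0\<^esub> = (\<lambda>l. cls 0)" and z1: "\<zero>\<^bsub>?A1\<^esub> = (\<lambda>\<mu>\<in>{..<k}. cls 0)"
    by (simp_all add: free_module_simps A_simps fun_eq_iff)
  have "carrier ?A0 \<times> {\<zero>\<^bsub>?A1\<^esub>} = {emb U (\<lambda>\<mu>. 0) |U. True}"
  proof (intro equalityI subsetI)
    fix x assume "x \<in> carrier ?A0 \<times> {\<zero>\<^bsub>?A1\<^esub>}"
    then have "x \<in> carrier L" "snd x = (\<lambda>\<mu>\<in>{..<k}. cls 0)"
      using z1 by (auto simp: cot_module_def sum_module_simps) (auto simp: free_module_simps)
    then show "x \<in> {emb U (\<lambda>\<mu>. 0) |U. True}" by (auto simp: L_carrier emb_def)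
  next
    fix x assume "x \<in> {emb U (\<lambda>\<mu>. 0) |U. True}"
    then show "x \<in> carrier ?A0 \<times> {\<zero>\<^bsub>?A1\<^esub>}" by (auto simp: emb_def z1) (auto simp: free_module_simps)
  qed
  moreover have "{\<zero>\<^bsub>?A0\<^esub>} \<times> carrier ?A1 = {emb (\<lambda>l. 0) V |V. True}"
  proof (intro equalityI subsetI)
    fix x assume "x \<in> {\<zero>\<^bsub>?A0\<^esub>} \<times> carrier ?A1"
    then have "x \<in> carrier L" "fst x = (\<lambda>l. cls 0)"
      using z0 by (auto simp: cot_module_def sum_module_simps) (auto simp: free_module_simps)
    then show "x \<in> {emb (\<lambda>l. 0) V |V. True}" by (auto simp: L_carrier emb_def)
  next
    fix x assume "x \<in> {emb (\<lambda>l. 0) V |V. True}"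
    then show "x \<in> {\<zero>\<^bsub>?A0\<^esub>} \<times> carrier ?A1" by (auto simp: emb_def z0) (auto simp: free_module_simps)
  qed
  moreover have "(\<zero>\<^bsub>?A0\<^esub>, \<zero>\<^bsub>?A1\<^esub>) = \<zero>\<^bsub>L\<^esub>" by (simp add: cot_module_def sum_module_simps)
  ultimately show ?thesis by (simp add: cot_gr_def Let_def)
qed

lemma cot_gr_cases:
  assumes "x \<in> cot_gr k f d"
  obtains (zero) U where "d = 0" "x = emb U (\<lambda>\<mu>. 0)"
    | (one) V where "d = 1" "x = emb (\<lambda>l. 0) V"
    | (other) "d \<noteq> 0" "d \<noteq> 1" "x = emb (\<lambda>l. 0) (\<lambda>\<mu>. 0)"
  using assms by (auto simp: cot_gr_eq L_simps(1) split: if_splits)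

lemma emb_in_cot_gr:
  "emb U (\<lambda>\<mu>. 0) \<in> cot_gr k f 0" "emb (\<lambda>l. 0) V \<in> cot_gr k f 1" "emb (\<lambda>l. 0) (\<lambda>\<mu>. 0) \<in> cot_gr k f d"
  by (auto simp: cot_gr_eq L_simps(1))

lemma submodule_cot_gr: "submodule (cot_gr k f d) A L"
proof (rule L.submoduleI)
  show "\<zero>\<^bsub>L\<^esub> \<in> cot_gr k f d" using emb_in_cot_gr(3) by (simp add: L_simps(1))
  show "cot_gr k f d \<subseteq> carrier L" by (auto simp: cot_gr_eq)
  show "\<ominus>\<^bsub>L\<^esub> x \<in> cot_gr k f d" if "x \<in> cot_gr k f d" for x
    using that by (cases rule: cot_gr_cases) (auto simp: emb_minus emb_in_cot_gr)
  show "x \<oplus>\<^bsub>L\<^esub> y \<in> cot_gr k f d" if x: "x \<in> cot_gr k f d" and y: "y \<in> cot_gr k f d" for x y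
    using x by (cases rule: cot_gr_cases; use y in \<open>cases rule: cot_gr_cases\<close>)
      (auto simp: L_simps emb_in_cot_gr)
  show "a \<odot>\<^bsub>L\<^esub> x \<in> cot_gr k f d" if "a \<in> carrier A" "x \<in> cot_gr k f d" for a x
  proof -
    from that obtain s where "a = cls s" by (auto simp: A_simps)
    with that(2) show ?thesis
      by (cases rule: cot_gr_cases) (auto simp: L_simps emb_in_cot_gr)
  qed
qed

lemma graded_module_L: "graded_module A L (cot_gr k f)"
proof (rule graded_module_two_term[OF module_L submodule_cot_gr])
  show "\<exists>x0\<in>cot_gr k f 0. \<exists>x1\<in>cot_gr k f 1. x = x0 \<oplus>\<^bsub>L\<^esub> x1" if x: "x \<in> carrier L" for x
  proof -
    obtain U V where "x = emb U V" using x by (rule L_cases)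
    then have "x = emb U (\<lambda>\<mu>. 0) \<oplus>\<^bsub>L\<^esub> emb (\<lambda>l. 0) V" by (simp add: L_simps)
    then show ?thesis using emb_in_cot_gr by blast
  qed
  show "cot_gr k f 0 \<inter> cot_gr k f 1 = {\<zero>\<^bsub>L\<^esub>}"
    by (auto simp: cot_gr_eq L_simps(1) emb_eq_iff I.zero)
qed (simp add: cot_gr_eq)

lemma fg_projective_cot_gr: "fg_projective A (L\<lparr>carrier := cot_gr k f d\<rparr>)"
proof -
  have M: "module A (L\<lparr>carrier := cot_gr k f d\<rparr>)"
    by (rule submodule.submodule_is_module[OF submodule_cot_gr module_L])
  consider "d = 0" | "d = 1" | "d \<noteq> 0" "d \<noteq> 1" by blast
  then show ?thesis
  proof cases
    case 1
    show ?thesis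
    proof (rule fg_projective_of_free[OF M])
      show "fst \<in> lin_maps A (L\<lparr>carrier := cot_gr k f d\<rparr>) (free_module A UNIV)"
        using 1 by (auto simp: lin_maps_def cot_gr_def cot_module_def sum_module_simps)
      show "(\<lambda>u. (u, \<zero>\<^bsub>free_module A {..<k}\<^esub>)) \<in> lin_maps A (free_module A UNIV) (L\<lparr>carrier := cot_gr k f d\<rparr>)"
        using 1 by (auto simp: lin_maps_def cot_gr_def cot_module_def sum_module_simps)
           (auto simp: free_module_simps A_simps fun_eq_iff)
    qed (use 1 in \<open>auto simp: cot_gr_def\<close>)
  next
    case 2
    show ?thesis
    proof (rule fg_projective_of_free[OF M])
      show "snd \<in> lin_maps A (L\<lparr>carrier := cot_gr k f d\<rparr>) (free_module A {..<k})"
        using 2 by (auto simp: lin_maps_def cot_gr_def cot_module_def sum_module_simps)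
      show "(\<lambda>v. (\<zero>\<^bsub>free_module A UNIV\<^esub>, v)) \<in> lin_maps A (free_module A {..<k}) (L\<lparr>carrier := cot_gr k f d\<rparr>)"
        using 2 by (auto simp: lin_maps_def cot_gr_def cot_module_def sum_module_simps)
           (auto simp: free_module_simps A_simps fun_eq_iff)
    qed (use 2 in \<open>auto simp: cot_gr_def\<close>)
  next
    case 3
    then have gr: "cot_gr k f d = {\<zero>\<^bsub>L\<^esub>}" by (simp add: cot_gr_eq)
    show ?thesis
    proof (rule fg_projective_of_free[OF M, of "{} :: nat set"])
      show "(\<lambda>x. \<zero>\<^bsub>free_module A ({} :: nat set)\<^esub>) \<in> lin_maps A (L\<lparr>carrier := cot_gr k f d\<rparr>) (free_module A {})"
        by (auto simp: lin_maps_def free_module_simps)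
      show "(\<lambda>x. \<zero>\<^bsub>L\<^esub>) \<in> lin_maps A (free_module A ({} :: nat set)) (L\<lparr>carrier := cot_gr k f d\<rparr>)"
        by (auto simp: lin_maps_def gr)
    qed (auto simp: gr)
  qed
qed

text \<open>
  A map on tuples of polynomials that is linear over \<open>cls\<close> is determined by the unit tuples. Stating this
  on lifts rather than on a free \<open>A\<close>-module spares the choice of representatives.
\<close>

lemma finsum_semilinear:
  fixes h :: "('j \<Rightarrow> ('n, 'k) mpoly) \<Rightarrow> 'c"
  assumes N: "module A N" and K: "finite K" and h: "\<And>U. h U \<in> carrier N"
    and add: "\<And>U W. h (\<lambda>j. U j + W j) = h U \<oplus>\<^bsub>N\<^esub> h W"
    and smult: "\<And>a U. h (\<lambda>j. a * U j) = cls a \<odot>\<^bsub>N\<^esub> h U"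
  shows "(\<Oplus>\<^bsub>N\<^esub>j\<in>K. cls (U j) \<odot>\<^bsub>N\<^esub> h (\<lambda>l. if l = j then 1 else 0)) = h (\<lambda>j. if j \<in> K then U j else 0)"
  using K
proof induction
  interpret N: module A N by fact
  case empty
  show ?case using smult[of 0 "\<lambda>_. 0"] h N.smult_l_null by (simp add: A_simps(2))
next
  interpret N: module A N by fact
  case (insert i K)
  have "(\<lambda>j. if j \<in> insert i K then U j else 0)
      = (\<lambda>j. U i * (if j = i then 1 else 0) + (if j \<in> K then U j else 0))"
    using insert.hyps(2) by (auto simp: fun_eq_iff)
  then show ?case
    using insert h by (simp add: add smult)
qed

text \<open>
  To compute the linear map with prescribed values on the basis it suffices to guess additive,
  \<open>cls\<close>-linear maps \<open>h1\<close> and \<open>h2\<close> on lifts with those values on the unit tuples. The truncation in the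
  result is there because \<open>h2\<close> may depend on entries from \<open>k\<close> on.
\<close>

lemma cot_lin_emb:
  assumes N: "module A N"
    and h1: "\<And>U. h1 U \<in> carrier N" "\<And>U W. h1 (\<lambda>j. U j + W j) = h1 U \<oplus>\<^bsub>N\<^esub> h1 W"
      "\<And>a U. h1 (\<lambda>j. a * U j) = cls a \<odot>\<^bsub>N\<^esub> h1 U"
    and h2: "\<And>V. h2 V \<in> carrier N" "\<And>V W. h2 (\<lambda>j. V j + W j) = h2 V \<oplus>\<^bsub>N\<^esub> h2 W"
      "\<And>a V. h2 (\<lambda>j. a * V j) = cls a \<odot>\<^bsub>N\<^esub> h2 V"
    and g: "\<And>i. g i = h1 (\<lambda>l. if l = i then 1 else 0)"
      "\<And>\<nu>. \<nu> < k \<Longrightarrow> g' \<nu> = h2 (\<lambda>\<mu>. if \<mu> = \<nu> then 1 else 0)"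
  shows "cot_lin k N g g' (emb U V) = h1 U \<oplus>\<^bsub>N\<^esub> h2 (\<lambda>\<mu>. if \<mu> < k then V \<mu> else 0)"
proof -
  interpret N: module A N by fact
  have "(\<Oplus>\<^bsub>N\<^esub>\<mu>\<in>{..<k}. (\<lambda>\<mu>\<in>{..<k}. cls (V \<mu>)) \<mu> \<odot>\<^bsub>N\<^esub> g' \<mu>)
      = (\<Oplus>\<^bsub>N\<^esub>\<nu>\<in>{..<k}. cls (V \<nu>) \<odot>\<^bsub>N\<^esub> h2 (\<lambda>\<mu>. if \<mu> = \<nu> then 1 else 0))"
    using h2(1) g(2) by (intro N.finsum_cong') auto
  then show ?thesis
    using finsum_semilinear[where h = h1 and K = UNIV and U = U, OF N finite h1]
      finsum_semilinear[where h = h2 and K = "{..<k}" and U = V, OF N finite_lessThan h2]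
    by (simp add: cot_lin_def emb_def g(1))
qed

lemma cot_lin_linear:
  assumes N: "module A N" and g: "\<And>i. g i \<in> carrier N" "\<And>\<nu>. \<nu> < k \<Longrightarrow> g' \<nu> \<in> carrier N"
  shows "cot_lin k N g g' \<in> lin_maps A L N"
proof -
  interpret N: module A N by fact
  define h1 where "h1 U = (\<Oplus>\<^bsub>N\<^esub>i\<in>UNIV. cls (U i) \<odot>\<^bsub>N\<^esub> g i)" for U
  define h2 where "h2 V = (\<Oplus>\<^bsub>N\<^esub>\<mu>\<in>{..<k}. cls (V \<mu>) \<odot>\<^bsub>N\<^esub> g' \<mu>)" for V :: "nat \<Rightarrow> ('n, 'k) mpoly"
  have h1: "h1 U \<in> carrier N" and h2: "h2 V \<in> carrier N" for U V
    using g by (auto simp: h1_def h2_def intro!: N.finsum_closed)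
  have val: "cot_lin k N g g' (emb U V) = h1 U \<oplus>\<^bsub>N\<^esub> h2 V" for U V
  proof -
    have "(\<Oplus>\<^bsub>N\<^esub>\<mu>\<in>{..<k}. (\<lambda>\<mu>\<in>{..<k}. cls (V \<mu>)) \<mu> \<odot>\<^bsub>N\<^esub> g' \<mu>) = h2 V"
      unfolding h2_def using g by (intro N.finsum_cong') auto
    then show ?thesis by (simp add: cot_lin_def emb_def h1_def)
  qed
  have add1: "h1 (\<lambda>l. U l + W l) = h1 U \<oplus>\<^bsub>N\<^esub> h1 W" for U W
    unfolding h1_def using g
    by (subst N.finsum_addf[symmetric]) (auto simp: A_simps(4)[symmetric] N.smult_l_distr)
  have add2: "h2 (\<lambda>l. U l + W l) = h2 U \<oplus>\<^bsub>N\<^esub> h2 W" for U W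
  proof -
    have "h2 (\<lambda>l. U l + W l) = (\<Oplus>\<^bsub>N\<^esub>\<mu>\<in>{..<k}. cls (U \<mu>) \<odot>\<^bsub>N\<^esub> g' \<mu> \<oplus>\<^bsub>N\<^esub> cls (W \<mu>) \<odot>\<^bsub>N\<^esub> g' \<mu>)"
      unfolding h2_def using g
      by (intro N.finsum_cong') (auto simp: A_simps(4)[symmetric] N.smult_l_distr)
    also have "\<dots> = h2 U \<oplus>\<^bsub>N\<^esub> h2 W"
      unfolding h2_def using g by (intro N.finsum_addf) auto
    finally show ?thesis .
  qed
  have sm1: "h1 (\<lambda>l. a * U l) = cls a \<odot>\<^bsub>N\<^esub> h1 U" for a U
    unfolding h1_def using g
    by (subst N.finsum_smult_ldistr) (auto simp: A_simps(5)[symmetric] N.smult_assoc1)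
  have sm2: "h2 (\<lambda>l. a * U l) = cls a \<odot>\<^bsub>N\<^esub> h2 U" for a U
  proof -
    have "h2 (\<lambda>l. a * U l) = (\<Oplus>\<^bsub>N\<^esub>\<mu>\<in>{..<k}. cls a \<odot>\<^bsub>N\<^esub> (cls (U \<mu>) \<odot>\<^bsub>N\<^esub> g' \<mu>))"
      unfolding h2_def using g
      by (intro N.finsum_cong') (auto simp: A_simps(5)[symmetric] N.smult_assoc1)
    also have "\<dots> = cls a \<odot>\<^bsub>N\<^esub> h2 U"
      unfolding h2_def using g by (intro N.finsum_smult_ldistr[symmetric]) auto
    finally show ?thesis .
  qed
  show ?thesis
    unfolding lin_maps_def
  proof (intro CollectI conjI ballI)
    show "cot_lin k N g g' \<in> carrier L \<rightarrow> carrier N"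
      using h1 h2 by (auto simp: L_carrier val)
    show "cot_lin k N g g' (x \<oplus>\<^bsub>L\<^esub> y) = cot_lin k N g g' x \<oplus>\<^bsub>N\<^esub> cot_lin k N g g' y"
      if x: "x \<in> carrier L" and y: "y \<in> carrier L" for x y
    proof -
      obtain U V U' V' where "x = emb U V" "y = emb U' V'" using x y by (elim L_cases)
      then show ?thesis using h1 h2 by (simp add: L_simps val add1 add2 N.M.add.m_ac)
    qed
    show "cot_lin k N g g' (a \<odot>\<^bsub>L\<^esub> x) = a \<odot>\<^bsub>N\<^esub> cot_lin k N g g' x"
      if a: "a \<in> carrier A" and x: "x \<in> carrier L" for a x
    proof -
      obtain U V s where "x = emb U V" "a = cls s" using a x by (auto simp: A_simps L_carrier)
      then show ?thesis using h1 h2 by (simp add: L_simps val sm1 sm2 N.smult_r_distr)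
    qed
  qed
qed

lemma jacobian_smult: "jacobian (\<lambda>\<mu>. a * V \<mu>) = (\<lambda>l. a * jacobian V l)"
  by (simp add: jacobian_def sum_distrib_left mult.assoc)

lemma jacobian_add: "jacobian (\<lambda>\<mu>. V \<mu> + V' \<mu>) = (\<lambda>l. jacobian V l + jacobian V' l)"
  by (simp add: jacobian_def distrib_right sum.distrib)

lemma jacobian_zero [simp]: "jacobian (\<lambda>\<mu>. 0) = (\<lambda>l. 0)"
  by (simp add: jacobian_def)

lemma jacobian_unit: "\<nu> < k \<Longrightarrow> jacobian (\<lambda>\<mu>. if \<mu> = \<nu> then 1 else 0) = grad (f \<nu>)"
  by (simp add: jacobian_def if_distrib[of "\<lambda>x. x * _"] cong: if_cong)

lemma finsum_cot_e: "(\<Oplus>\<^bsub>L\<^esub>i\<in>UNIV. cls (U i) \<odot>\<^bsub>L\<^esub> cot_e k f i) = emb U (\<lambda>\<mu>. 0)"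
  unfolding cot_e_eq
  using finsum_semilinear[where h = "\<lambda>U. emb U (\<lambda>\<mu>. 0)" and K = UNIV and U = U, OF module_L finite]
  by (simp add: L_simps)

lemma finsum_cot_eps: "(\<Oplus>\<^bsub>L\<^esub>\<nu>\<in>{..<k}. cls (V \<nu>) \<odot>\<^bsub>L\<^esub> cot_eps k f \<nu>) = emb (\<lambda>l. 0) V"
  unfolding cot_eps_eq
  using finsum_semilinear[where h = "\<lambda>V. emb (\<lambda>l. 0) V" and K = "{..<k}" and U = V, OF module_L finite_lessThan]
  by (simp add: L_simps emb_restrict)

lemma cot_diff_emb: "cot_diff k f (emb U V) = emb (jacobian V) (\<lambda>\<mu>. 0)"
proof -
  have "cot_diff k f (emb U V) = \<zero>\<^bsub>L\<^esub> \<oplus>\<^bsub>L\<^esub> emb (jacobian (\<lambda>\<mu>. if \<mu> < k then V \<mu> else 0)) (\<lambda>\<mu>. 0)"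
    unfolding cot_diff_def Let_def finsum_cot_e
    by (rule cot_lin_emb[OF module_L]) (auto simp: jacobian_smult jacobian_add jacobian_unit L_simps)
  also have "jacobian (\<lambda>\<mu>. if \<mu> < k then V \<mu> else 0) = jacobian V" by (simp add: jacobian_def)
  finally show ?thesis by simp
qed

lemma chain_complex_L: "chain_complex A L (cot_gr k f) (cot_diff k f)"
proof (intro chain_complex.intro graded_module_L chain_complex_axioms.intro)
  show "cot_diff k f \<in> lin_maps A L L"
    unfolding cot_diff_def Let_def by (intro cot_lin_linear module_L) (auto simp: finsum_cot_e)
  show "cot_diff k f x \<in> cot_gr k f (d - 1)" if "x \<in> cot_gr k f d" for x d
    using that by (cases rule: cot_gr_cases) (auto simp: cot_diff_emb emb_in_cot_gr)
  show "cot_diff k f (cot_diff k f x) = \<zero>\<^bsub>L\<^esub>" if x: "x \<in> carrier L" for x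
  proof -
    obtain U V where "x = emb U V" using x by (rule L_cases)
    then show ?thesis by (simp add: cot_diff_emb L_simps)
  qed
qed

end

section \<open>Comparison with the Kaehler differentials\<close>

context relations
begin

sublocale K: commutative_algebra A const
  by unfold_locales (simp add: quot_const_def)

abbreviation \<Omega> where "\<Omega> \<equiv> kaehler const A"
abbreviation d where "d \<equiv> kaehler_d const A"
abbreviation \<phi> where "\<phi> \<equiv> cot_to_kaehler k f"

lemma \<phi>_linear: "\<phi> \<in> lin_maps A L \<Omega>"
  unfolding cot_to_kaehler_def Let_def by (intro cot_lin_linear K.module_kaehler) auto

text \<open>
  The class in \<open>\<Omega>\<^sub>A\<close> of the one-form with coefficients \<open>U\<close>.
\<close>

definition \<omega> where "\<omega> U = \<phi> (emb U (\<lambda>\<mu>. 0))"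

lemma \<omega>_closed [simp, intro]: "\<omega> U \<in> carrier \<Omega>"
  unfolding \<omega>_def by (intro lin_mapsD(1)[OF \<phi>_linear] emb_closed)

lemma \<omega>_add: "\<omega> (\<lambda>l. U l + W l) = \<omega> U \<oplus>\<^bsub>\<Omega>\<^esub> \<omega> W"
  unfolding \<omega>_def using lin_mapsD(2)[OF \<phi>_linear emb_closed emb_closed, of U "\<lambda>\<mu>. 0" W "\<lambda>\<mu>. 0"]
  by (simp add: L_simps)

lemma \<omega>_smult: "\<omega> (\<lambda>l. a * U l) = cls a \<odot>\<^bsub>\<Omega>\<^esub> \<omega> U"
  unfolding \<omega>_def using lin_mapsD(3)[OF \<phi>_linear cls_closed emb_closed, of a U "\<lambda>\<mu>. 0"]
  by (simp add: L_simps)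

lemma \<omega>_zero [simp]: "\<omega> (\<lambda>l. 0) = \<zero>\<^bsub>\<Omega>\<^esub>"
  using lin_map_zero[OF module_L K.module_kaehler \<phi>_linear] by (simp add: \<omega>_def L_simps)

lemma \<omega>_cong: "(\<And>l. U l - W l \<in> I) \<Longrightarrow> \<omega> U = \<omega> W"
  unfolding \<omega>_def by (rule arg_cong[of _ _ \<phi>]) (simp add: emb_eq_iff I.zero)

lemma \<phi>_emb: "\<phi> (emb U V) = \<omega> U"
proof -
  have "\<phi> (emb (\<lambda>l. 0) V) = \<zero>\<^bsub>\<Omega>\<^esub>"
  proof -
    have "(\<Oplus>\<^bsub>\<Omega>\<^esub>i\<in>(UNIV :: 'n set). cls 0 \<odot>\<^bsub>\<Omega>\<^esub> d (cls (mvar i))) = \<zero>\<^bsub>\<Omega>\<^esub>"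
      by (rule K.\<Omega>.M.add.finprod_one_eqI) (simp add: A_simps(2)[symmetric])
    moreover have "(\<Oplus>\<^bsub>\<Omega>\<^esub>\<mu>\<in>{..<k}. (\<lambda>\<mu>\<in>{..<k}. cls (V \<mu>)) \<mu> \<odot>\<^bsub>\<Omega>\<^esub> \<zero>\<^bsub>\<Omega>\<^esub>) = \<zero>\<^bsub>\<Omega>\<^esub>"
      by (rule K.\<Omega>.M.add.finprod_one_eqI) simp
    ultimately show ?thesis by (simp add: cot_to_kaehler_def cot_lin_def emb_def Let_def)
  qed
  then show ?thesis
    using lin_mapsD(2)[OF \<phi>_linear emb_closed emb_closed, of U "\<lambda>\<mu>. 0" "\<lambda>l. 0" V]
    by (simp add: L_simps \<omega>_def[symmetric])
qed

lemma \<omega>_unit: "\<omega> (grad (mvar i)) = d (cls (mvar i))"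
proof -
  have "(\<Oplus>\<^bsub>\<Omega>\<^esub>j\<in>UNIV. cls (mpderiv j (mvar i)) \<odot>\<^bsub>\<Omega>\<^esub> d (cls (mvar j)))
     = (\<Oplus>\<^bsub>\<Omega>\<^esub>j\<in>UNIV. if i = j then d (cls (mvar j)) else \<zero>\<^bsub>\<Omega>\<^esub>)"
    by (rule arg_cong[of _ _ "\<lambda>g. finsum \<Omega> g UNIV"]) (auto simp: fun_eq_iff mpderiv_mvar A_simps(2,3)[symmetric])
  also have "\<dots> = d (cls (mvar i))"
    by (rule K.\<Omega>.M.add.finprod_singleton) auto
  finally have "(\<Oplus>\<^bsub>\<Omega>\<^esub>j\<in>UNIV. cls (mpderiv j (mvar i)) \<odot>\<^bsub>\<Omega>\<^esub> d (cls (mvar j))) = d (cls (mvar i))" .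
  moreover have "(\<Oplus>\<^bsub>\<Omega>\<^esub>\<mu>\<in>{..<k}. (\<lambda>\<mu>\<in>{..<k}. cls 0) \<mu> \<odot>\<^bsub>\<Omega>\<^esub> \<zero>\<^bsub>\<Omega>\<^esub>) = \<zero>\<^bsub>\<Omega>\<^esub>"
    by (rule K.\<Omega>.M.add.finprod_one_eqI) simp
  ultimately show ?thesis by (simp add: \<omega>_def cot_to_kaehler_def cot_lin_def emb_def Let_def)
qed

lemma d_const: "d (cls (mconst c)) = \<zero>\<^bsub>\<Omega>\<^esub>"
  using K.d_smult[of "\<one>\<^bsub>A\<^esub>" c] by (simp add: K.d_one quot_const_def)

lemma \<omega>_grad: "\<omega> (grad c) = d (cls c)"
proof (induction c rule: mpoly_induct)
  case (add a b)
  then show ?case by (simp add: mpderiv_add \<omega>_add A_simps(4)[symmetric] K.d_add)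
next
  case (mult a b)
  have "\<omega> (grad (a * b)) = \<omega> (\<lambda>l. b * mpderiv l a + a * mpderiv l b)"
    by (simp add: mpderiv_mult mult.commute)
  also have "\<dots> = cls b \<odot>\<^bsub>\<Omega>\<^esub> d (cls a) \<oplus>\<^bsub>\<Omega>\<^esub> cls a \<odot>\<^bsub>\<Omega>\<^esub> d (cls b)"
    by (simp add: \<omega>_add \<omega>_smult mult)
  also have "\<dots> = d (cls (a * b))" by (simp add: A_simps(5)[symmetric] K.d_mult)
  finally show ?case .
qed (simp_all add: \<omega>_unit d_const)

lemma \<omega>_generator: "\<omega> (\<lambda>l. a * mpderiv l b) = cls a \<odot>\<^bsub>\<Omega>\<^esub> d (cls b)"
  by (simp add: \<omega>_smult \<omega>_grad)

lemma \<omega>_surj: assumes "x \<in> carrier \<Omega>" shows "\<exists>U. x = \<omega> U"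
  using assms
proof (induction rule: K.kaehler_induct)
  case (generator a b)
  then have "a \<odot>\<^bsub>\<Omega>\<^esub> d b = \<omega> (\<lambda>l. rep a * mpderiv l (rep b))" by (simp add: \<omega>_generator cls_rep)
  then show ?case by (intro exI[where x = "\<lambda>l. rep a * mpderiv l (rep b)"])
next
  case (add x y)
  then obtain U W where "x = \<omega> U" "y = \<omega> W" by (elim exE)
  then have "x \<oplus>\<^bsub>\<Omega>\<^esub> y = \<omega> (\<lambda>l. U l + W l)" by (simp only: \<omega>_add)
  then show ?case by (intro exI[where x = "\<lambda>l. U l + W l"])
qed

lemma \<omega>_jacobian: "\<omega> (jacobian V) = \<zero>\<^bsub>\<Omega>\<^esub>"
proof -
  have "\<omega> (jacobian V) = \<omega> (grad (combination V))" by (intro \<omega>_cong jacobian_cong_grad)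
  also have "\<dots> = \<omega> (grad 0)"
    unfolding \<omega>_grad by (rule arg_cong[of _ _ d]) (simp add: cls_eq_iff combination_in_ideal)
  finally show ?thesis by simp
qed

text \<open>
  Exactness of the conormal sequence in the middle. Sending \<open>a\<close> to the class of the gradient of a lift
  is a well-defined derivation from \<open>A\<close> to the cokernel of \<open>\<partial>\<close>, because the gradient of an element of
  \<open>I\<close> is in the image of \<open>\<partial>\<close> modulo \<open>I\<close>. The resulting map from \<open>\<Omega>\<^sub>A\<close> to the cokernel inverts \<open>\<omega>\<close>,
  so \<open>\<omega> U = 0\<close> forces \<open>U\<close> to vanish in the cokernel.
\<close>

lemma \<omega>_kernel:
  assumes zero: "\<omega> U = \<zero>\<^bsub>\<Omega>\<^esub>"
  shows "\<exists>V. \<forall>l. U l - jacobian V l \<in> I"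
proof -
  let ?An = "free_module A (UNIV :: 'n set)"
  define c where "c U = (\<lambda>l. cls (U l))" for U :: "'n \<Rightarrow> ('n, 'k) mpoly"
  \<comment> \<open>The image of \<open>\<partial>\<close>.\<close>
  define H where "H = range (\<lambda>V. c (jacobian V))"
  interpret N0: module A ?An by (rule free_module_is_module) (rule cring_A)
  have c_simps: "c U \<oplus>\<^bsub>?An\<^esub> c W = c (\<lambda>l. U l + W l)" "cls a \<odot>\<^bsub>?An\<^esub> c U = c (\<lambda>l. a * U l)"
    "\<zero>\<^bsub>?An\<^esub> = c (\<lambda>l. 0)" for U W a
    by (simp_all add: c_def free_module_simps A_simps fun_eq_iff)
  have c_closed [simp, intro]: "c U \<in> carrier ?An" for U by (simp add: c_def free_module_simps)
  have c_minus: "\<ominus>\<^bsub>?An\<^esub> c U = c (\<lambda>l. - U l)" for U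
    by (rule N0.M.minus_equality) (simp_all add: c_simps)
  have H_sub: "submodule H A ?An"
  proof (rule N0.submoduleI)
    show "H \<subseteq> carrier ?An" by (auto simp: H_def)
    show "\<zero>\<^bsub>?An\<^esub> \<in> H" unfolding H_def c_simps by (rule image_eqI[of _ _ "\<lambda>\<mu>. 0"]) simp_all
    show "\<ominus>\<^bsub>?An\<^esub> x \<in> H" if "x \<in> H" for x
      using that jacobian_smult[of "- 1"] by (auto simp: H_def c_minus intro!: image_eqI[of _ _ "\<lambda>\<mu>. - _ \<mu>"])
    show "x \<oplus>\<^bsub>?An\<^esub> y \<in> H" if "x \<in> H" "y \<in> H" for x y
      using that by (auto simp: H_def c_simps jacobian_add[symmetric])
    show "a \<odot>\<^bsub>?An\<^esub> x \<in> H" if "a \<in> carrier A" "x \<in> H" for a x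
      using that by (auto simp: H_def A_simps c_simps jacobian_smult[symmetric])
  qed
  interpret Q: quotient_module A ?An H
    by (intro quotient_module.intro N0.module_axioms quotient_module_axioms.intro H_sub)
  let ?N = "quot_module ?An H" and ?q = "\<lambda>x. H +>\<^bsub>?An\<^esub> x"
  have q_cong: "?q (c U) = ?q (c W)" if "\<And>l. (U l - W l) - jacobian V l \<in> I" for U W V
  proof -
    have "c U \<ominus>\<^bsub>?An\<^esub> c W = c (jacobian V)"
      using that by (simp add: a_minus_def c_minus c_simps) (simp add: c_def fun_eq_iff cls_eq_iff)
    then have "c U \<ominus>\<^bsub>?An\<^esub> c W \<in> H" by (simp add: H_def)
    then show ?thesis by (simp add: Q.coset_eq_iff)
  qed
  define g where "g a = ?q (c (grad (rep a)))" for a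
  have g: "g (cls a) = ?q (c (grad a))" for a
  proof -
    obtain V where V: "rep (cls a) - a = combination V"
      using rep_cls[of a] by (auto simp: mem_gen_ideal_iff combination_def)
    have "(mpderiv l (rep (cls a)) - mpderiv l a) - jacobian V l \<in> I" for l
      using I.uminus[OF jacobian_cong_grad[of V l]] by (simp add: mpderiv_diff[symmetric] V)
    then show ?thesis unfolding g_def by (rule q_cong)
  qed
  have "\<exists>h\<in>lin_maps A \<Omega> ?N. \<forall>a\<in>carrier A. h (d a) = g a"
  proof (rule K.kaehler_universal[OF Q.quot_module_is_module, of g])
    show "g a \<in> carrier ?N" for a by (auto simp: g_def Q.quot_simps)
    fix a b assume "a \<in> carrier A"
    then obtain a' where a: "a = cls a'" by (auto simp: A_simps)
    show "g (const t \<otimes>\<^bsub>A\<^esub> a) = const t \<odot>\<^bsub>?N\<^esub> g a" for t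
      by (simp add: a quot_const_def A_simps(5) g Q.quot_smult c_simps mpderiv_mult)
    assume "b \<in> carrier A"
    then obtain b' where b: "b = cls b'" by (auto simp: A_simps)
    show "g (a \<oplus>\<^bsub>A\<^esub> b) = g a \<oplus>\<^bsub>?N\<^esub> g b"
      by (simp add: a b A_simps(4) g Q.quot_add c_simps mpderiv_add)
    show "g (a \<otimes>\<^bsub>A\<^esub> b) = b \<odot>\<^bsub>?N\<^esub> g a \<oplus>\<^bsub>?N\<^esub> a \<odot>\<^bsub>?N\<^esub> g b"
      by (simp add: a b A_simps(5) g Q.quot_add Q.quot_smult c_simps mpderiv_mult mult.commute)
  qed
  then obtain h where h: "h \<in> lin_maps A \<Omega> ?N" "\<And>a. a \<in> carrier A \<Longrightarrow> h (d a) = g a"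
    by auto
  note h_lin = lin_mapsD[OF h(1)]
  have "h (\<omega> U) = ?q (c U)" for U
  proof (induction U rule: one_form_induct)
    case (smult a V)
    then show ?case by (simp add: \<omega>_smult h_lin Q.quot_smult c_simps)
  next
    case (add V W)
    then show ?case by (simp add: \<omega>_add h_lin Q.quot_add c_simps)
  next
    case (grad i)
    show ?case by (simp add: \<omega>_unit h(2) g)
  qed
  then have "?q (c U) = h \<zero>\<^bsub>\<Omega>\<^esub>" using zero by metis
  also have "\<dots> = H"
    using lin_map_zero[OF K.module_kaehler Q.quot_module_is_module h(1)] by (simp add: Q.quot_simps)
  finally have "c U \<in> H" using Q.coset_zero_iff by simp
  then obtain V where "c U = c (jacobian V)" by (auto simp: H_def)
  then have "\<forall>l. U l - jacobian V l \<in> I" by (simp add: c_def fun_eq_iff cls_eq_iff)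
  then show ?thesis by (intro exI[where x = V])
qed

abbreviation \<delta> where "\<delta> \<equiv> cot_diff k f"
abbreviation gr where "gr \<equiv> cot_gr k f"

lemma chain_complex_concentrated: "chain_complex A \<Omega> (concentrated \<Omega>) (\<lambda>_. \<zero>\<^bsub>\<Omega>\<^esub>)"
proof (intro chain_complex.intro chain_complex_axioms.intro)
  have zero_sub: "submodule {\<zero>\<^bsub>\<Omega>\<^esub>} A \<Omega>"
    by (rule K.\<Omega>.submoduleI) (auto intro: K.\<Omega>.M.minus_equality)
  have "submodule (concentrated \<Omega> d) A \<Omega>" for d
    using zero_sub K.\<Omega>.carrier_is_submodule by (simp add: concentrated_def)
  then show "graded_module A \<Omega> (concentrated \<Omega>)"
    by (rule graded_module_two_term[OF K.module_kaehler]) (auto simp: concentrated_def)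
qed (auto simp: lin_maps_def concentrated_def)

lemma chain_map_\<phi>: "chain_map A L gr \<delta> \<Omega> (concentrated \<Omega>) (\<lambda>_. \<zero>\<^bsub>\<Omega>\<^esub>) \<phi>"
  unfolding chain_map_def
proof (intro conjI allI ballI chain_complex_L chain_complex_concentrated \<phi>_linear)
  show "\<phi> x \<in> concentrated \<Omega> d" if "x \<in> gr d" for x d
    using that by (cases rule: cot_gr_cases) (auto simp: \<phi>_emb concentrated_def)
  show "\<phi> (\<delta> x) = \<zero>\<^bsub>\<Omega>\<^esub>" if "x \<in> carrier L" for x
    using that by (auto simp: L_carrier cot_diff_emb \<phi>_emb \<omega>_jacobian)
qed

lemma boundaries_concentrated: "boundaries (concentrated \<Omega>) (\<lambda>_. \<zero>\<^bsub>\<Omega>\<^esub>) e = {\<zero>\<^bsub>\<Omega>\<^esub>}"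
  by (auto simp: boundaries_def concentrated_def)

lemma boundaries_trivial: assumes "e \<noteq> 0" shows "boundaries gr \<delta> e = {\<zero>\<^bsub>L\<^esub>}"
proof -
  have zero: "\<delta> (emb U (\<lambda>\<mu>. 0)) = \<zero>\<^bsub>L\<^esub>" for U
    by (simp add: cot_diff_emb L_simps)
  have "\<delta> y = \<zero>\<^bsub>L\<^esub>" if "y \<in> gr (e + 1)" for y
    using that by (cases rule: cot_gr_cases) (use assms zero in auto)
  moreover have "\<zero>\<^bsub>L\<^esub> \<in> boundaries gr \<delta> e"
    unfolding boundaries_def using zero emb_in_cot_gr(3)[of "e + 1"]
    by (intro image_eqI[of _ _ "emb (\<lambda>l. 0) (\<lambda>\<mu>. 0)"]) simp_all
  ultimately show ?thesis by (auto simp: boundaries_def)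
qed

text \<open>
  In degree one the target is zero and nothing but zero is a boundary, so there the claim is the injectivity of
  \<open>\<partial>\<close>, which is the alternative in the hypothesis. Degree zero is \<open>\<omega>_kernel\<close> and \<open>\<omega>_surj\<close>.
\<close>

lemma homology_iso_\<phi>:
  assumes "e \<noteq> 1 \<or> (\<forall>V. (\<forall>l. jacobian V l \<in> I) \<longrightarrow> (\<forall>\<mu><k. V \<mu> \<in> I))"
  shows "homology_iso L gr \<delta> \<Omega> (concentrated \<Omega>) (\<lambda>_. \<zero>\<^bsub>\<Omega>\<^esub>) \<phi> e"
proof (rule homology_isoI[OF chain_map_\<phi>])
  show "\<phi> x \<in> boundaries (concentrated \<Omega>) (\<lambda>_. \<zero>\<^bsub>\<Omega>\<^esub>) e \<longleftrightarrow> x \<in> boundaries gr \<delta> e"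
    if x: "x \<in> gr e" "\<delta> x = \<zero>\<^bsub>L\<^esub>" for x
    using x(1)
  proof (cases rule: cot_gr_cases)
    case (zero U)
    have "x \<in> boundaries gr \<delta> e" if "\<omega> U = \<zero>\<^bsub>\<Omega>\<^esub>"
    proof -
      from \<omega>_kernel[OF that] obtain V where "\<forall>l. U l - jacobian V l \<in> I" by blast
      then have "x = \<delta> (emb (\<lambda>l. 0) V)" by (simp add: zero cot_diff_emb emb_eq_iff I.zero)
      then show ?thesis using zero emb_in_cot_gr(2) by (auto simp: boundaries_def)
    qed
    moreover have "\<omega> U = \<zero>\<^bsub>\<Omega>\<^esub>" if "x \<in> boundaries gr \<delta> e"
    proof -
      from that obtain y where "y \<in> gr (e + 1)" "x = \<delta> y" by (auto simp: boundaries_def)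
      then obtain W V where "x = \<delta> (emb W V)" using zero by (auto simp: cot_gr_eq)
      then have "\<phi> x = \<zero>\<^bsub>\<Omega>\<^esub>" by (simp add: cot_diff_emb \<phi>_emb \<omega>_jacobian)
      then show ?thesis by (simp add: zero \<phi>_emb)
    qed
    ultimately show ?thesis by (auto simp: boundaries_concentrated zero \<phi>_emb)
  next
    case (one V)
    have "\<forall>l. jacobian V l \<in> I" using x(2) by (simp add: one cot_diff_emb L_simps emb_eq_iff)
    then have "\<forall>\<mu><k. V \<mu> \<in> I" using assms one by blast
    then have "x = \<zero>\<^bsub>L\<^esub>" by (simp add: one L_simps emb_eq_iff I.zero)
    then show ?thesis
      using one boundaries_trivial[of e] by (simp add: boundaries_concentrated L_simps(1) \<phi>_emb)
  next
    case other
    then show ?thesis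
      using boundaries_trivial[of e] by (simp add: boundaries_concentrated L_simps(1) \<phi>_emb)
  qed
  show "\<exists>x\<in>gr e. \<delta> x = \<zero>\<^bsub>L\<^esub> \<and> \<phi> x = y" if y: "y \<in> concentrated \<Omega> e" for y
  proof (cases "e = 0")
    case True
    then obtain U where "y = \<omega> U" using y \<omega>_surj by (auto simp: concentrated_def)
    then show ?thesis using True emb_in_cot_gr(1)
      by (intro bexI[of _ "emb U (\<lambda>\<mu>. 0)"]) (auto simp: cot_diff_emb \<phi>_emb L_simps)
  next
    case False
    then have "y = \<zero>\<^bsub>\<Omega>\<^esub>" using y by (simp add: concentrated_def)
    then show ?thesis using emb_in_cot_gr(3)
      by (intro bexI[of _ "emb (\<lambda>l. 0) (\<lambda>\<mu>. 0)"]) (auto simp: cot_diff_emb \<phi>_emb L_simps)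
  qed
qed

lemma radical_of_reduced:
  assumes "reduced A" shows "\<forall>b m. b ^ m \<in> I \<longrightarrow> b \<in> I"
proof (intro allI impI)
  fix b m assume bm: "b ^ m \<in> I"
  have "cls b [^]\<^bsub>A\<^esub> m = cls (b ^ m)"
    by (induction m) (simp_all add: A_simps mult.commute)
  also have "\<dots> = \<zero>\<^bsub>A\<^esub>" using bm by (simp add: A_simps cls_eq_iff)
  finally have "cls b = \<zero>\<^bsub>A\<^esub>" using assms unfolding reduced_def by blast
  then show "b \<in> I" by (simp add: A_simps cls_eq_iff)
qed

lemma quasi_isomorphism_\<phi>:
  assumes "complete_intersection k f" "reduced A"
  shows "quasi_isomorphism A L gr \<delta> \<Omega> (concentrated \<Omega>) (\<lambda>_. \<zero>\<^bsub>\<Omega>\<^esub>) \<phi>"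
proof -
  have inj: "\<forall>V. (\<forall>l. jacobian V l \<in> I) \<longrightarrow> (\<forall>\<mu><k. V \<mu> \<in> I)"
  proof (intro allI impI)
    fix V \<nu> assume V: "\<forall>l. jacobian V l \<in> I" and \<nu>: "\<nu> < k"
    show "V \<nu> \<in> I"
    proof (rule jacobian_injective_mod_ideal[OF assms(1) radical_of_reduced[OF assms(2)] _ \<nu>])
      show "(\<Sum>\<mu><k. V \<mu> * mpderiv i (f \<mu>)) \<in> I" for i
        using V by (simp add: jacobian_def)
    qed
  qed
  show ?thesis
    unfolding quasi_isomorphism_def
    by (intro conjI allI chain_map_\<phi> homology_iso_\<phi> disjI2 inj)
qed

end

section \<open>The bracket on the cotangent complex\<close>

context poisson_complete_intersection
begin

lemma bracket_zero [simp]: "bracket (\<lambda>l. 0) U = (\<lambda>l. 0)" "bracket U (\<lambda>l. 0) = (\<lambda>l. 0)"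
  by (simp_all add: bracket_def anchor_def)

lemma act_uminus_right: "act U (\<lambda>\<mu>. - V \<mu>) = (\<lambda>\<nu>. - act U V \<nu>)"
  using act_diff_right[of U "\<lambda>\<mu>. 0" V] by simp

lemma quot_bracket_cls: "quot_bracket k f P (cls s) (cls t) = cls (P s t)"
proof -
  have "cls (P s' t') = cls (P s t)" if s': "s' \<in> cls s" and t': "t' \<in> cls t" for s' t'
  proof -
    obtain a b where ab: "a \<in> I" "b \<in> I" "s' = a + s" "t' = b + t"
      using s' t' by (auto simp: cls_eq)
    have "P s' t' - P s t = P a t' + P s b" by (simp add: ab P_add_left P_add_right)
    then show ?thesis using I.add[OF P_in_ideal(1)[OF ab(1)] P_in_ideal(2)[OF ab(2)]]
      by (simp add: cls_eq_iff)
  qed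
  then have eq: "quot_bracket k f P (cls s) (cls t) = (\<Union>s'\<in>cls s. \<Union>t'\<in>cls t. cls (P s t))"
    unfolding quot_bracket_def by (intro SUP_cong refl)
  have "cls c \<noteq> {}" for c unfolding cls_eq using I.zero by blast
  then show ?thesis by (simp only: eq UN_constant if_False)
qed

text \<open>
  Defined on chosen lifts; by \<open>br_emb\<close> any other lifts give the same result. The bracket of two elements of
  degree one does not occur because it is zero.
\<close>

definition br :: "('n, 'k) cot \<Rightarrow> ('n, 'k) cot \<Rightarrow> ('n, 'k) cot" where
  "br x y =
    (let U = \<lambda>l. rep (fst x l); V = \<lambda>\<mu>. rep (snd x \<mu>); U' = \<lambda>l. rep (fst y l); V' = \<lambda>\<mu>. rep (snd y \<mu>)
     in emb (bracket U U') (\<lambda>\<nu>. act U V' \<nu> - act U' V \<nu>))"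

lemma br_emb: "br (emb U V) (emb W Y) = emb (bracket U W) (\<lambda>\<nu>. act U Y \<nu> - act W V \<nu>)"
proof -
  define lift0 where "lift0 U = (\<lambda>l. rep (cls (U l)))" for U :: "'n \<Rightarrow> ('n, 'k) mpoly"
  define lift1 where "lift1 V = (\<lambda>\<mu>. rep ((\<lambda>\<mu>\<in>{..<k}. cls (V \<mu>)) \<mu>))" for V :: "nat \<Rightarrow> ('n, 'k) mpoly"
  have l0: "lift0 U l - U l \<in> I" for U l by (simp add: lift0_def rep_cls)
  have l1: "lift1 V \<mu> - V \<mu> \<in> I" if "\<mu> < k" for V \<mu> using that by (simp add: lift1_def rep_cls)
  have cong: "act (lift0 U) (lift1 V) \<nu> - act U V \<nu> \<in> I" if "\<nu> < k" for U V \<nu>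
    by (rule act_cong[OF l0 l1 that])
  have "act (lift0 U) (lift1 Y) \<nu> - act (lift0 W) (lift1 V) \<nu> - (act U Y \<nu> - act W V \<nu>) \<in> I" if "\<nu> < k" for \<nu>
    using I.diff[OF cong[OF that, of U Y] cong[OF that, of W V]]
    by (simp add: algebra_simps)
  moreover have "bracket (lift0 U) (lift0 W) l - bracket U W l \<in> I" for l by (rule bracket_cong[OF l0 l0])
  ultimately have "emb (bracket (lift0 U) (lift0 W)) (\<lambda>\<nu>. act (lift0 U) (lift1 Y) \<nu> - act (lift0 W) (lift1 V) \<nu>)
      = emb (bracket U W) (\<lambda>\<nu>. act U Y \<nu> - act W V \<nu>)"
    by (simp add: emb_eq_iff)
  then show ?thesis by (simp add: br_def Let_def lift0_def lift1_def emb_def)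
qed

text \<open>
  The derivation of \<open>A\<close> induced by \<open>anchor U\<close>, which preserves \<open>I\<close>; it is the value of the anchor of
  \<open>L\<close> on the class of \<open>U\<close>.
\<close>

definition quot_der :: "('n \<Rightarrow> ('n, 'k) mpoly) \<Rightarrow> ('n, 'k) mpoly set \<Rightarrow> ('n, 'k) mpoly set" where
  "quot_der U = (\<lambda>a\<in>carrier A. cls (anchor U (rep a)))"

lemma quot_der_cls: "quot_der U (cls c) = cls (anchor U c)"
  using anchor_in_ideal[OF rep_cls, of U c] by (simp add: quot_der_def cls_eq_iff anchor_diff)

abbreviation DerA where "DerA \<equiv> der_module const A"
abbreviation \<rho> where "\<rho> \<equiv> cot_anchor k f P"

lemma module_DerA: "module A DerA"
  by (rule der_module_is_module[OF cring_A]) (simp add: quot_const_def)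

lemma quot_der_extensional: "quot_der U \<in> extensional (carrier A)"
  by (simp add: quot_der_def)

lemma quot_der_ext: "E \<in> extensional (carrier A) \<Longrightarrow> (\<And>c. E (cls c) = cls (anchor U c)) \<Longrightarrow> E = quot_der U"
  by (erule extensionalityI[OF _ quot_der_extensional]) (auto simp: quot_der_cls A_simps(1))

lemma quot_der_closed: "quot_der U \<in> carrier DerA"
  unfolding der_module_simps derivations_def
  using quot_der_extensional
  by (auto simp: A_simps quot_der_cls quot_const_def anchor_add anchor_mult PiE_iff)

lemma quot_der_add: "quot_der (\<lambda>l. U l + W l) = quot_der U \<oplus>\<^bsub>DerA\<^esub> quot_der W"
  by (rule quot_der_ext[symmetric]) (simp_all add: der_module_simps quot_der_cls A_simps(4) anchor_add_left)

lemma quot_der_smult: "quot_der (\<lambda>l. a * U l) = cls a \<odot>\<^bsub>DerA\<^esub> quot_der U"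
  by (rule quot_der_ext[symmetric]) (simp_all add: der_module_simps quot_der_cls A_simps(5) anchor_smult_left)

lemma unit_eq_grad: "(\<lambda>l. if l = i then 1 else 0) = grad (mvar i)"
  by (auto simp: mpderiv_mvar)

lemma \<rho>_emb: "\<rho> (emb U V) = quot_der U"
proof -
  interpret W: module A DerA by (rule module_DerA)
  have "\<rho> (emb U V) = quot_der U \<oplus>\<^bsub>DerA\<^esub> \<zero>\<^bsub>DerA\<^esub>"
    unfolding cot_anchor_def Let_def
  proof (rule cot_lin_emb[OF module_DerA quot_der_closed quot_der_add quot_der_smult])
    show "(\<lambda>a\<in>carrier A. quot_bracket k f P (cls (mvar i)) a) = quot_der (\<lambda>l. if l = i then 1 else 0)" for i
      by (rule quot_der_ext) (simp_all add: quot_bracket_cls unit_eq_grad anchor_grad)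
  qed auto
  then show ?thesis using quot_der_closed by simp
qed

lemma \<rho>_linear: "\<rho> \<in> lin_maps A L DerA"
  unfolding lin_maps_def
  by (auto simp: L_carrier \<rho>_emb quot_der_closed L_simps quot_der_add A_simps(1) quot_der_smult)

lemma quot_der_zero: "quot_der (\<lambda>l. 0) = \<zero>\<^bsub>DerA\<^esub>"
  by (rule quot_der_ext[symmetric]) (simp_all add: der_module_simps A_simps(2) anchor_def)

lemma quot_der_jacobian: "quot_der (jacobian V) = \<zero>\<^bsub>DerA\<^esub>"
  by (rule quot_der_ext[symmetric]) (simp_all add: der_module_simps A_simps(2) cls_eq_iff I.uminus anchor_jacobian)

lemma quot_der_commutator: "quot_der (bracket U W) = commutator A (quot_der U) (quot_der W)"
  by (rule quot_der_ext[symmetric]) (simp_all add: commutator_def quot_der_cls cls_diff anchor_bracket)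

lemma br_antisym:
  assumes x: "x \<in> gr m" and y: "y \<in> gr n"
  shows "br x y = \<ominus>\<^bsub>L\<^esub> sign_smult L (m * n) (br y x)"
  using x
proof (cases rule: cot_gr_cases)
  case (zero U)
  from y show ?thesis
    by (cases rule: cot_gr_cases) (auto simp: zero br_emb sign_smult_def emb_minus bracket_anti[of U])
next
  case (one V)
  from y show ?thesis
    by (cases rule: cot_gr_cases) (auto simp: one br_emb sign_smult_def emb_minus)
next
  case other
  from y show ?thesis
    by (cases rule: cot_gr_cases) (auto simp: other br_emb sign_smult_def emb_minus)
qed

text \<open>
  With three arguments of degree zero this is \<open>bracket_jacobi\<close>. With one argument of degree one it is the
  flatness of the action, up to signs, in each of the three positions. In all other cases both
  sides vanish.
\<close>

lemma br_jacobi: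
  assumes x: "x \<in> gr m" and y: "y \<in> gr n" and z: "z \<in> gr n'"
  shows "br x (br y z) = br (br x y) z \<oplus>\<^bsub>L\<^esub> sign_smult L (m * n) (br y (br x z))"
  using x
proof (cases rule: cot_gr_cases)
  case x: (zero U)
  from y show ?thesis
  proof (cases rule: cot_gr_cases)
    case y: (zero W)
    from z show ?thesis
    proof (cases rule: cot_gr_cases)
      case (zero Y)
      then show ?thesis
        using bracket_jacobi[of U W Y] by (simp add: x y br_emb sign_smult_def L_simps)
    next
      case (one V)
      have "act U (act W V) \<nu> - (act (bracket U W) V \<nu> + act W (act U V) \<nu>) \<in> I" if "\<nu> < k" for \<nu>
        using I.uminus[OF act_flat[OF that, of U W V]] by (simp add: algebra_simps)
      with one show ?thesis by (simp add: x y br_emb sign_smult_def L_simps emb_eq_iff I.zero)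
    qed (simp add: x y br_emb sign_smult_def L_simps)
  next
    case y: (one V)
    from z show ?thesis
    proof (cases rule: cot_gr_cases)
      case (zero W)
      have "act W (act U V) \<nu> - act U (act W V) \<nu> + act (bracket U W) V \<nu> \<in> I" if "\<nu> < k" for \<nu>
        using act_flat[OF that, of U W V] by (simp add: algebra_simps)
      with zero show ?thesis
        by (simp add: x y br_emb sign_smult_def L_simps emb_eq_iff I.zero act_uminus_right algebra_simps)
    qed (simp_all add: x y br_emb sign_smult_def L_simps)
  next
    case y: other
    from z show ?thesis
      by (cases rule: cot_gr_cases) (simp_all add: x y br_emb sign_smult_def L_simps)
  qed
next
  case x: (one V)
  from y show ?thesis
  proof (cases rule: cot_gr_cases)
    case y: (zero U)
    from z show ?thesis
    proof (cases rule: cot_gr_cases)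
      case (zero W)
      have "act U (act W V) \<nu> - (act (bracket U W) V \<nu> + act W (act U V) \<nu>) \<in> I" if "\<nu> < k" for \<nu>
        using I.uminus[OF act_flat[OF that, of U W V]] by (simp add: algebra_simps)
      with zero show ?thesis
        by (simp add: x y br_emb sign_smult_def L_simps emb_eq_iff I.zero act_uminus_right algebra_simps)
    qed (simp_all add: x y br_emb sign_smult_def L_simps)
  next
    case y: (one W)
    from z show ?thesis
      by (cases rule: cot_gr_cases) (simp_all add: x y br_emb sign_smult_def L_simps emb_minus)
  next
    case y: other
    from z show ?thesis
      by (cases rule: cot_gr_cases) (simp_all add: x y br_emb sign_smult_def L_simps emb_minus)
  qed
next
  case x: other
  from y show ?thesis
    by (cases rule: cot_gr_cases; use z in \<open>cases rule: cot_gr_cases\<close>)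
       (simp_all add: x br_emb sign_smult_def L_simps emb_minus)
qed

text \<open>
  For degrees zero and one, in either order, this is \<open>bracket_jacobian\<close>; for two elements of degree one it is
  \<open>act_jacobian\<close>.
\<close>

lemma br_diff:
  assumes x: "x \<in> gr m" and y: "y \<in> gr n"
  shows "\<delta> (br x y) = br (\<delta> x) y \<oplus>\<^bsub>L\<^esub> sign_smult L m (br x (\<delta> y))"
  using x
proof (cases rule: cot_gr_cases)
  case x: (zero U)
  from y show ?thesis
  proof (cases rule: cot_gr_cases)
    case (one V)
    have "jacobian (act U V) l - bracket U (jacobian V) l \<in> I" for l
      using I.uminus[OF bracket_jacobian[of U V l]] by simp
    with one show ?thesis
      by (simp add: x br_emb cot_diff_emb sign_smult_def L_simps emb_eq_iff I.zero)
  qed (simp_all add: x br_emb cot_diff_emb sign_smult_def L_simps)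
next
  case x: (one V)
  from y show ?thesis
  proof (cases rule: cot_gr_cases)
    case (zero U)
    have "jacobian (\<lambda>\<nu>. - act U V \<nu>) l - bracket (jacobian V) U l \<in> I" for l
      using bracket_jacobian[of U V l] jacobian_smult[of "- 1" "act U V"] fun_cong[OF bracket_anti[of "jacobian V" U], of l] by simp
    with zero show ?thesis
      by (simp add: x br_emb cot_diff_emb sign_smult_def L_simps emb_minus emb_eq_iff I.zero)
  next
    case (one V')
    then show ?thesis
      using I.uminus[OF act_jacobian[of _ V V']]
      by (simp add: x br_emb cot_diff_emb sign_smult_def L_simps emb_minus emb_eq_iff I.zero)
  next
    case other
    then show ?thesis by (simp add: x br_emb cot_diff_emb sign_smult_def L_simps emb_minus)
  qed
next
  case x: other
  from y show ?thesis
    by (cases rule: cot_gr_cases) (simp_all add: x br_emb cot_diff_emb sign_smult_def L_simps emb_minus)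
qed

lemma dg_lie_algebroid_L: "dg_lie_algebroid A L gr \<delta> br const \<rho>"
proof (intro dg_lie_algebroid.intro chain_complex_L dg_lie_algebroid_axioms.intro
    fg_projective_cot_gr br_antisym br_jacobi br_diff \<rho>_linear)
  show "br x y \<in> gr (m + n)" if "x \<in> gr m" "y \<in> gr n" for x y m n
    using that(1)
    by (cases rule: cot_gr_cases; use that(2) in \<open>cases rule: cot_gr_cases\<close>)
       (simp_all add: br_emb emb_in_cot_gr)
  show "br (x \<oplus>\<^bsub>L\<^esub> y) z = br x z \<oplus>\<^bsub>L\<^esub> br y z" "br x (y \<oplus>\<^bsub>L\<^esub> z) = br x y \<oplus>\<^bsub>L\<^esub> br x z"
    if "x \<in> carrier L" "y \<in> carrier L" "z \<in> carrier L" for x y z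
    using that by (auto simp: L_carrier L_simps br_emb bracket_add_left bracket_add_right act_add_left act_add_right algebra_simps)
  show "\<rho> x = \<zero>\<^bsub>DerA\<^esub>" if "x \<in> gr m" "m \<noteq> 0" for x m
    using that by (cases rule: cot_gr_cases) (auto simp: \<rho>_emb quot_der_zero)
  show "\<rho> (br x y) = commutator A (\<rho> x) (\<rho> y)" if "x \<in> carrier L" "y \<in> carrier L" for x y
    using that by (auto simp: L_carrier br_emb \<rho>_emb quot_der_commutator)
  show "\<rho> (\<delta> x) = \<zero>\<^bsub>DerA\<^esub>" if "x \<in> carrier L" for x
    using that by (auto simp: L_carrier cot_diff_emb \<rho>_emb quot_der_jacobian)
  show "br x (a \<odot>\<^bsub>L\<^esub> y) = a \<odot>\<^bsub>L\<^esub> br x y \<oplus>\<^bsub>L\<^esub> \<rho> x a \<odot>\<^bsub>L\<^esub> y"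
    if "a \<in> carrier A" "x \<in> carrier L" "y \<in> carrier L" for a x y
    using that by (auto simp: L_carrier A_simps(1) L_simps br_emb \<rho>_emb quot_der_cls bracket_leibniz act_leibniz
        act_smult_left algebra_simps)
qed

lemma br_e_e: "br (cot_e k f i) (cot_e k f j)
    = (\<Oplus>\<^bsub>L\<^esub>l\<in>UNIV. cls (mpderiv l (P (mvar i) (mvar j))) \<odot>\<^bsub>L\<^esub> cot_e k f l)"
  by (simp add: finsum_cot_e) (simp add: cot_e_eq br_emb unit_eq_grad bracket_grad)

lemma br_e_eps:
  assumes "\<mu> < k"
  shows "br (cot_e k f i) (cot_eps k f \<mu>) = (\<Oplus>\<^bsub>L\<^esub>\<nu>\<in>{..<k}. cls (Z i \<mu> \<nu>) \<odot>\<^bsub>L\<^esub> cot_eps k f \<nu>)"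
proof -
  have "act (grad (mvar i)) (\<lambda>\<mu>'. if \<mu>' = \<mu> then 1 else 0) = Z i \<mu>"
  proof
    fix \<nu>
    have "anchor (grad (mvar i)) (if \<nu> = \<mu> then 1 else 0) = 0"
      using anchor_mconst[of "grad (mvar i)" 1] by simp
    moreover have "(\<Sum>i'\<in>UNIV. \<Sum>\<mu>'<k. mpderiv i' (mvar i) * (if \<mu>' = \<mu> then 1 else 0) * Z i' \<mu>' \<nu>)
       = (\<Sum>i'\<in>UNIV. if i' = i then Z i' \<mu> \<nu> else 0)"
      using assms by (intro sum.cong refl) (simp add: mpderiv_mvar if_distrib[of "\<lambda>x. x * _"] cong: if_cong)
    ultimately show "act (grad (mvar i)) (\<lambda>\<mu>'. if \<mu>' = \<mu> then 1 else 0) \<nu> = Z i \<mu> \<nu>"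
      by (simp add: act_def)
  qed
  then show ?thesis
    by (simp add: finsum_cot_eps) (simp add: cot_e_eq cot_eps_eq br_emb unit_eq_grad)
qed

text \<open>
  The image of \<open>\<partial>\<close> is an ideal for the bracket, so the bracket descends to the cokernel \<open>\<Omega>\<^sub>A\<close>.
\<close>

lemma \<omega>_bracket_kernel: assumes "\<omega> U = \<zero>\<^bsub>\<Omega>\<^esub>" shows "\<omega> (bracket W U) = \<zero>\<^bsub>\<Omega>\<^esub>"
proof -
  obtain V where V: "\<And>l. U l - jacobian V l \<in> I" using \<omega>_kernel[OF assms] by auto
  have "bracket W (\<lambda>l. U l - jacobian V l) l \<in> I" for l by (rule bracket_in_ideal) (rule V)
  then have "\<omega> (bracket W U) = \<omega> (bracket W (jacobian V))" by (intro \<omega>_cong) (simp add: bracket_diff_right)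
  also have "\<dots> = \<omega> (jacobian (act W V))" by (intro \<omega>_cong bracket_jacobian)
  finally show ?thesis by (simp add: \<omega>_jacobian)
qed

lemma \<omega>_bracket_cong_right: assumes "\<omega> U = \<omega> U'" shows "\<omega> (bracket W U) = \<omega> (bracket W U')"
proof -
  have "\<omega> U = \<omega> (\<lambda>l. U l - U' l) \<oplus>\<^bsub>\<Omega>\<^esub> \<omega> U'" using \<omega>_add[of "\<lambda>l. U l - U' l" U'] by simp
  then have "\<omega> (\<lambda>l. U l - U' l) = \<zero>\<^bsub>\<Omega>\<^esub>" using assms
      K.\<Omega>.M.add.r_cancel_one'[of "\<omega> U'" "\<omega> (\<lambda>l. U l - U' l)"] by simp
  from \<omega>_bracket_kernel[OF this, of W] have "\<omega> (\<lambda>l. bracket W U l - bracket W U' l) = \<zero>\<^bsub>\<Omega>\<^esub>" by (simp add: bracket_diff_right)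
  then show ?thesis using \<omega>_add[of "\<lambda>l. bracket W U l - bracket W U' l" "bracket W U'"] by simp
qed

lemma \<omega>_bracket_cong: assumes "\<omega> U = \<omega> U'" "\<omega> W = \<omega> W'" shows "\<omega> (bracket U W) = \<omega> (bracket U' W')"
proof -
  have "\<omega> (\<lambda>l. - 1 * bracket W U l) = \<omega> (\<lambda>l. - 1 * bracket W U' l)"
    unfolding \<omega>_smult using \<omega>_bracket_cong_right[OF assms(1), of W] by simp
  then have "\<omega> (bracket U W) = \<omega> (bracket U' W)" using bracket_anti[of U W] bracket_anti[of U' W] by simp
  then show ?thesis using \<omega>_bracket_cong_right[OF assms(2), of U'] by simp
qed

text \<open>
  The Koszul bracket on \<open>\<Omega>\<^sub>A\<close>, computed on one-forms with polynomial coefficients.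
\<close>

definition koszul :: "(('n, 'k) mpoly set \<Rightarrow> ('n, 'k) mpoly set) set \<Rightarrow> _ \<Rightarrow> _" where
  "koszul x y = \<omega> (bracket (SOME U. \<omega> U = x) (SOME U. \<omega> U = y))"

lemma koszul_\<omega>: "koszul (\<omega> U) (\<omega> W) = \<omega> (bracket U W)"
proof -
  have "\<omega> (SOME U. \<omega> U = \<omega> V) = \<omega> V" for V
    by (rule someI[where P = "\<lambda>U. \<omega> U = \<omega> V" and x = V]) (rule refl)
  then show ?thesis unfolding koszul_def by (intro \<omega>_bracket_cong)
qed

lemma bracket_smult_grad:
  "bracket (\<lambda>l. a1 * mpderiv l a2) (\<lambda>l. b1 * mpderiv l b2) =
    (\<lambda>l. a1 * P a2 b1 * mpderiv l b2 + b1 * P a1 b2 * mpderiv l a2 + a1 * b1 * mpderiv l (P a2 b2))"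
proof -
  have "bracket (\<lambda>l. a1 * mpderiv l a2) (grad b2) = (\<lambda>l. - bracket (grad b2) (\<lambda>l. a1 * mpderiv l a2) l)"
    by (rule bracket_anti)
  also have "\<dots> = (\<lambda>l. - (a1 * mpderiv l (P b2 a2) + P b2 a1 * mpderiv l a2))"
    by (simp add: bracket_leibniz bracket_grad anchor_grad)
  also have "\<dots> = (\<lambda>l. a1 * mpderiv l (P a2 b2) + P a1 b2 * mpderiv l a2)"
    by (simp add: P_anti[of b2] mpderiv_uminus algebra_simps)
  finally show ?thesis
    by (simp add: bracket_leibniz anchor_smult_left anchor_grad algebra_simps)
qed

lemma koszul_bracket: "is_koszul_bracket const A (quot_bracket k f P) koszul"
  unfolding is_koszul_bracket_def Let_def
proof (intro conjI ballI)
  show "koszul x y \<in> carrier \<Omega>" for x y by (simp add: koszul_def)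
  fix x y z assume "x \<in> carrier \<Omega>" "y \<in> carrier \<Omega>" "z \<in> carrier \<Omega>"
  then obtain U W Y where "x = \<omega> U" "y = \<omega> W" "z = \<omega> Y" by (elim \<omega>_surj[THEN exE])
  then show "koszul (x \<oplus>\<^bsub>\<Omega>\<^esub> y) z = koszul x z \<oplus>\<^bsub>\<Omega>\<^esub> koszul y z"
    "koszul x (y \<oplus>\<^bsub>\<Omega>\<^esub> z) = koszul x y \<oplus>\<^bsub>\<Omega>\<^esub> koszul x z"
    by (simp_all add: koszul_\<omega> \<omega>_add[symmetric] bracket_add_left bracket_add_right)
next
  fix a1 a2 b1 b2 assume "a1 \<in> carrier A" "a2 \<in> carrier A" "b1 \<in> carrier A" "b2 \<in> carrier A"
  then obtain s1 s2 t1 t2 where s: "a1 = cls s1" "a2 = cls s2" "b1 = cls t1" "b2 = cls t2"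
    by (auto simp: A_simps(1))
  show "koszul (a1 \<odot>\<^bsub>\<Omega>\<^esub> d a2) (b1 \<odot>\<^bsub>\<Omega>\<^esub> d b2) =
      (a1 \<otimes>\<^bsub>A\<^esub> quot_bracket k f P a2 b1) \<odot>\<^bsub>\<Omega>\<^esub> d b2 \<oplus>\<^bsub>\<Omega>\<^esub>
      (b1 \<otimes>\<^bsub>A\<^esub> quot_bracket k f P a1 b2) \<odot>\<^bsub>\<Omega>\<^esub> d a2 \<oplus>\<^bsub>\<Omega>\<^esub>
      (a1 \<otimes>\<^bsub>A\<^esub> b1) \<odot>\<^bsub>\<Omega>\<^esub> d (quot_bracket k f P a2 b2)"
    unfolding s by (simp add: quot_bracket_cls A_simps(5) \<omega>_generator[symmetric] koszul_\<omega> \<omega>_add[symmetric] bracket_smult_grad)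
qed

lemma \<phi>_br:
  assumes K: "is_koszul_bracket const A (quot_bracket k f P) K" and xy: "x \<in> carrier L" "y \<in> carrier L"
  shows "\<phi> (br x y) = K (\<phi> x) (\<phi> y)"
proof -
  obtain U V W Y where "x = emb U V" "y = emb W Y" using xy by (auto simp: L_carrier)
  then show ?thesis
    using K.koszul_bracket_unique[OF K koszul_bracket \<omega>_closed \<omega>_closed, of U W]
    by (simp add: br_emb \<phi>_emb koszul_\<omega>)
qed

end

section \<open>Internal degrees\<close>

context relations
begin

lemma emb_in_cot_internal:
  "(\<And>l. homogeneous w (m - int (w l)) (U l)) \<Longrightarrow> (\<And>\<mu>. \<mu> < k \<Longrightarrow> homogeneous w (m - int (df \<mu>)) (V \<mu>))
    \<Longrightarrow> emb U V \<in> cot_internal k f w df m"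
  using emb_closed[of U V] unfolding cot_internal_def by (auto simp: emb_def)

lemma cot_internal_cases:
  assumes "x \<in> cot_internal k f w df m"
  obtains U V where "x = emb U V" "\<And>l. homogeneous w (m - int (w l)) (U l)"
    "\<And>\<mu>. \<mu> < k \<Longrightarrow> homogeneous w (m - int (df \<mu>)) (V \<mu>)"
proof -
  obtain u v where x: "x = (u, v)" "(u, v) \<in> carrier L"
    and u: "\<forall>i. \<exists>s. homogeneous w (m - int (w i)) s \<and> u i = cls s"
    and v: "\<forall>\<mu>. \<mu> < k \<longrightarrow> (\<exists>s. homogeneous w (m - int (df \<mu>)) s \<and> v \<mu> = cls s)"
    using assms unfolding cot_internal_def by auto
  obtain U where U: "\<And>i. homogeneous w (m - int (w i)) (U i)" "\<And>i. u i = cls (U i)"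
    using choice[OF u] by auto
  have "\<forall>\<mu>. \<exists>s. \<mu> < k \<longrightarrow> homogeneous w (m - int (df \<mu>)) s \<and> v \<mu> = cls s" using v by blast
  from choice[OF this] obtain V where
    V: "\<And>\<mu>. \<mu> < k \<Longrightarrow> homogeneous w (m - int (df \<mu>)) (V \<mu>)" "\<And>\<mu>. \<mu> < k \<Longrightarrow> v \<mu> = cls (V \<mu>)"
    by auto
  have "v \<in> extensional {..<k}" using x(2) by (auto simp: L_carrier emb_def)
  then have "x = emb U V" using U V by (auto simp: x(1) emb_def extensional_def fun_eq_iff)
  with that U V show ?thesis by blast
qed

lemma homogeneous_jacobian:
  assumes "\<And>\<mu>. \<mu> < k \<Longrightarrow> homogeneous w (int (df \<mu>)) (f \<mu>)"
    and "\<And>\<mu>. \<mu> < k \<Longrightarrow> homogeneous w (m - int (df \<mu>)) (V \<mu>)"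
  shows "homogeneous w (m - int (w l)) (jacobian V l)"
  unfolding jacobian_def
proof (rule homogeneous_sum)
  fix \<mu> assume "\<mu> \<in> {..<k}"
  then have "homogeneous w ((m - int (df \<mu>)) + (int (df \<mu>) - int (w l))) (V \<mu> * mpderiv l (f \<mu>))"
    using assms by (intro homogeneous_mult homogeneous_mpderiv) auto
  then show "homogeneous w (m - int (w l)) (V \<mu> * mpderiv l (f \<mu>))" by simp
qed

lemma cot_diff_internal:
  assumes "\<And>\<mu>. \<mu> < k \<Longrightarrow> homogeneous w (int (df \<mu>)) (f \<mu>)" "x \<in> cot_internal k f w df m"
  shows "\<delta> x \<in> cot_internal k f w df m"
  using assms(2)
  by (rule cot_internal_cases) (auto simp: cot_diff_emb intro!: emb_in_cot_internal homogeneous_jacobian[OF assms(1)])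

end

context poisson_complete_intersection
begin

lemma homogeneous_anchor:
  assumes P: "respects_internal_degree w p P"
    and U: "\<And>l. homogeneous w (m - int (w l)) (U l)" and c: "homogeneous w n c"
  shows "homogeneous w (m + n + p) (anchor U c)"
  unfolding anchor_def
proof (rule homogeneous_sum)
  fix i
  have "homogeneous w (int (w i) + n + p) (P (mvar i) c)"
    using P c homogeneous_mvar unfolding respects_internal_degree_def by blast
  from homogeneous_mult[OF U[of i] this] show "homogeneous w (m + n + p) (U i * P (mvar i) c)"
    by (simp add: algebra_simps)
qed

lemma homogeneous_bracket:
  assumes P: "respects_internal_degree w p P"
    and U: "\<And>l. homogeneous w (m - int (w l)) (U l)" and W: "\<And>l. homogeneous w (n - int (w l)) (W l)"
  shows "homogeneous w (m + n + p - int (w l)) (bracket U W l)"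
  unfolding bracket_def
proof (intro homogeneous_add homogeneous_diff homogeneous_sum)
  show "homogeneous w (m + n + p - int (w l)) (anchor U (W l))"
    using homogeneous_anchor[OF P U W[of l]] by (simp add: algebra_simps)
  show "homogeneous w (m + n + p - int (w l)) (anchor W (U l))"
    using homogeneous_anchor[OF P W U[of l]] by (simp add: algebra_simps)
  fix i j
  have "homogeneous w (int (w i) + int (w j) + p) (P (mvar i) (mvar j))"
    using P homogeneous_mvar unfolding respects_internal_degree_def by blast
  from homogeneous_mult[OF homogeneous_mult[OF U[of i] W[of j]] homogeneous_mpderiv[OF this, of l]]
  show "homogeneous w (m + n + p - int (w l)) (U i * W j * mpderiv l (P (mvar i) (mvar j)))"
    by (simp add: algebra_simps)
qed

lemma homogeneous_act:
  assumes P: "respects_internal_degree w p P"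
    and Zh: "\<And>i \<mu> \<nu>. \<mu> < k \<Longrightarrow> \<nu> < k \<Longrightarrow>
      homogeneous w (int (w i) + int (df \<mu>) + p - int (df \<nu>)) (Z i \<mu> \<nu>)"
    and U: "\<And>l. homogeneous w (m - int (w l)) (U l)"
    and V: "\<And>\<mu>. \<mu> < k \<Longrightarrow> homogeneous w (n - int (df \<mu>)) (V \<mu>)" and \<nu>: "\<nu> < k"
  shows "homogeneous w (m + n + p - int (df \<nu>)) (act U V \<nu>)"
  unfolding act_def
proof (intro homogeneous_add homogeneous_sum)
  show "homogeneous w (m + n + p - int (df \<nu>)) (anchor U (V \<nu>))"
    using homogeneous_anchor[OF P U V[OF \<nu>]] by (simp add: algebra_simps)
  fix i \<mu> assume "\<mu> \<in> {..<k}"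
  then have "\<mu> < k" by simp
  from homogeneous_mult[OF homogeneous_mult[OF U[of i] V[OF this]] Zh[OF this \<nu>, of i]]
  show "homogeneous w (m + n + p - int (df \<nu>)) (U i * V \<mu> * Z i \<mu> \<nu>)" by (simp add: algebra_simps)
qed

lemma br_internal:
  assumes P: "respects_internal_degree w p P"
    and Zh: "\<And>i \<mu> \<nu>. \<mu> < k \<Longrightarrow> \<nu> < k \<Longrightarrow>
      homogeneous w (int (w i) + int (df \<mu>) + p - int (df \<nu>)) (Z i \<mu> \<nu>)"
    and x: "x \<in> cot_internal k f w df m" and y: "y \<in> cot_internal k f w df n"
  shows "br x y \<in> cot_internal k f w df (m + n + p)"
proof -
  from x obtain U V where x: "x = emb U V" and U: "\<And>l. homogeneous w (m - int (w l)) (U l)"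
    and V: "\<And>\<mu>. \<mu> < k \<Longrightarrow> homogeneous w (m - int (df \<mu>)) (V \<mu>)" by (rule cot_internal_cases) (rule that)
  from y obtain W Y where y: "y = emb W Y" and W: "\<And>l. homogeneous w (n - int (w l)) (W l)"
    and Y: "\<And>\<mu>. \<mu> < k \<Longrightarrow> homogeneous w (n - int (df \<mu>)) (Y \<mu>)" by (rule cot_internal_cases) (rule that)
  show ?thesis
    unfolding x y br_emb
  proof (intro emb_in_cot_internal homogeneous_bracket[OF P U W] homogeneous_diff)
    fix \<nu> assume \<nu>: "\<nu> < k"
    show "homogeneous w (m + n + p - int (df \<nu>)) (act U Y \<nu>)" by (rule homogeneous_act[OF P Zh U Y \<nu>])
    show "homogeneous w (m + n + p - int (df \<nu>)) (act W V \<nu>)"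
      using homogeneous_act[OF P Zh W V \<nu>] by (simp add: add.commute)
  qed
qed

end

section \<open>The dg Lie algebroid of a Poisson complete intersection\<close>

theorem theorem3p7:
  fixes P :: "('n::finite, 'k::field_char_0) mpoly \<Rightarrow> ('n, 'k) mpoly \<Rightarrow> ('n, 'k) mpoly"
    and w :: "'n \<Rightarrow> nat" and p :: int
    and k :: nat and f :: "nat \<Rightarrow> ('n, 'k) mpoly" and df :: "nat \<Rightarrow> nat"
    and Z :: "'n \<Rightarrow> nat \<Rightarrow> nat \<Rightarrow> ('n, 'k) mpoly"
  assumes "\<forall>i. w i \<ge> 1"
    and "poisson_bracket P"
    and "respects_internal_degree w p P"
    and "\<forall>\<mu><k. homogeneous w (int (df \<mu>)) (f \<mu>)"
    and "poisson_ideal P (gen_ideal k f)"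
    and "\<forall>i. \<forall>\<mu><k. P (mvar i) (f \<mu>) = (\<Sum>\<nu><k. Z i \<mu> \<nu> * f \<nu>)"
    and "complete_intersection k f"
  shows "let A = quot_alg k f; cls = quot_cls k f; \<iota> = quot_const k f;
             L = cot_module k f; gr = cot_gr k f; \<delta> = cot_diff k f;
             e = cot_e k f; \<epsilon> = cot_eps k f; \<rho> = cot_anchor k f P;
             \<Omega> = kaehler \<iota> A; \<phi> = cot_to_kaehler k f
         in (\<exists>br.
               dg_lie_algebroid A L gr \<delta> br \<iota> \<rho> \<and>
               (\<forall>i j. br (e i) (e j) =
                  (\<Oplus>\<^bsub>L\<^esub>l\<in>UNIV. cls (mpderiv l (P (mvar i) (mvar j))) \<odot>\<^bsub>L\<^esub> e l)) \<and>
               (\<forall>i. \<forall>\<mu><k. br (e i) (\<epsilon> \<mu>) = (\<Oplus>\<^bsub>L\<^esub>\<nu>\<in>{..<k}. cls (Z i \<mu> \<nu>) \<odot>\<^bsub>L\<^esub> \<epsilon> \<nu>)) \<and>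
               (\<exists>K. is_koszul_bracket \<iota> A (quot_bracket k f P) K) \<and>
               (\<forall>K. is_koszul_bracket \<iota> A (quot_bracket k f P) K \<longrightarrow>
                  (\<forall>x\<in>carrier L. \<forall>y\<in>carrier L. \<phi> (br x y) = K (\<phi> x) (\<phi> y))) \<and>
               ((\<forall>i. \<forall>\<mu><k. \<forall>\<nu><k.
                   homogeneous w (int (w i) + int (df \<mu>) + p - int (df \<nu>)) (Z i \<mu> \<nu>)) \<longrightarrow>
                (\<forall>d d'. \<forall>x\<in>cot_internal k f w df d. \<forall>y\<in>cot_internal k f w df d'.
                   br x y \<in> cot_internal k f w df (d + d' + p)))) \<and>
            (\<forall>d. \<forall>x\<in>cot_internal k f w df d. \<delta> x \<in> cot_internal k f w df d) \<and>
            chain_map A L gr \<delta> \<Omega> (concentrated \<Omega>) (\<lambda>_. \<zero>\<^bsub>\<Omega>\<^esub>) \<phi> \<and>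
            (\<forall>d. d \<noteq> 1 \<longrightarrow> homology_iso L gr \<delta> \<Omega> (concentrated \<Omega>) (\<lambda>_. \<zero>\<^bsub>\<Omega>\<^esub>) \<phi> d) \<and>
            (reduced A \<longrightarrow> quasi_isomorphism A L gr \<delta> \<Omega> (concentrated \<Omega>) (\<lambda>_. \<zero>\<^bsub>\<Omega>\<^esub>) \<phi>)"
proof -
  interpret poisson_complete_intersection P k f Z
    by unfold_locales (use assms in auto)
  show ?thesis
    unfolding Let_def
  proof (intro conjI exI[of _ br] allI ballI impI)
    show "\<exists>K. is_koszul_bracket const A (quot_bracket k f P) K"
      using koszul_bracket by (rule exI[where x = koszul])
    show "\<phi> (br x y) = K (\<phi> x) (\<phi> y)"
      if "is_koszul_bracket const A (quot_bracket k f P) K" "x \<in> carrier L" "y \<in> carrier L" for K x y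
      using that by (rule \<phi>_br)
    show "br x y \<in> cot_internal k f w df (m + n + p)"
      if "\<forall>i. \<forall>\<mu><k. \<forall>\<nu><k. homogeneous w (int (w i) + int (df \<mu>) + p - int (df \<nu>)) (Z i \<mu> \<nu>)"
        "x \<in> cot_internal k f w df m" "y \<in> cot_internal k f w df n" for m n x y
      using that by (intro br_internal[OF assms(3)]) auto
    show "\<delta> x \<in> cot_internal k f w df m" if "x \<in> cot_internal k f w df m" for m x
      using assms(4) that by (intro cot_diff_internal) auto
    show "homology_iso L gr \<delta> \<Omega> (concentrated \<Omega>) (\<lambda>_. \<zero>\<^bsub>\<Omega>\<^esub>) \<phi> m" if "m \<noteq> 1" for m
      using that by (intro homology_iso_\<phi> disjI1)
    show "quasi_isomorphism A L gr \<delta> \<Omega> (concentrated \<Omega>) (\<lambda>_. \<zero>\<^bsub>\<Omega>\<^esub>) \<phi>" if "reduced A"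
      using assms(7) that by (rule quasi_isomorphism_\<phi>)
  qed (simp_all add: dg_lie_algebroid_L br_e_e br_e_eps chain_map_\<phi>)
qed

end
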